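(* Let $\mathcal{A}$ be diagonalizable with a Riesz basis of eigenvectors $(\varphi_n^i)_{(i,n)\in\{1,\dots,m\}\times\mathbb{N}^*}$ and eigenvalues $\lambda_n^i$ as described in the context, and assume that there are $(\alpha_1,\dots,\alpha_m)\in(1,+\infty)^m$ and $c,C>0$ such that for all $i\in\{1,\dots,m\}$ and all $n,p\in\mathbb{N}^*$ $$c\,n^{\alpha_i}\le|\lambda_n^i|+1\le C\,n^{\alpha_i},\qquad |\lambda_n^i-\lambda_p^i|\ge c\,n^{\alpha_i-1}|n-p|.$$ Let $\vec\alpha=(\alpha_1,\dots,\alpha_m)$, $\vec\beta=(\beta_1,\dots,\beta_m)\in\mathbb{R}^m$, $(\gamma_1,\dots,\gamma_m)\in[0,(\alpha_1-1)/2)\times\cdots\times[0,(\alpha_m-1)/2)$, and $B=(B_1,\dots,B_m)\in\mathcal{H}_1^{\beta_1-\alpha_1/2}\times\cdots\times\mathcal{H}_m^{\beta_m-\alpha_m/2}$ such that there exist $c_1,c_2>0$ with $$c_1n^{-\beta_i}\le|\langle B_i,\widetilde{\varphi_n}^i\rangle|\le c_2n^{-\beta_i+\gamma_i},\qquad\forall n\in\mathbb{N}^*,\ i\in\{1,\dots,m\}.$$ Then for any $\lambda_0>0$ there exist $\lambda>\lambda_0$, a bounded linear feedback $K\in\mathcal{L}(\mathcal{H}^{\vec\beta+\vec\alpha/2},\mathbb{C}^m)$ and a mapping $T$ that is an isomorphism from $\mathcal{H}^{\vec\beta+\vec r}$ to itself for any $\vec r=(r_1,\dots,r_m)$ with $$r_i\in(1/2-\alpha_i+\gamma_i,\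 \alpha_i-1/2-\gamma_i),\quad i\in\{1,\dots,m\}.$$ Moreover $T$ maps the system $\partial_tu=\mathcal{A}u+BK(u)$ to the system $\partial_tv=\mathcal{A}v-\lambda v$. In particular, for any $\mu>0$, $\lambda_0$ can be chosen sufficiently large such that the closed-loop system $\partial_tu=\mathcal{A}u+BK(u)$ is exponentially stable with decay rate $\mu$ in $\mathcal{H}^{\vec\beta+\vec r}$ for any such $\vec r$.
   Context: $\mathbb{N}^*=\{1,2,\dots\}$. $(X,\langle\cdot,\cdot\rangle)$ is a complex Hilbert space and $\mathcal{A}:\mathcal{D}(\mathcal{A})\subset X\to X$, $\mathcal{D}(\mathcal{A})=\{f\in X:\mathcal{A}f\in X\}$, generates a $C^0$ semigroup with finite growth bound. $\mathcal{A}$ is diagonalizable: there is a Riesz basis of $X$ consisting of eigenvectors of $\mathcal{A}$, and the eigenvalues have bounded multiplicities; $m\in\mathbb{N}^*$ is the highest multiplicity. The basis is arranged as $(\varphi_n^i)_{(i,n)\in\{1,\dots,m\}\times\mathbb{N}^*}$ (a Riesz basis of $X$) with $\mathcal{A}\varphi_n^i=\lambda_n^i\varphi_n^i$ and $\lambda_n^i\ne\lambda_p^i$ for $n\ne p$; $X_i$ is the closed span of $(\varphi_n^i)_{n}$, so $X=X_1+\dots+X_m$. For $s\in\mathbb{R}$, $\mathcal{H}_i^s$ is the Hilbert space of (possibly formal) series $f=\sum_{n\in\mathbb{N}^*}f_n^i\varphi_n^i$ with $\|f\|_{\mathcal{H}_i^s}^2=\sum_nn^{2s}|f_n^i|^2<\infty$.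 For $\vec s=(s_1,\dots,s_m)\in\mathbb{R}^m$, $\mathcal{H}^{\vec s}=\mathcal{H}_1^{s_1}+\dots+\mathcal{H}_m^{s_m}$ with the corresponding Hilbert structure. $\mathcal{A}$ acts on these spaces coefficientwise by $\mathcal{A}\varphi_n^i=\lambda_n^i\varphi_n^i$. $(\widetilde{\varphi_n}^i)_n$ is the biorthogonal family of $(\varphi_n^i)_n$ in $X_i$, and for $f\in\mathcal{H}_i^s$ (any $s\in\mathbb{R}$), $\langle f,\widetilde{\varphi_n}^i\rangle=f_n^i$ is the coefficient of $f$ along $\varphi_n^i$. For $B=(B_1,\dots,B_m)$ and $K=(K_1,\dots,K_m)$ with scalar-valued $K_i$, $BK(u)=\sum_{i=1}^mB_iK_i(u)$. "$T$ maps $\partial_tu=\mathcal{A}u+BK(u)$ to $\partial_tv=\mathcal{A}v-\lambda v$" means that $T$ satisfies the operator equality $T(\mathcal{A}+BK)=(\mathcal{A}-\lambda I)T$ from $\mathcal{H}^{\vec\beta+\vec\alpha/2}$ to $\mathcal{H}^{\vec\beta-\vec\alpha/2}$ (and, by density, wherever both sides extend continuously), so that $v=Tu$ solves the second system when $u$ solves the first one, and conversely. The system $\partial_tu=\mathcal{A}u+BK(u)$ is exponentially stable with decay rate $\mu>0$ in a space $H$ (here $H=\mathcal{H}^{\vec\beta+\vec r}$) if $\mathcal{A}+BK$, with domain $\{f\in H:(\mathcal{A}+BK)f\in H\}$, generates a $C^0$ semigroup on $H$ and there is $C>0$ such that for every $u_0\in H$ the unique solution $u\in C^0([0,+\infty),H)$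 with $u(0)=u_0$ satisfies $\|u(t)\|_H\le Ce^{-\mu t}\|u_0\|_H$ for all $t\ge0$. Here $K$ is identified with its continuous extension to any larger space $\mathcal{H}^{\vec\sigma}$ on which it is bounded. *)

theory Defs
  imports "HOL-Analysis.Analysis" "HOL-Library.Function_Algebras"
begin

class scaleC =
  fixes scaleC :: "complex \<Rightarrow> 'a \<Rightarrow> 'a"  (infixr \<open>*\<^sub>C\<close> 75)

class complex_vector = ab_group_add + scaleC +
  assumes scaleC_right_distrib: "c *\<^sub>C (x + y) = c *\<^sub>C x + c *\<^sub>C y"
    and scaleC_left_distrib: "(c + d) *\<^sub>C x = c *\<^sub>C x + d *\<^sub>C x"
    and scaleC_scaleC: "c *\<^sub>C (d *\<^sub>C x) = (c * d) *\<^sub>C x"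
    and scaleC_one: "1 *\<^sub>C x = x"

global_interpretation complex_vector:
  vector_space "scaleC :: complex \<Rightarrow> 'a \<Rightarrow> 'a::complex_vector"
  by unfold_locales
    (simp_all add: scaleC_right_distrib scaleC_left_distrib scaleC_scaleC scaleC_one)

instantiation complex :: complex_vector
begin
definition "c *\<^sub>C z = c * z" for c z :: complex
instance by standard (simp_all add: scaleC_complex_def algebra_simps)
end

instantiation "fun" :: (type, complex_vector) complex_vector
begin
definition "c *\<^sub>C f = (\<lambda>x. c *\<^sub>C f x)" for f :: "'a \<Rightarrow> 'b"
instance
  by standard (simp_all add: scaleC_fun_def fun_eq_iff scaleC_right_distrib
      scaleC_left_distrib scaleC_scaleC scaleC_one)
end

instantiation vec :: (complex_vector, finite) complex_vector
begin
definition "c *\<^sub>C v = (\<chi> i. c *\<^sub>C (v $ i))" for v :: "'a^'b"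
instance
  by standard (simp_all add: scaleC_vec_def vec_eq_iff scaleC_right_distrib
      scaleC_left_distrib scaleC_scaleC scaleC_one)
end

class complex_hilbert = complex_vector + banach +
  fixes cinner :: "'a \<Rightarrow> 'a \<Rightarrow> complex"
  assumes scaleR_scaleC: "r *\<^sub>R x = complex_of_real r *\<^sub>C x"
    and cinner_commute: "cinner x y = cnj (cinner y x)"
    and cinner_add_left: "cinner (x + y) z = cinner x z + cinner y z"
    and cinner_scaleC_left: "cinner (c *\<^sub>C x) y = c * cinner x y"
    and cinner_self: "cinner x x = complex_of_real ((norm x)\<^sup>2)"

text \<open>
  A normed space is given by its carrier \<open>V\<close>, a linear subspace of the ambient type, and its
  norm \<open>N\<close>. This covers the state space \<open>X\<close> (carrier \<^term>\<open>UNIV\<close>, norm \<^term>\<open>norm\<close>) as well as the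
  spaces of formal series below, whose norm depends on a real exponent.
\<close>

definition bounded_clinear_on ::
  "'a::complex_vector set \<Rightarrow> ('a \<Rightarrow> real) \<Rightarrow> 'b::complex_vector set \<Rightarrow> ('b \<Rightarrow> real)
     \<Rightarrow> ('a \<Rightarrow> 'b) \<Rightarrow> bool" where
  "bounded_clinear_on V N W M F \<longleftrightarrow>
     (\<forall>f\<in>V. F f \<in> W) \<and>
     (\<forall>f\<in>V. \<forall>g\<in>V. F (f + g) = F f + F g) \<and>
     (\<forall>c. \<forall>f\<in>V. F (c *\<^sub>C f) = c *\<^sub>C F f) \<and>
     (\<exists>C. \<forall>f\<in>V. M (F f) \<le> C * N f)"

definition isomorphism_on ::
  "'a::complex_vector set \<Rightarrow> ('a \<Rightarrow> real) \<Rightarrow> 'b::complex_vector set \<Rightarrow> ('b \<Rightarrow> real)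
     \<Rightarrow> ('a \<Rightarrow> 'b) \<Rightarrow> bool" where
  "isomorphism_on V N W M F \<longleftrightarrow>
     bounded_clinear_on V N W M F \<and>
     (\<exists>G. bounded_clinear_on W M V N G \<and> (\<forall>f\<in>V. G (F f) = f) \<and> (\<forall>g\<in>W. F (G g) = g))"

definition c0_semigroup ::
  "'a::complex_vector set \<Rightarrow> ('a \<Rightarrow> real) \<Rightarrow> (real \<Rightarrow> 'a \<Rightarrow> 'a) \<Rightarrow> bool" where
  "c0_semigroup V N S \<longleftrightarrow>
     (\<forall>t\<ge>0. bounded_clinear_on V N V N (S t)) \<and>
     (\<forall>f\<in>V. S 0 f = f) \<and>
     (\<forall>s\<ge>0. \<forall>t\<ge>0. \<forall>f\<in>V. S (s + t) f = S s (S t f)) \<and>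
     (\<forall>f\<in>V. ((\<lambda>t. N (S t f - f)) \<longlongrightarrow> 0) (at_right 0))"

text \<open>
  The unbounded operator \<open>A\<close> with domain \<open>D\<close> (values of \<open>A\<close> outside \<open>D\<close> are irrelevant) is the
  infinitesimal generator of \<open>S\<close>, with \<open>D\<close> being exactly the domain of the generator.
\<close>

definition generates ::
  "'a::complex_vector set \<Rightarrow> ('a \<Rightarrow> real) \<Rightarrow> 'a set \<Rightarrow> ('a \<Rightarrow> 'a) \<Rightarrow> (real \<Rightarrow> 'a \<Rightarrow> 'a) \<Rightarrow> bool" where
  "generates V N D A S \<longleftrightarrow>
     c0_semigroup V N S \<and> D \<subseteq> V \<and> A ` D \<subseteq> V \<and>
     (\<forall>f\<in>V. \<forall>g\<in>V. f \<in> D \<and> A f = g \<longleftrightarrow>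
        ((\<lambda>h. N (complex_of_real (1 / h) *\<^sub>C (S h f - f) - g)) \<longlongrightarrow> 0) (at_right 0))"

definition finite_growth_bound ::
  "'a::complex_vector set \<Rightarrow> ('a \<Rightarrow> real) \<Rightarrow> (real \<Rightarrow> 'a \<Rightarrow> 'a) \<Rightarrow> bool" where
  "finite_growth_bound V N S \<longleftrightarrow>
     (\<exists>M \<omega>. \<forall>t\<ge>0. \<forall>f\<in>V. N (S t f) \<le> M * exp (\<omega> * t) * N f)"

text \<open>
  The solution in \<open>C\<^sup>0([0,\<infinity>), V)\<close> with initial state \<open>u0\<close> of the evolution equation of a
  generator is the orbit \<open>t \<mapsto> S t u0\<close>.
\<close>

definition exponentially_stable ::
  "'a::complex_vector set \<Rightarrow> ('a \<Rightarrow> real) \<Rightarrow> 'a set \<Rightarrow> ('a \<Rightarrow> 'a) \<Rightarrow> real \<Rightarrow> bool" where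
  "exponentially_stable V N D A \<mu> \<longleftrightarrow>
     (\<exists>S. generates V N D A S \<and>
        (\<exists>C>0. \<forall>u0\<in>V. \<forall>t\<ge>0. N (S t u0) \<le> C * exp (- \<mu> * t) * N u0))"

definition orthonormal_basis :: "('j \<Rightarrow> 'a::complex_hilbert) \<Rightarrow> bool" where
  "orthonormal_basis e \<longleftrightarrow>
     (\<forall>j k. cinner (e j) (e k) = (if j = k then 1 else 0)) \<and>
     closure (complex_vector.span (range e)) = UNIV"

definition riesz_basis :: "('j \<Rightarrow> 'a::complex_hilbert) \<Rightarrow> bool" where
  "riesz_basis b \<longleftrightarrow>
     (\<exists>e U. orthonormal_basis e \<and> isomorphism_on (UNIV :: 'a set) norm (UNIV :: 'a set) norm U \<and>
        (\<forall>j. b j = U (e j)))"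

definition eigenspace :: "'a::complex_vector set \<Rightarrow> ('a \<Rightarrow> 'a) \<Rightarrow> complex \<Rightarrow> 'a set" where
  "eigenspace D A z = {f \<in> D. A f = z *\<^sub>C f}"

text \<open>The finite spanning set is required since \<^term>\<open>complex_vector.dim\<close> is 0 in infinite dimension.\<close>

definition highest_multiplicity :: "'a::complex_vector set \<Rightarrow> ('a \<Rightarrow> 'a) \<Rightarrow> nat \<Rightarrow> bool" where
  "highest_multiplicity D A m \<longleftrightarrow>
     (\<forall>z. (\<exists>b. finite b \<and> eigenspace D A z \<subseteq> complex_vector.span b) \<and>
          complex_vector.dim (eigenspace D A z) \<le> m) \<and>
     (\<exists>z. complex_vector.dim (eigenspace D A z) = m)"

text \<open>
  The index set \<open>{1,\<dots>,m}\<close> is the finite type \<^typ>\<open>'i\<close>. The positive integer \<open>n\<close> is represented by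
  its predecessor, so that position \<open>n :: nat\<close> in a sequence carries the weight \<^term>\<open>real (Suc n)\<close>;
  differences of indices are unaffected.
\<close>

definition diagonalizable ::
  "'a::complex_hilbert set \<Rightarrow> ('a \<Rightarrow> 'a) \<Rightarrow> ('i::finite \<Rightarrow> nat \<Rightarrow> 'a) \<Rightarrow> ('i \<Rightarrow> nat \<Rightarrow> complex) \<Rightarrow> bool"
  where
  "diagonalizable D A \<phi> lam \<longleftrightarrow>
     (\<exists>S. generates UNIV norm D A S \<and> finite_growth_bound UNIV norm S) \<and>
     D = {f. \<exists>a g. ((\<lambda>(i, n). a i n *\<^sub>C \<phi> i n) has_sum f) UNIV \<and>
                   ((\<lambda>(i, n). (lam i n * a i n) *\<^sub>C \<phi> i n) has_sum g) UNIV} \<and>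
     riesz_basis (\<lambda>(i, n). \<phi> i n) \<and>
     (\<forall>i n. \<phi> i n \<in> D \<and> A (\<phi> i n) = lam i n *\<^sub>C \<phi> i n) \<and>
     (\<forall>i n p. n \<noteq> p \<longrightarrow> lam i n \<noteq> lam i p) \<and>
     highest_multiplicity D A CARD('i)"

text \<open>
  A formal series \<open>\<Sum>\<^sub>n f\<^sub>n \<phi>\<^sub>n\<^sup>i\<close> is represented by its coefficient family, so that the pairing of
  \<open>f\<close> with the \<open>n\<close>-th element of the biorthogonal family of \<open>(\<phi>\<^sub>n\<^sup>i)\<^sub>n\<close> is \<open>f i n\<close>.
\<close>

definition hcomp :: "real \<Rightarrow> (nat \<Rightarrow> complex) set" where
  "hcomp s = {f. summable (\<lambda>n. real (Suc n) powr (2 * s) * (cmod (f n))\<^sup>2)}"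

definition hspace :: "real^'i \<Rightarrow> ('i::finite \<Rightarrow> nat \<Rightarrow> complex) set" where
  "hspace s = {f. \<forall>i. f i \<in> hcomp (s $ i)}"

definition hnorm :: "real^'i \<Rightarrow> ('i::finite \<Rightarrow> nat \<Rightarrow> complex) \<Rightarrow> real" where
  "hnorm s f =
     sqrt (\<Sum>i\<in>UNIV. \<Sum>n. real (Suc n) powr (2 * s $ i) * (cmod (f i n))\<^sup>2)"

definition diag_op ::
  "('i \<Rightarrow> nat \<Rightarrow> complex) \<Rightarrow> ('i \<Rightarrow> nat \<Rightarrow> complex) \<Rightarrow> ('i \<Rightarrow> nat \<Rightarrow> complex)" where
  "diag_op lam f = (\<lambda>i n. lam i n * f i n)"

text \<open>\<open>B\<^sub>1 y\<^sub>1 + \<dots> + B\<^sub>m y\<^sub>m\<close> for the vector \<open>y\<close> of controls; here \<open>B\<^sub>i\<close> only has an \<open>i\<close>-th component.\<close>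

definition control_op ::
  "('i \<Rightarrow> nat \<Rightarrow> complex) \<Rightarrow> complex^'i::finite \<Rightarrow> ('i \<Rightarrow> nat \<Rightarrow> complex)" where
  "control_op B y = (\<lambda>i n. B i n * y $ i)"

definition bounded_feedback ::
  "real^'i \<Rightarrow> (('i::finite \<Rightarrow> nat \<Rightarrow> complex) \<Rightarrow> complex^'i) \<Rightarrow> bool" where
  "bounded_feedback s K \<longleftrightarrow> bounded_clinear_on (hspace s) (hnorm s) UNIV norm K"

definition maps_system ::
  "('i \<Rightarrow> nat \<Rightarrow> complex) \<Rightarrow> ('i \<Rightarrow> nat \<Rightarrow> complex) \<Rightarrow> (('i::finite \<Rightarrow> nat \<Rightarrow> complex) \<Rightarrow> complex^'i)
     \<Rightarrow> real \<Rightarrow> real^'i \<Rightarrow> real^'i \<Rightarrow> (('i \<Rightarrow> nat \<Rightarrow> complex) \<Rightarrow> ('i \<Rightarrow> nat \<Rightarrow> complex)) \<Rightarrow> bool" where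
  "maps_system lam B K l s s' T \<longleftrightarrow>
     (\<forall>f\<in>hspace s.
        T (diag_op lam f + control_op B (K f)) \<in> hspace s' \<and>
        T (diag_op lam f + control_op B (K f)) = diag_op lam (T f) - complex_of_real l *\<^sub>C T f)"

text \<open>
  \<open>K'\<close> is the continuous extension of \<open>K\<close> from \<^term>\<open>hspace s\<close> to a larger space
  \<^term>\<open>hspace \<sigma>\<close>. As \<^term>\<open>hspace s\<close> is dense in \<^term>\<open>hspace \<sigma>\<close> (both contain the finite
  series, which are dense), the value of the extension at a given \<open>f\<close> depends neither on \<open>K'\<close> nor on
  \<open>\<sigma>\<close>: it is the limit of \<open>K\<close> along the truncations of \<open>f\<close>.
\<close>

definition feedback_extension ::
  "real^'i \<Rightarrow> (('i::finite \<Rightarrow> nat \<Rightarrow> complex) \<Rightarrow> complex^'i) \<Rightarrow> real^'i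
     \<Rightarrow> (('i \<Rightarrow> nat \<Rightarrow> complex) \<Rightarrow> complex^'i) \<Rightarrow> bool" where
  "feedback_extension s K \<sigma> K' \<longleftrightarrow>
     hspace s \<subseteq> hspace \<sigma> \<and> bounded_feedback \<sigma> K' \<and> (\<forall>f\<in>hspace s. K' f = K f)"

definition extended_domain ::
  "real^'i \<Rightarrow> (('i::finite \<Rightarrow> nat \<Rightarrow> complex) \<Rightarrow> complex^'i) \<Rightarrow> ('i \<Rightarrow> nat \<Rightarrow> complex) set" where
  "extended_domain s K = {f. \<exists>\<sigma> K'. feedback_extension s K \<sigma> K' \<and> f \<in> hspace \<sigma>}"

definition extended_feedback ::
  "real^'i \<Rightarrow> (('i::finite \<Rightarrow> nat \<Rightarrow> complex) \<Rightarrow> complex^'i) \<Rightarrow> ('i \<Rightarrow> nat \<Rightarrow> complex) \<Rightarrow> complex^'i" where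
  "extended_feedback s K f =
     (THE y. \<exists>\<sigma> K'. feedback_extension s K \<sigma> K' \<and> f \<in> hspace \<sigma> \<and> y = K' f)"

definition closed_loop ::
  "('i \<Rightarrow> nat \<Rightarrow> complex) \<Rightarrow> ('i \<Rightarrow> nat \<Rightarrow> complex) \<Rightarrow> real^'i
     \<Rightarrow> (('i::finite \<Rightarrow> nat \<Rightarrow> complex) \<Rightarrow> complex^'i) \<Rightarrow> ('i \<Rightarrow> nat \<Rightarrow> complex) \<Rightarrow> ('i \<Rightarrow> nat \<Rightarrow> complex)" where
  "closed_loop lam B s K f = diag_op lam f + control_op B (extended_feedback s K f)"

definition closed_loop_domain ::
  "('i \<Rightarrow> nat \<Rightarrow> complex) \<Rightarrow> ('i \<Rightarrow> nat \<Rightarrow> complex) \<Rightarrow> real^'i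
     \<Rightarrow> (('i::finite \<Rightarrow> nat \<Rightarrow> complex) \<Rightarrow> complex^'i) \<Rightarrow> real^'i \<Rightarrow> ('i \<Rightarrow> nat \<Rightarrow> complex) set" where
  "closed_loop_domain lam B s K \<rho> =
     {f \<in> hspace \<rho> \<inter> extended_domain s K. closed_loop lam B s K f \<in> hspace \<rho>}"

definition admissible_shifts :: "real^'i \<Rightarrow> real^'i \<Rightarrow> (real^'i::finite) set" where
  "admissible_shifts \<alpha> \<gamma> =
     {r. \<forall>i. r $ i \<in> {1/2 - \<alpha> $ i + \<gamma> $ i <..< \<alpha> $ i - 1/2 - \<gamma> $ i}}"

definition backstepping_pair ::
  "('i \<Rightarrow> nat \<Rightarrow> complex) \<Rightarrow> ('i \<Rightarrow> nat \<Rightarrow> complex) \<Rightarrow> real^'i \<Rightarrow> real^'i \<Rightarrow> real^'i \<Rightarrow> real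
     \<Rightarrow> (('i::finite \<Rightarrow> nat \<Rightarrow> complex) \<Rightarrow> complex^'i)
     \<Rightarrow> (('i \<Rightarrow> nat \<Rightarrow> complex) \<Rightarrow> ('i \<Rightarrow> nat \<Rightarrow> complex)) \<Rightarrow> bool" where
  "backstepping_pair lam B \<alpha> \<beta> \<gamma> l K T \<longleftrightarrow>
     bounded_feedback (\<beta> + (1/2) *\<^sub>R \<alpha>) K \<and>
     (\<forall>r\<in>admissible_shifts \<alpha> \<gamma>.
        isomorphism_on (hspace (\<beta> + r)) (hnorm (\<beta> + r)) (hspace (\<beta> + r)) (hnorm (\<beta> + r)) T) \<and>
     maps_system lam B K l (\<beta> + (1/2) *\<^sub>R \<alpha>) (\<beta> - (1/2) *\<^sub>R \<alpha>) T"

end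

theory Submission
  imports Defs
begin

text \<open>
  Let \<open>\<Lambda>\<close> be the diagonal operator with entries \<open>lam i n\<close>. On coefficient families everything decouples
  in \<open>i\<close>, so fix one component and drop it from the notation. If \<open>T B = B\<close>, the operator equality
  \<open>T (\<Lambda> + B K) = (\<Lambda> - l) T\<close>, applied to the \<open>n\<close>-th basis vector, determines the matrix of \<open>T\<close>: with
  \<open>K f = \<Sum>\<^sub>n k\<^sub>n f\<^sub>n\<close> and \<open>\<kappa>\<^sub>n = k\<^sub>n B\<^sub>n\<close> it reads \<open>T\<^sub>p\<^sub>n = B\<^sub>p \<kappa>\<^sub>n / (B\<^sub>n (lam p - lam n - l))\<close>, and \<open>T B = B\<close>
  becomes \<open>\<Sum>\<^sub>n \<kappa>\<^sub>n / (lam p - l - lam n) = 1\<close> for all \<open>p\<close>. This is solved by partial fractions: the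
  function \<open>\<Prod>\<^sub>k (1 + l / (w - lam k))\<close> vanishes at every \<open>w = lam p - l\<close>, so one minus the function takes the
  value \<open>1\<close> there, and \<open>\<kappa>\<^sub>n\<close> is chosen as its residue at \<open>lam n\<close> (\<open>residue_sum_one\<close>). The product converges
  because \<open>\<alpha> > 1\<close> and the gaps make \<open>\<Sum>\<^sub>k 1 / \<bar>lam n - lam k\<bar>\<close> bounded in \<open>n\<close>.

  The inverse of \<open>T\<close> solves the same problem with the two systems exchanged, so it is the same matrix with
  \<open>- l\<close> in place of \<open>l\<close>; this is another partial fraction identity (\<open>residue_orthogonality\<close>). All that is
  asked of \<open>l\<close> is to avoid the countably many differences of eigenvalues.

  Boundedness on \<open>\<H>\<^sup>\<beta>\<^sup>+\<^sup>r\<close> is a Schur test (\<open>matrix_op_bounded\<close>). After conjugation with the weights the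
  entries off the diagonal are at most a constant times \<open>(p / n)\<^sup>r max(p, n)\<^sup>-\<^sup>\<theta> / \<bar>p - n\<bar>\<close> with
  \<open>\<theta> = \<alpha> - 1 - \<gamma>\<close>, and testing with \<open>n\<^sup>-\<^sup>1\<^sup>/\<^sup>2\<close> leads to sums of the kind treated in \<open>kernel_sum_bounded\<close>
  for the exponents \<open>1/2 + r\<close> and \<open>1/2 - r\<close>. Both exceed \<open>- \<theta>\<close> exactly for the admissible \<open>r\<close>.

  For the stability part the pair \<open>(K, T)\<close> is arbitrary. The operator equality itself shows that \<open>K\<close> extends to
  a larger space (\<open>feedback_extends\<close>), and then that the closed loop, with its domain, is exactly the conjugate
  by \<open>T\<close> of \<open>\<Lambda> - l\<close> (\<open>closed_loop_stable\<close>). The latter generates an explicit semigroup of rate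
  \<open>sup Re lam - l\<close>, and the supremum is finite because the original operator generates a semigroup of finite growth
  (\<open>spectral_bound\<close>).
\<close>


section \<open>Weighted sequence spaces\<close>

lemma scaleC_apply [simp]:
  fixes f :: "'i \<Rightarrow> nat \<Rightarrow> complex"
  shows "(c *\<^sub>C f) i n = c * f i n"
  by (simp add: scaleC_fun_def scaleC_complex_def)

lemma weight_pos [simp]: "real (Suc n) powr s > 0"
  by simp

lemma weight_sq:
  "real (Suc n) powr (2 * s) * (cmod z)\<^sup>2 = (real (Suc n) powr s * cmod z)\<^sup>2"
  by (simp add: power_mult_distrib powr_power mult.commute del: of_nat_Suc)

lemma hspace_iff:
  "f \<in> hspace s \<longleftrightarrow> (\<forall>i. summable (\<lambda>n. (real (Suc n) powr (s $ i) * cmod (f i n))\<^sup>2))"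
  unfolding hspace_def hcomp_def by (simp only: weight_sq mem_Collect_eq)

lemma hnorm_eq:
  "hnorm s f = sqrt (\<Sum>i\<in>UNIV. \<Sum>n. (real (Suc n) powr (s $ i) * cmod (f i n))\<^sup>2)"
  unfolding hnorm_def by (simp only: weight_sq)

lemma hnorm_nonneg: "f \<in> hspace s \<Longrightarrow> hnorm s f \<ge> 0"
  unfolding hnorm_eq hspace_iff by (intro real_sqrt_ge_zero sum_nonneg suminf_nonneg) auto

lemma hnorm_sq:
  "f \<in> hspace s \<Longrightarrow>
     (hnorm s f)\<^sup>2 = (\<Sum>i\<in>UNIV. \<Sum>n. (real (Suc n) powr (s $ i) * cmod (f i n))\<^sup>2)"
  unfolding hnorm_eq hspace_iff
  by (intro real_sqrt_pow2 sum_nonneg suminf_nonneg) auto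

lemma hspace_dominated:
  assumes f: "f \<in> hspace s" and "C \<ge> 0"
    and dom: "\<And>i n. real (Suc n) powr (s' $ i) * cmod (g i n)
                       \<le> C * (real (Suc n) powr (s $ i) * cmod (f i n))"
  shows "g \<in> hspace s'" and "hnorm s' g \<le> C * hnorm s f"
proof -
  have sf: "summable (\<lambda>n. (real (Suc n) powr (s $ i) * cmod (f i n))\<^sup>2)" for i
    using f by (simp add: hspace_iff)
  have le: "(real (Suc n) powr (s' $ i) * cmod (g i n))\<^sup>2
              \<le> C\<^sup>2 * (real (Suc n) powr (s $ i) * cmod (f i n))\<^sup>2" for i n
    unfolding power_mult_distrib[of C, symmetric] by (intro power_mono dom) simp
  have sg: "summable (\<lambda>n. (real (Suc n) powr (s' $ i) * cmod (g i n))\<^sup>2)" for i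
    by (rule summable_comparison_test'[of _ 0, OF summable_mult[OF sf[of i], of "C\<^sup>2"]])
       (use le in \<open>simp add: del: of_nat_Suc\<close>)
  show g: "g \<in> hspace s'" using sg by (simp add: hspace_iff)
  have "(\<Sum>n. (real (Suc n) powr (s' $ i) * cmod (g i n))\<^sup>2)
          \<le> C\<^sup>2 * (\<Sum>n. (real (Suc n) powr (s $ i) * cmod (f i n))\<^sup>2)" for i
    by (rule order_trans[OF suminf_le[OF le sg summable_mult[OF sf]] eq_refl[OF suminf_mult[OF sf]]])
  hence "(hnorm s' g)\<^sup>2 \<le> (C * hnorm s f)\<^sup>2"
    unfolding power_mult_distrib[of C "hnorm s f"] hnorm_sq[OF f] hnorm_sq[OF g] sum_distrib_left
    by (rule sum_mono)
  thus "hnorm s' g \<le> C * hnorm s f"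
    by (rule power2_le_imp_le) (intro mult_nonneg_nonneg \<open>C \<ge> 0\<close> hnorm_nonneg[OF f])
qed

lemma hspace_0 [simp]: "0 \<in> hspace s"
  by (simp add: hspace_iff)

lemma
  assumes f: "f \<in> hspace s"
  shows hspace_scaleC: "c *\<^sub>C f \<in> hspace s" and hnorm_scaleC: "hnorm s (c *\<^sub>C f) \<le> cmod c * hnorm s f"
  by (rule hspace_dominated[OF f, of "cmod c"]; simp add: norm_mult)+

text \<open>A crude form of the triangle inequality is all that the continuity arguments below need.\<close>

lemma
  assumes f: "f \<in> hspace s" and g: "g \<in> hspace s"
  shows hspace_add: "f + g \<in> hspace s"
    and hnorm_add: "hnorm s (f + g) \<le> 2 * (hnorm s f + hnorm s g)"
proof -
  let ?w = "\<lambda>f i n. real (Suc n) powr (s $ i) * cmod (f i n)"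
  have sf: "summable (\<lambda>n. (?w f i n)\<^sup>2)" and sg: "summable (\<lambda>n. (?w g i n)\<^sup>2)" for i
    using f g by (simp_all only: hspace_iff)
  have le: "(?w (f + g) i n)\<^sup>2 \<le> 2 * ((?w f i n)\<^sup>2 + (?w g i n)\<^sup>2)" for i n
  proof -
    have "?w (f + g) i n \<le> ?w f i n + ?w g i n"
      unfolding distrib_left[symmetric] by (intro mult_left_mono) (auto simp: norm_triangle_ineq)
    hence "(?w (f + g) i n)\<^sup>2 \<le> (?w f i n + ?w g i n)\<^sup>2"
      by (intro power_mono) auto
    also have "\<dots> \<le> 2 * ((?w f i n)\<^sup>2 + (?w g i n)\<^sup>2)"
      using sum_squares_bound[of "?w f i n" "?w g i n"] by (simp add: power2_sum)
    finally show ?thesis .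
  qed
  have sfg: "summable (\<lambda>n. 2 * ((?w f i n)\<^sup>2 + (?w g i n)\<^sup>2))" for i
    by (intro summable_mult summable_add sf sg)
  have sadd: "summable (\<lambda>n. (?w (f + g) i n)\<^sup>2)" for i
    by (rule summable_comparison_test'[of _ 0, OF sfg[of i]]) (use le in \<open>simp del: of_nat_Suc\<close>)
  show *: "f + g \<in> hspace s" unfolding hspace_iff by (intro allI sadd)
  have "(hnorm s (f + g))\<^sup>2 \<le> (\<Sum>i\<in>UNIV. \<Sum>n. 2 * ((?w f i n)\<^sup>2 + (?w g i n)\<^sup>2))"
    unfolding hnorm_sq[OF *] by (intro sum_mono suminf_le le sadd sfg)
  also have "\<dots> = 2 * ((hnorm s f)\<^sup>2 + (hnorm s g)\<^sup>2)"
    unfolding hnorm_sq[OF f] hnorm_sq[OF g] suminf_mult[OF summable_add[OF sf sg]]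
      suminf_add[OF sf sg, symmetric] by (simp only: sum.distrib sum_distrib_left distrib_left)
  also have "\<dots> \<le> (2 * (hnorm s f + hnorm s g))\<^sup>2"
    using hnorm_nonneg[OF f] hnorm_nonneg[OF g] mult_nonneg_nonneg[OF hnorm_nonneg[OF f] hnorm_nonneg[OF g]]
    by (simp add: power_mult_distrib power2_sum)
  finally show "hnorm s (f + g) \<le> 2 * (hnorm s f + hnorm s g)"
    by (rule power2_le_imp_le) (use hnorm_nonneg[OF f] hnorm_nonneg[OF g] in simp)
qed

lemma
  assumes f: "f \<in> hspace s" and g: "g \<in> hspace s"
  shows hspace_diff: "f - g \<in> hspace s"
    and hnorm_diff: "hnorm s (f - g) \<le> 2 * (hnorm s f + hnorm s g)"
proof -
  have eq: "f - g = f + (-1) *\<^sub>C g" by (simp add: fun_eq_iff)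
  show "f - g \<in> hspace s" unfolding eq by (intro hspace_add hspace_scaleC f g)
  show "hnorm s (f - g) \<le> 2 * (hnorm s f + hnorm s g)"
    unfolding eq using hnorm_add[OF f hspace_scaleC[OF g, of "-1"]] hnorm_scaleC[OF g, of "-1"] by simp
qed

lemma hnorm_diff_tendsto_0:
  assumes f: "\<And>t. f t \<in> hspace s" and g: "\<And>t. g t \<in> hspace s"
    and "((\<lambda>t. hnorm s (f t)) \<longlongrightarrow> 0) F" "((\<lambda>t. hnorm s (g t)) \<longlongrightarrow> 0) F"
  shows "((\<lambda>t. hnorm s (f t - g t)) \<longlongrightarrow> 0) F"
proof (rule tendsto_sandwich[OF _ _ tendsto_const])
  show "((\<lambda>t. 2 * (hnorm s (f t) + hnorm s (g t))) \<longlongrightarrow> 0) F"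
    by (auto intro!: tendsto_eq_intros assms)
  show "\<forall>\<^sub>F t in F. 0 \<le> hnorm s (f t - g t)"
    by (intro always_eventually allI hnorm_nonneg hspace_diff f g)
  show "\<forall>\<^sub>F t in F. hnorm s (f t - g t) \<le> 2 * (hnorm s (f t) + hnorm s (g t))"
    by (intro always_eventually allI hnorm_diff f g)
qed

lemma hspace_coord_le:
  assumes f: "f \<in> hspace s"
  shows "real (Suc n) powr (s $ i) * cmod (f i n) \<le> hnorm s f"
proof -
  let ?w = "\<lambda>i n. (real (Suc n) powr (s $ i) * cmod (f i n))\<^sup>2"
  have sf: "summable (?w i)" for i using f by (simp only: hspace_iff)
  have "?w i n \<le> (\<Sum>n. ?w i n)"
    using sum_le_suminf[OF sf, of "{n}"] by simp
  also have "\<dots> \<le> (\<Sum>i\<in>UNIV. \<Sum>n. ?w i n)"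
    by (rule member_le_sum) (use suminf_nonneg[OF sf] in simp_all)
  also have "\<dots> = (hnorm s f)\<^sup>2" by (rule hnorm_sq[OF f, symmetric])
  finally show ?thesis by (rule power2_le_imp_le) (rule hnorm_nonneg[OF f])
qed

lemma hnorm_tendsto_0_coord:
  assumes h: "\<forall>\<^sub>F t in F. h t \<in> hspace s" and lim: "((\<lambda>t. hnorm s (h t)) \<longlongrightarrow> 0) F"
  shows "((\<lambda>t. h t i n) \<longlongrightarrow> 0) F"
proof (rule Lim_null_comparison)
  let ?c = "real (Suc n) powr (- (s $ i))"
  show "\<forall>\<^sub>F t in F. norm (h t i n) \<le> ?c * hnorm s (h t)"
    using h
  proof eventually_elim
    fix t assume t: "h t \<in> hspace s"
    have "norm (h t i n) = ?c * (real (Suc n) powr (s $ i) * cmod (h t i n))"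
      by (simp add: powr_minus del: of_nat_Suc)
    also have "\<dots> \<le> ?c * hnorm s (h t)" by (intro mult_left_mono hspace_coord_le t) simp
    finally show "norm (h t i n) \<le> ?c * hnorm s (h t)" .
  qed
  show "((\<lambda>t. ?c * hnorm s (h t)) \<longlongrightarrow> 0) F"
    by (rule tendsto_eq_rhs[OF tendsto_mult_left[OF lim]]) simp
qed

text \<open>
  Dominated convergence for multipliers; it yields the density of the finite series as well as the
  differentiation of diagonal semigroups.
\<close>

lemma hnorm_multiplier_tendsto_0:
  assumes f: "f \<in> hspace s" and F: "F \<noteq> bot"
    and bound: "eventually (\<lambda>t. \<forall>i n. cmod (m t i n) \<le> C) F"
    and lim: "\<And>i n. ((\<lambda>t. m t i n) \<longlongrightarrow> 0) F"
  shows "((\<lambda>t. hnorm s (\<lambda>i n. m t i n * f i n)) \<longlongrightarrow> 0) F"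
proof -
  let ?w = "\<lambda>f i n. (real (Suc n) powr (s $ i) * cmod (f i n))\<^sup>2"
  have sf: "summable (?w f i)" for i using f by (simp only: hspace_iff)
  have "((\<lambda>t. \<Sum>n. ?w (\<lambda>i n. m t i n * f i n) i n) \<longlongrightarrow> (\<Sum>n. 0)) F" for i
  proof (rule tannerys_theorem[THEN conjunct2, THEN conjunct2])
    show "summable (\<lambda>n. C\<^sup>2 * ?w f i n)" by (intro summable_mult sf)
    show "((\<lambda>t. ?w (\<lambda>i n. m t i n * f i n) i n) \<longlongrightarrow> 0) F" for n
      by (auto intro!: tendsto_eq_intros lim simp: norm_mult)
    have "\<forall>\<^sub>F (n, t) in sequentially \<times>\<^sub>F F. (\<forall>i n. cmod (m t i n) \<le> C)"
      using bound by (subst eventually_prod2) auto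
    thus "\<forall>\<^sub>F (n, t) in at_top \<times>\<^sub>F F. norm (?w (\<lambda>i n. m t i n * f i n) i n) \<le> C\<^sup>2 * ?w f i n"
    proof (rule eventually_mono, safe)
      fix n t assume *: "\<forall>i n. cmod (m t i n) \<le> C"
      have "?w (\<lambda>i n. m t i n * f i n) i n = (cmod (m t i n))\<^sup>2 * ?w f i n"
        by (simp add: norm_mult power_mult_distrib)
      also have "\<dots> \<le> C\<^sup>2 * ?w f i n" using * by (intro mult_right_mono power_mono) auto
      finally show "norm (?w (\<lambda>i n. m t i n * f i n) i n) \<le> C\<^sup>2 * ?w f i n" by simp
    qed
  qed (fact F)
  hence "((\<lambda>t. sqrt (\<Sum>i\<in>UNIV. \<Sum>n. ?w (\<lambda>i n. m t i n * f i n) i n)) \<longlongrightarrow> sqrt (\<Sum>i\<in>(UNIV::'a set). 0)) F"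
    by (intro tendsto_intros) simp
  thus ?thesis by (simp add: hnorm_eq)
qed

lemma hspace_multiplier:
  assumes f: "f \<in> hspace s" and bound: "\<And>i n. cmod (m i n) \<le> C"
  shows "(\<lambda>i n. m i n * f i n) \<in> hspace s" and "hnorm s (\<lambda>i n. m i n * f i n) \<le> C * hnorm s f"
proof -
  have C: "C \<ge> 0" using bound[of undefined 0] norm_ge_zero order_trans by blast
  have "real (Suc n) powr (s $ i) * cmod (m i n * f i n) \<le> C * (real (Suc n) powr (s $ i) * cmod (f i n))" for i n
    using mult_right_mono[OF bound[of i n], of "real (Suc n) powr (s $ i) * cmod (f i n)"]
    by (simp add: norm_mult algebra_simps)
  from hspace_dominated[OF f C this]
  show "(\<lambda>i n. m i n * f i n) \<in> hspace s" and "hnorm s (\<lambda>i n. m i n * f i n) \<le> C * hnorm s f"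
    by auto
qed

lemma hspace_mono:
  assumes f: "f \<in> hspace s" and le: "\<And>i. s' $ i \<le> s $ i"
  shows "f \<in> hspace s'"
proof (rule hspace_dominated(1)[OF f, of 1])
  show "real (Suc n) powr (s' $ i) * cmod (f i n) \<le> 1 * (real (Suc n) powr (s $ i) * cmod (f i n))" for i n
    using le by (auto intro!: mult_right_mono powr_mono)
qed simp

section \<open>Finite series and bounded operators\<close>

definition truncation :: "nat \<Rightarrow> ('i \<Rightarrow> nat \<Rightarrow> complex) \<Rightarrow> ('i \<Rightarrow> nat \<Rightarrow> complex)" where
  "truncation M f = (\<lambda>i n. if n < M then f i n else 0)"

definition unit_series :: "'i \<Rightarrow> nat \<Rightarrow> ('i \<Rightarrow> nat \<Rightarrow> complex)" where
  "unit_series i n = (\<lambda>j p. if j = i \<and> p = n then 1 else 0)"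

lemma hspace_finite_support:
  assumes "\<And>i n. n \<ge> M \<Longrightarrow> f i n = 0"
  shows "f \<in> hspace s"
  unfolding hspace_iff
  by (intro allI summable_finite[of "{..<M}"]) (auto simp: assms)

lemma truncation_in_hspace [simp]: "truncation M f \<in> hspace s"
  by (rule hspace_finite_support[of M]) (simp add: truncation_def)

lemma unit_series_in_hspace [simp]: "unit_series i n \<in> hspace s"
  by (rule hspace_finite_support[of "Suc n"]) (auto simp: unit_series_def)

lemma truncation_tendsto:
  assumes f: "f \<in> hspace s"
  shows "(\<lambda>M. hnorm s (truncation M f - f)) \<longlonglongrightarrow> 0"
proof -
  have "(\<lambda>M. hnorm s (\<lambda>i n. (if n < M then 0 else - 1) * f i n)) \<longlonglongrightarrow> 0"
  proof (rule hnorm_multiplier_tendsto_0[OF f, where C = 1])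
    fix i n
    have "\<forall>\<^sub>F M in sequentially. n < M" by (rule eventually_gt_at_top)
    hence "\<forall>\<^sub>F M in sequentially. (if n < M then 0 else - 1) = (0::complex)"
      by eventually_elim simp
    thus "(\<lambda>M. if n < M then 0 else - 1) \<longlonglongrightarrow> (0::complex)" by (rule tendsto_eventually)
  qed auto
  moreover have "(\<lambda>i n. (if n < M then 0 else - 1) * f i n) = truncation M f - f" for M
    by (auto simp: truncation_def fun_eq_iff)
  ultimately show ?thesis by simp
qed

lemma
  assumes "bounded_clinear_on V N W M F"
  shows bounded_clinear_in: "f \<in> V \<Longrightarrow> F f \<in> W"
    and bounded_clinear_add: "f \<in> V \<Longrightarrow> g \<in> V \<Longrightarrow> F (f + g) = F f + F g"
    and bounded_clinear_scaleC: "f \<in> V \<Longrightarrow> F (c *\<^sub>C f) = c *\<^sub>C F f"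
  using assms by (auto simp: bounded_clinear_on_def)

lemma bounded_clinear_boundE:
  assumes "bounded_clinear_on V N W M F" and "\<And>f. f \<in> V \<Longrightarrow> N f \<ge> 0"
  obtains C where "C > 0" "\<And>f. f \<in> V \<Longrightarrow> M (F f) \<le> C * N f"
proof -
  obtain C where C: "\<And>f. f \<in> V \<Longrightarrow> M (F f) \<le> C * N f"
    using assms(1) unfolding bounded_clinear_on_def by blast
  have "M (F f) \<le> (\<bar>C\<bar> + 1) * N f" if "f \<in> V" for f
    using C[OF that] assms(2)[OF that] mult_right_mono[of C "\<bar>C\<bar> + 1" "N f"] by linarith
  thus ?thesis by (intro that[of "\<bar>C\<bar> + 1"]) auto
qed

lemma bounded_clinear_diff:
  fixes f g :: "'i::finite \<Rightarrow> nat \<Rightarrow> complex"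
  assumes F: "bounded_clinear_on (hspace s) (hnorm s) W M F" and f: "f \<in> hspace s" and g: "g \<in> hspace s"
  shows "F (f - g) = F f - F g"
proof -
  have "F f = F ((f - g) + g)" by simp
  also have "\<dots> = F (f - g) + F g"
    by (intro bounded_clinear_add[OF F] hspace_diff f g)
  finally show ?thesis by simp
qed

lemma bounded_clinear_comp:
  assumes F: "bounded_clinear_on U L V N F" and G: "bounded_clinear_on V N W M G"
    and "\<And>f. f \<in> V \<Longrightarrow> N f \<ge> 0"
  shows "bounded_clinear_on U L W M (\<lambda>f. G (F f))"
proof -
  obtain C where C: "C > 0" "\<And>f. f \<in> V \<Longrightarrow> M (G f) \<le> C * N f"
    using bounded_clinear_boundE[OF G assms(3)] by blast
  obtain D where D: "\<And>f. f \<in> U \<Longrightarrow> N (F f) \<le> D * L f"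
    using F unfolding bounded_clinear_on_def by blast
  have "M (G (F f)) \<le> (C * D) * L f" if "f \<in> U" for f
    using order_trans[OF C(2)[OF bounded_clinear_in[OF F that]]
        mult_left_mono[OF D[OF that] less_imp_le[OF C(1)]]] by (simp add: mult.assoc)
  thus ?thesis
    unfolding bounded_clinear_on_def
    by (intro conjI ballI allI exI[of _ "C * D"])
       (simp_all add: bounded_clinear_in[OF F] bounded_clinear_in[OF G] bounded_clinear_add[OF F]
          bounded_clinear_add[OF G] bounded_clinear_scaleC[OF F] bounded_clinear_scaleC[OF G])
qed

lemma bounded_clinear_tendsto_0:
  fixes x :: "'t \<Rightarrow> 'i::finite \<Rightarrow> nat \<Rightarrow> complex"
  assumes F: "bounded_clinear_on (hspace s) (hnorm s) (hspace s') (hnorm s') G"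
    and x: "\<forall>\<^sub>F t in F. x t \<in> hspace s" and lim: "((\<lambda>t. hnorm s (x t)) \<longlongrightarrow> 0) F"
  shows "((\<lambda>t. hnorm s' (G (x t))) \<longlongrightarrow> 0) F"
proof -
  obtain C where C: "C > 0" "\<And>g. g \<in> hspace s \<Longrightarrow> hnorm s' (G g) \<le> C * hnorm s g"
    using bounded_clinear_boundE[OF F hnorm_nonneg] by blast
  show ?thesis
  proof (rule tendsto_sandwich[OF _ _ tendsto_const])
    show "((\<lambda>t. C * hnorm s (x t)) \<longlongrightarrow> 0) F"
      by (rule tendsto_mult_right_zero[OF lim])
    show "\<forall>\<^sub>F t in F. 0 \<le> hnorm s' (G (x t))"
      using x by eventually_elim (intro hnorm_nonneg bounded_clinear_in[OF F])
    show "\<forall>\<^sub>F t in F. hnorm s' (G (x t)) \<le> C * hnorm s (x t)"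
      using x by eventually_elim (rule C(2))
  qed
qed

lemma bounded_clinear_truncation_tendsto:
  assumes F: "bounded_clinear_on (hspace s) (hnorm s) (hspace s') (hnorm s') F" and f: "f \<in> hspace s"
  shows "(\<lambda>M. F (truncation M f) i n) \<longlonglongrightarrow> F f i n"
proof -
  have d: "truncation M f - f \<in> hspace s" for M by (intro hspace_diff f) simp
  have Fd: "F (truncation M f) - F f = F (truncation M f - f)" for M
    by (rule bounded_clinear_diff[OF F _ f, symmetric]) simp
  have in': "F (truncation M f) - F f \<in> hspace s'" for M
    unfolding Fd by (intro bounded_clinear_in[OF F] d)
  have lim: "(\<lambda>M. hnorm s' (F (truncation M f) - F f)) \<longlonglongrightarrow> 0"
    unfolding Fd by (rule bounded_clinear_tendsto_0[OF F always_eventually truncation_tendsto[OF f]]) (use d in simp)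
  show "(\<lambda>M. F (truncation M f) i n) \<longlonglongrightarrow> F f i n"
    using hnorm_tendsto_0_coord[OF always_eventually lim, of i n] in' by (simp add: LIM_zero_iff)
qed

lemma bounded_clinear_eqI:
  assumes F: "bounded_clinear_on (hspace s) (hnorm s) (hspace s') (hnorm s') F"
    and G: "bounded_clinear_on (hspace s) (hnorm s) (hspace s') (hnorm s') G"
    and eq: "\<And>M. F (truncation M f) = G (truncation M f)" and f: "f \<in> hspace s"
  shows "F f = G f"
proof (intro ext)
  fix i n
  show "F f i n = G f i n"
    using LIMSEQ_unique bounded_clinear_truncation_tendsto[OF F f, of i n]
      bounded_clinear_truncation_tendsto[OF G f, of i n] unfolding eq by blast
qed

lemma truncation_eq_on_units:
  fixes F G :: "('i::finite \<Rightarrow> nat \<Rightarrow> complex) \<Rightarrow> 'b::complex_vector"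
  assumes F: "bounded_clinear_on (hspace s) (hnorm s) W N F"
    and G: "bounded_clinear_on (hspace s) (hnorm s) W' N' G"
    and eq: "\<And>i n. F (unit_series i n) = G (unit_series i n)"
  shows "F (truncation M f) = G (truncation M f)"
proof -
  define r where "r Z = (\<lambda>i n. if (i, n) \<in> Z then f i n else 0)" for Z
  have "finite Z \<Longrightarrow> r Z \<in> hspace s \<and> F (r Z) = G (r Z)" for Z
  proof (induction Z rule: finite_induct)
    case empty
    have "F 0 = 0" "G 0 = 0"
      using bounded_clinear_scaleC[OF F hspace_0, of 0] bounded_clinear_scaleC[OF G hspace_0, of 0] by simp_all
    moreover have "r {} = 0" by (simp add: r_def fun_eq_iff)
    ultimately show ?case by (simp only: hspace_0)
  next
    case (insert z Z)
    obtain i n where z: "z = (i, n)" by force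
    have r: "r (insert z Z) = r Z + f i n *\<^sub>C unit_series i n"
    proof (intro ext)
      fix j p
      show "r (insert z Z) j p = (r Z + f i n *\<^sub>C unit_series i n) j p"
        using insert(2) by (cases "(j, p) = z") (auto simp: r_def z unit_series_def)
    qed
    have u: "f i n *\<^sub>C unit_series i n \<in> hspace s" by (intro hspace_scaleC) simp
    have rZ: "r Z \<in> hspace s" "F (r Z) = G (r Z)" using insert(3) by auto
    have "F (r Z + f i n *\<^sub>C unit_series i n) = G (r Z + f i n *\<^sub>C unit_series i n)"
      unfolding bounded_clinear_add[OF F rZ(1) u] bounded_clinear_add[OF G rZ(1) u]
        bounded_clinear_scaleC[OF F unit_series_in_hspace] bounded_clinear_scaleC[OF G unit_series_in_hspace]
      by (simp only: eq rZ(2))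
    thus ?case unfolding r using hspace_add[OF rZ(1) u] by blast
  qed
  from this[of "UNIV \<times> {..<M}"] have "F (r (UNIV \<times> {..<M})) = G (r (UNIV \<times> {..<M}))" by simp
  moreover have "r (UNIV \<times> {..<M}) = truncation M f" by (auto simp: r_def truncation_def fun_eq_iff)
  ultimately show ?thesis by simp
qed


section \<open>Diagonal semigroups and their conjugates\<close>

definition diag_semigroup ::
  "('i \<Rightarrow> nat \<Rightarrow> complex) \<Rightarrow> real \<Rightarrow> ('i \<Rightarrow> nat \<Rightarrow> complex) \<Rightarrow> ('i \<Rightarrow> nat \<Rightarrow> complex)" where
  "diag_semigroup \<nu> t f = (\<lambda>i n. exp (of_real t * \<nu> i n) * f i n)"

lemma norm_exp_minus_one_le:
  assumes "Re z \<le> 0"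
  shows "cmod (exp z - 1) \<le> cmod z"
proof -
  have "cmod (exp z - exp 0) \<le> 1 * cmod (z - 0)"
  proof (rule field_differentiable_bound[of "{z. Re z \<le> 0}" exp exp])
    show "convex {z. Re z \<le> 0}" by (rule convex_halfspace_Re_le)
  qed (use assms in \<open>auto intro: DERIV_exp DERIV_subset\<close>)
  thus ?thesis by simp
qed

lemma exp_difference_quotient:
  fixes z :: complex
  shows "((\<lambda>h. (exp (of_real h * z) - 1) / of_real h) \<longlongrightarrow> z) (at_right (0::real))"
proof -
  have "((\<lambda>w::complex. exp (w * z)) has_field_derivative z) (at 0)"
    by (auto intro!: derivative_eq_intros)
  hence "((\<lambda>w. (exp (w * z) - 1) / w) \<longlongrightarrow> z) (at 0)"
    by (simp add: DERIV_def)
  moreover have "filterlim complex_of_real (at 0) (at_right 0)"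
    using eventually_at_right_less[of "0::real"]
    by (auto simp: filterlim_at intro!: tendsto_eq_intros elim: eventually_mono)
  ultimately show ?thesis by (rule filterlim_compose)
qed

text \<open>
  In both directions the difference quotient is compared with \<open>\<nu> f\<close> coordinate by coordinate. As
  \<open>\<bar>exp z - 1\<bar> \<le> \<bar>z\<bar>\<close> in the left half plane, the quotient is a bounded multiple of \<open>\<nu> f\<close>, which makes the
  domain of the generator as large as it can be.
\<close>

lemma diag_semigroup_generates:
  fixes \<nu> :: "'i::finite \<Rightarrow> nat \<Rightarrow> complex"
  assumes \<mu>: "\<mu> > 0" and Re_\<nu>: "\<And>i n. Re (\<nu> i n) \<le> - \<mu>"
  shows "generates (hspace s) (hnorm s) {g \<in> hspace s. diag_op \<nu> g \<in> hspace s} (diag_op \<nu>) (diag_semigroup \<nu>)"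
    and "f \<in> hspace s \<Longrightarrow> t \<ge> 0 \<Longrightarrow> hnorm s (diag_semigroup \<nu> t f) \<le> exp (- \<mu> * t) * hnorm s f"
proof -
  have norm_exp: "cmod (exp (of_real t * \<nu> i n)) \<le> exp (- \<mu> * t)" if "t \<ge> 0" for t i n
    using mult_left_mono[OF Re_\<nu>[of i n] that] by (simp add: mult.commute)
  have norm_exp_1: "cmod (exp (of_real t * \<nu> i n)) \<le> 1" if "t \<ge> 0" for t i n
    using norm_exp[OF that, of i n] \<mu> that by (elim order_trans) simp
  have nz: "\<nu> i n \<noteq> 0" for i n using Re_\<nu>[of i n] \<mu> by auto
  have pos: "\<forall>\<^sub>F t::real in at_right 0. t > 0" by (rule eventually_at_right_less)
  show decay: "hnorm s (diag_semigroup \<nu> t f) \<le> exp (- \<mu> * t) * hnorm s f"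
    if "f \<in> hspace s" "t \<ge> 0" for f t
    unfolding diag_semigroup_def by (rule hspace_multiplier(2)[OF that(1) norm_exp[OF that(2)]])
  have in_space: "diag_semigroup \<nu> t f \<in> hspace s" if "f \<in> hspace s" "t \<ge> 0" for f t
    unfolding diag_semigroup_def by (rule hspace_multiplier(1)[OF that(1) norm_exp[OF that(2)]])
  have "c0_semigroup (hspace s) (hnorm s) (diag_semigroup \<nu>)"
    unfolding c0_semigroup_def
  proof (intro conjI allI impI ballI)
    fix t :: real assume "t \<ge> 0"
    show "bounded_clinear_on (hspace s) (hnorm s) (hspace s) (hnorm s) (diag_semigroup \<nu> t)"
      unfolding bounded_clinear_on_def
      by (intro conjI ballI allI exI[of _ "exp (- \<mu> * t)"];
          (rule in_space decay, assumption, rule \<open>t \<ge> 0\<close>)?)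
         (simp_all add: diag_semigroup_def fun_eq_iff algebra_simps)
  next
    fix f assume f: "f \<in> hspace s"
    have "((\<lambda>t. hnorm s (\<lambda>i n. (exp (of_real t * \<nu> i n) - 1) * f i n)) \<longlongrightarrow> 0) (at_right 0)"
    proof (rule hnorm_multiplier_tendsto_0[OF f, where C = 2])
      show "\<forall>\<^sub>F t in at_right 0. \<forall>i n. cmod (exp (of_real t * \<nu> i n) - 1) \<le> 2"
        using pos
      proof eventually_elim
        fix t :: real assume "t > 0"
        show "\<forall>i n. cmod (exp (of_real t * \<nu> i n) - 1) \<le> 2"
          using norm_exp_1[of t] \<open>t > 0\<close> norm_triangle_ineq4[of "exp (of_real t * \<nu> i n)" 1 for i n]
          by (smt (verit) norm_one)
      qed
      show "((\<lambda>t. exp (of_real t * \<nu> i n) - 1) \<longlongrightarrow> 0) (at_right 0)" for i n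
        by (auto intro!: tendsto_eq_intros)
    qed simp
    moreover have "diag_semigroup \<nu> t f - f = (\<lambda>i n. (exp (of_real t * \<nu> i n) - 1) * f i n)" for t
      by (simp add: diag_semigroup_def fun_eq_iff algebra_simps)
    ultimately show "((\<lambda>t. hnorm s (diag_semigroup \<nu> t f - f)) \<longlongrightarrow> 0) (at_right 0)"
      by simp
  qed (simp_all add: diag_semigroup_def fun_eq_iff exp_add distrib_right)
  moreover have "(f \<in> {g \<in> hspace s. diag_op \<nu> g \<in> hspace s} \<and> diag_op \<nu> f = g) \<longleftrightarrow>
     ((\<lambda>h. hnorm s (complex_of_real (1 / h) *\<^sub>C (diag_semigroup \<nu> h f - f) - g)) \<longlongrightarrow> 0) (at_right 0)"
    (is "?dom \<longleftrightarrow> (?quot \<longlongrightarrow> 0) _")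
    if f: "f \<in> hspace s" and g: "g \<in> hspace s" for f g
  proof
    note quot = exp_difference_quotient[of "\<nu> i n" for i n]
    {
      assume ?dom
      hence geq: "g = diag_op \<nu> f" by simp
      have "((\<lambda>h. hnorm s (\<lambda>i n. ((exp (of_real h * \<nu> i n) - 1) / of_real h / \<nu> i n - 1) * g i n)) \<longlongrightarrow> 0) (at_right 0)"
      proof (rule hnorm_multiplier_tendsto_0[OF g, where C = 2])
        show "\<forall>\<^sub>F h in at_right 0. \<forall>i n. cmod ((exp (of_real h * \<nu> i n) - 1) / of_real h / \<nu> i n - 1) \<le> 2"
          using pos
        proof eventually_elim
          fix h :: real assume "h > 0"
          show "\<forall>i n. cmod ((exp (of_real h * \<nu> i n) - 1) / of_real h / \<nu> i n - 1) \<le> 2"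
          proof (intro allI)
            fix i n
            have "Re (of_real h * \<nu> i n) \<le> 0"
              using \<open>h > 0\<close> Re_\<nu>[of i n] \<mu> by (simp add: mult_nonneg_nonpos)
            from norm_exp_minus_one_le[OF this]
            have "cmod ((exp (of_real h * \<nu> i n) - 1) / of_real h / \<nu> i n) \<le> 1"
              using \<open>h > 0\<close> nz[of i n] by (simp add: norm_divide norm_mult field_simps)
            thus "cmod ((exp (of_real h * \<nu> i n) - 1) / of_real h / \<nu> i n - 1) \<le> 2"
              using norm_triangle_ineq4[of "(exp (of_real h * \<nu> i n) - 1) / of_real h / \<nu> i n" 1] by simp
          qed
        qed
        show "((\<lambda>h. (exp (of_real h * \<nu> i n) - 1) / of_real h / \<nu> i n - 1) \<longlongrightarrow> 0) (at_right 0)" for i n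
          by (rule tendsto_eq_rhs[OF tendsto_diff[OF tendsto_divide[OF quot tendsto_const nz] tendsto_const]])
             (simp add: nz)
      qed simp
      moreover have "complex_of_real (1 / h) *\<^sub>C (diag_semigroup \<nu> h f - f) - g
          = (\<lambda>i n. ((exp (of_real h * \<nu> i n) - 1) / of_real h / \<nu> i n - 1) * g i n)" for h
      proof (intro ext)
        fix i n
        show "(complex_of_real (1 / h) *\<^sub>C (diag_semigroup \<nu> h f - f) - g) i n
            = ((exp (of_real h * \<nu> i n) - 1) / of_real h / \<nu> i n - 1) * g i n"
          using nz[of i n] by (simp add: diag_semigroup_def diag_op_def geq left_diff_distrib diff_divide_distrib)
      qed
      ultimately show "(?quot \<longlongrightarrow> 0) (at_right 0)" by simp
    }
    {
      assume lim: "(?quot \<longlongrightarrow> 0) (at_right 0)"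
      have "g i n = \<nu> i n * f i n" for i n
      proof -
        have "((\<lambda>h. (complex_of_real (1 / h) *\<^sub>C (diag_semigroup \<nu> h f - f) - g) i n) \<longlongrightarrow> 0) (at_right 0)"
          using pos by (intro hnorm_tendsto_0_coord[OF _ lim], elim eventually_mono)
            (auto intro!: hspace_diff hspace_scaleC in_space f g)
        hence "((\<lambda>h. (exp (of_real h * \<nu> i n) - 1) / of_real h * f i n - g i n) \<longlongrightarrow> 0) (at_right 0)"
          by (simp add: diag_semigroup_def left_diff_distrib diff_divide_distrib)
        moreover have "((\<lambda>h. (exp (of_real h * \<nu> i n) - 1) / of_real h * f i n - g i n)
            \<longlongrightarrow> \<nu> i n * f i n - g i n) (at_right 0)"
          by (intro tendsto_intros quot)
        ultimately have "\<nu> i n * f i n - g i n = 0"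
          using tendsto_unique trivial_limit_at_right_real by blast
        thus ?thesis by simp
      qed
      hence "g = diag_op \<nu> f" by (simp add: diag_op_def fun_eq_iff)
      thus ?dom using f g by simp
    }
  qed
  ultimately show "generates (hspace s) (hnorm s) {g \<in> hspace s. diag_op \<nu> g \<in> hspace s} (diag_op \<nu>) (diag_semigroup \<nu>)"
    unfolding generates_def by blast
qed

text \<open>
  The domain \<open>D'\<close> and the operator \<open>A'\<close> are characterized rather than written out, because the closed loop is
  given by another formula, which agrees with the conjugate only on its domain.
\<close>

lemma generates_conjugate:
  fixes D :: "('i::finite \<Rightarrow> nat \<Rightarrow> complex) set"
  assumes gen: "generates (hspace s) (hnorm s) D A S"
    and T: "bounded_clinear_on (hspace s) (hnorm s) (hspace s) (hnorm s) T"
    and G: "bounded_clinear_on (hspace s) (hnorm s) (hspace s) (hnorm s) G"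
    and GT: "\<And>f. f \<in> hspace s \<Longrightarrow> G (T f) = f" and TG: "\<And>f. f \<in> hspace s \<Longrightarrow> T (G f) = f"
    and D': "\<And>f. f \<in> D' \<longleftrightarrow> f \<in> hspace s \<and> T f \<in> D"
    and A': "\<And>f. f \<in> D' \<Longrightarrow> A' f = G (A (T f))"
  shows "generates (hspace s) (hnorm s) D' A' (\<lambda>t f. G (S t (T f)))"
proof -
  have S: "bounded_clinear_on (hspace s) (hnorm s) (hspace s) (hnorm s) (S t)" if "t \<ge> 0" for t
    using gen that by (simp add: generates_def c0_semigroup_def)
  have S0: "S 0 f = f" and Sadd: "p \<ge> 0 \<Longrightarrow> q \<ge> 0 \<Longrightarrow> S (p + q) f = S p (S q f)"
    and Slim: "((\<lambda>t. hnorm s (S t f - f)) \<longlongrightarrow> 0) (at_right 0)" if "f \<in> hspace s" for f p q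
    using gen that by (simp_all add: generates_def c0_semigroup_def)
  have AD: "A f \<in> hspace s" if "f \<in> D" for f using gen that by (auto simp: generates_def)
  have genD: "f \<in> D \<and> A f = g \<longleftrightarrow>
      ((\<lambda>h. hnorm s (complex_of_real (1 / h) *\<^sub>C (S h f - f) - g)) \<longlongrightarrow> 0) (at_right 0)"
    if "f \<in> hspace s" "g \<in> hspace s" for f g
    using gen that unfolding generates_def by blast
  have pos: "\<forall>\<^sub>F t::real in at_right 0. t > 0" by (rule eventually_at_right_less)
  note Tin = bounded_clinear_in[OF T] and Gin = bounded_clinear_in[OF G] and Sin = bounded_clinear_in[OF S]
  have "c0_semigroup (hspace s) (hnorm s) (\<lambda>t f. G (S t (T f)))"
    unfolding c0_semigroup_def
  proof (intro conjI allI impI ballI)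
    fix t :: real assume "t \<ge> 0"
    show "bounded_clinear_on (hspace s) (hnorm s) (hspace s) (hnorm s) (\<lambda>f. G (S t (T f)))"
      by (rule bounded_clinear_comp[OF bounded_clinear_comp[OF T S[OF \<open>t \<ge> 0\<close>]] G]) (auto intro: hnorm_nonneg)
  next
    fix f assume f: "f \<in> hspace s"
    show "G (S 0 (T f)) = f" using f by (simp add: S0 Tin GT)
    have "((\<lambda>t. hnorm s (G (S t (T f) - T f))) \<longlongrightarrow> 0) (at_right 0)"
      using pos by (intro bounded_clinear_tendsto_0[OF G _ Slim[OF Tin[OF f]]], elim eventually_mono)
        (auto intro!: hspace_diff Sin Tin f)
    moreover have "\<forall>\<^sub>F t in at_right 0. hnorm s (G (S t (T f) - T f)) = hnorm s (G (S t (T f)) - f)"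
      using pos by eventually_elim (simp add: bounded_clinear_diff[OF G] Sin Tin f GT)
    ultimately show "((\<lambda>t. hnorm s (G (S t (T f)) - f)) \<longlongrightarrow> 0) (at_right 0)"
      by (rule Lim_transform_eventually)
  next
    fix p q :: real and f assume "p \<ge> 0" "q \<ge> 0" "f \<in> hspace s"
    thus "G (S (p + q) (T f)) = G (S p (T (G (S q (T f)))))"
      by (simp add: Sadd Tin TG Sin)
  qed
  moreover have "(f \<in> D' \<and> A' f = g) \<longleftrightarrow>
     ((\<lambda>h. hnorm s (complex_of_real (1 / h) *\<^sub>C (G (S h (T f)) - f) - g)) \<longlongrightarrow> 0) (at_right 0)"
    if f: "f \<in> hspace s" and g: "g \<in> hspace s" for f g
  proof -
    let ?x = "\<lambda>h. complex_of_real (1 / h) *\<^sub>C (S h (T f) - T f) - T g"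
    let ?y = "\<lambda>h. complex_of_real (1 / h) *\<^sub>C (G (S h (T f)) - f) - g"
    have xin: "\<forall>\<^sub>F h in at_right 0. ?x h \<in> hspace s"
      using pos by eventually_elim (auto intro!: hspace_diff hspace_scaleC Sin Tin f g)
    have yin: "\<forall>\<^sub>F h in at_right 0. ?y h \<in> hspace s"
      using pos by eventually_elim (auto intro!: hspace_diff hspace_scaleC Gin Sin Tin f g)
    have Gx: "\<forall>\<^sub>F h in at_right 0. G (?x h) = ?y h"
      using pos
    proof eventually_elim
      fix h :: real assume "h > 0"
      hence Sh: "S h (T f) \<in> hspace s" by (auto intro!: Sin Tin f)
      note d = hspace_diff[OF Sh Tin[OF f]]
      show "G (?x h) = ?y h"
        by (simp only: bounded_clinear_diff[OF G hspace_scaleC[OF d] Tin[OF g]] bounded_clinear_scaleC[OF G d]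
            bounded_clinear_diff[OF G Sh Tin[OF f]] GT f g)
    qed
    have Ty: "\<forall>\<^sub>F h in at_right 0. T (?y h) = ?x h"
      using Gx xin by eventually_elim (metis TG)
    have "(f \<in> D' \<and> A' f = g) \<longleftrightarrow> (T f \<in> D \<and> A (T f) = T g)"
    proof safe
      assume "f \<in> D'" thus "T f \<in> D" "A (T f) = T (A' f)"
        by (auto simp: D' A' TG AD)
    next
      assume "T f \<in> D" "A (T f) = T g"
      thus "f \<in> D'" "A' f = g" using f g by (auto simp: D' A' GT)
    qed
    also have "\<dots> \<longleftrightarrow> ((\<lambda>h. hnorm s (?x h)) \<longlongrightarrow> 0) (at_right 0)"
      by (rule genD[OF Tin[OF f] Tin[OF g]])
    also have "\<dots> \<longleftrightarrow> ((\<lambda>h. hnorm s (?y h)) \<longlongrightarrow> 0) (at_right 0)"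
    proof
      assume "((\<lambda>h. hnorm s (?x h)) \<longlongrightarrow> 0) (at_right 0)"
      from bounded_clinear_tendsto_0[OF G xin this]
      show "((\<lambda>h. hnorm s (?y h)) \<longlongrightarrow> 0) (at_right 0)"
        by (rule Lim_transform_eventually) (use Gx in eventually_elim, simp only:)
    next
      assume "((\<lambda>h. hnorm s (?y h)) \<longlongrightarrow> 0) (at_right 0)"
      from bounded_clinear_tendsto_0[OF T yin this]
      show "((\<lambda>h. hnorm s (?x h)) \<longlongrightarrow> 0) (at_right 0)"
        by (rule Lim_transform_eventually) (use Ty in eventually_elim, simp only:)
    qed
    finally show ?thesis .
  qed
  moreover have "D' \<subseteq> hspace s" "A' ` D' \<subseteq> hspace s" by (auto simp: D' A' Gin AD)
  ultimately show ?thesis unfolding generates_def by blast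
qed

lemma exponentially_stable_conjugate:
  fixes \<nu> :: "'i::finite \<Rightarrow> nat \<Rightarrow> complex"
  assumes \<mu>: "\<mu> > 0" and Re_\<nu>: "\<And>i n. Re (\<nu> i n) \<le> - \<mu>"
    and T: "bounded_clinear_on (hspace s) (hnorm s) (hspace s) (hnorm s) T"
    and G: "bounded_clinear_on (hspace s) (hnorm s) (hspace s) (hnorm s) G"
    and GT: "\<And>f. f \<in> hspace s \<Longrightarrow> G (T f) = f" and TG: "\<And>f. f \<in> hspace s \<Longrightarrow> T (G f) = f"
    and D': "\<And>f. f \<in> D' \<longleftrightarrow> f \<in> hspace s \<and> diag_op \<nu> (T f) \<in> hspace s"
    and A': "\<And>f. f \<in> D' \<Longrightarrow> A' f = G (diag_op \<nu> (T f))"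
  shows "exponentially_stable (hspace s) (hnorm s) D' A' \<mu>"
proof -
  let ?S = "\<lambda>t f. G (diag_semigroup \<nu> t (T f))"
  have "generates (hspace s) (hnorm s) D' A' ?S"
    using bounded_clinear_in[OF T]
    by (intro generates_conjugate[OF diag_semigroup_generates(1)[OF \<mu> Re_\<nu>] T G GT TG _ A']) (auto simp: D')
  moreover obtain CT where CT: "CT > 0" "\<And>f. f \<in> hspace s \<Longrightarrow> hnorm s (T f) \<le> CT * hnorm s f"
    using bounded_clinear_boundE[OF T hnorm_nonneg] by blast
  moreover obtain CG where CG: "CG > 0" "\<And>f. f \<in> hspace s \<Longrightarrow> hnorm s (G f) \<le> CG * hnorm s f"
    using bounded_clinear_boundE[OF G hnorm_nonneg] by blast
  moreover have "hnorm s (?S t f) \<le> (CG * CT) * exp (- \<mu> * t) * hnorm s f" if f: "f \<in> hspace s" and t: "t \<ge> 0" for t f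
  proof -
    have Tf: "T f \<in> hspace s" by (rule bounded_clinear_in[OF T f])
    have "diag_semigroup \<nu> t (T f) \<in> hspace s"
      using diag_semigroup_generates(1)[OF \<mu> Re_\<nu>, where s = s] t Tf
      by (auto simp: generates_def c0_semigroup_def bounded_clinear_on_def)
    hence "hnorm s (?S t f) \<le> CG * hnorm s (diag_semigroup \<nu> t (T f))" by (rule CG(2))
    also have "\<dots> \<le> CG * (exp (- \<mu> * t) * (CT * hnorm s f))"
      using CG(1) diag_semigroup_generates(2)[OF \<mu> Re_\<nu> Tf t] CT(2)[OF f]
      by (intro mult_left_mono order_trans[OF diag_semigroup_generates(2)[OF \<mu> Re_\<nu> Tf t]]) auto
    finally show ?thesis by (simp add: mult_ac)
  qed
  ultimately show ?thesis
    unfolding exponentially_stable_def by (intro exI[of _ ?S] conjI exI[of _ "CG * CT"]) auto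
qed


section \<open>Stability of the closed loop\<close>

lemma diag_op_bounded:
  fixes m :: "'i::finite \<Rightarrow> nat \<Rightarrow> complex"
  assumes C: "C \<ge> 0" and m: "\<And>i n. cmod (m i n) \<le> C * real (Suc n) powr (s $ i - s' $ i)"
  shows "bounded_clinear_on (hspace s) (hnorm s) (hspace s') (hnorm s') (diag_op m)"
proof -
  have dom: "real (Suc n) powr (s' $ i) * cmod (diag_op m f i n)
      \<le> C * (real (Suc n) powr (s $ i) * cmod (f i n))" for f i n
  proof -
    have "real (Suc n) powr (s' $ i) * cmod (diag_op m f i n)
        = cmod (m i n) * (real (Suc n) powr (s' $ i) * cmod (f i n))"
      by (simp add: diag_op_def norm_mult)
    also have "\<dots> \<le> (C * real (Suc n) powr (s $ i - s' $ i)) * (real (Suc n) powr (s' $ i) * cmod (f i n))"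
      by (intro mult_right_mono m) simp
    also have "\<dots> = C * ((real (Suc n) powr (s $ i - s' $ i) * real (Suc n) powr (s' $ i)) * cmod (f i n))"
      by (simp only: mult_ac)
    also have "\<dots> = C * (real (Suc n) powr (s $ i) * cmod (f i n))"
      by (simp only: powr_add[symmetric] diff_add_cancel)
    finally show ?thesis .
  qed
  show ?thesis
    unfolding bounded_clinear_on_def
    by (intro conjI ballI allI exI[of _ C];
        (rule hspace_dominated[OF _ C dom], assumption)?)
       (simp_all add: diag_op_def fun_eq_iff algebra_simps)
qed

lemma
  assumes B: "B \<in> hspace s"
  shows control_op_in_hspace: "control_op B y \<in> hspace s"
    and hnorm_control_op: "hnorm s (control_op B y) \<le> norm y * hnorm s B"
proof -
  have eq: "control_op B y = (\<lambda>i n. y $ i * B i n)" by (simp add: control_op_def mult.commute)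
  show "control_op B y \<in> hspace s" unfolding eq by (rule hspace_multiplier(1)[OF B Finite_Cartesian_Product.norm_nth_le])
  show "hnorm s (control_op B y) \<le> norm y * hnorm s B"
    unfolding eq by (rule hspace_multiplier(2)[OF B Finite_Cartesian_Product.norm_nth_le])
qed

lemma control_op_diff: "control_op B (y - z) = control_op B y - control_op B z"
  by (simp add: control_op_def fun_eq_iff algebra_simps)

text \<open>Density of the finite series: any continuous extension is the limit of \<open>K\<close> along truncations.\<close>

lemma feedback_extension_limit:
  assumes ext: "feedback_extension s K \<sigma> K'" and f: "f \<in> hspace \<sigma>"
  shows "(\<lambda>M. K (truncation M f)) \<longlonglongrightarrow> K' f"
proof -
  have K': "bounded_clinear_on (hspace \<sigma>) (hnorm \<sigma>) UNIV norm K'"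
    and eq: "K' (truncation M f) = K (truncation M f)" for M
    using ext by (auto simp: feedback_extension_def bounded_feedback_def)
  obtain C where C: "C > 0" "\<And>g. g \<in> hspace \<sigma> \<Longrightarrow> norm (K' g) \<le> C * hnorm \<sigma> g"
    using bounded_clinear_boundE[OF K' hnorm_nonneg] by blast
  have "(\<lambda>M. K' (truncation M f) - K' f) \<longlonglongrightarrow> 0"
  proof (rule Lim_null_comparison[OF always_eventually])
    show "(\<lambda>M. C * hnorm \<sigma> (truncation M f - f)) \<longlonglongrightarrow> 0"
      by (rule tendsto_mult_right_zero[OF truncation_tendsto[OF f]])
    show "\<forall>M. norm (K' (truncation M f) - K' f) \<le> C * hnorm \<sigma> (truncation M f - f)"
      using C(2)[OF hspace_diff[OF truncation_in_hspace f]]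
      by (simp add: bounded_clinear_diff[OF K' truncation_in_hspace f, symmetric])
  qed
  thus ?thesis by (simp add: eq LIM_zero_iff)
qed

lemma extended_feedback_eq:
  assumes "feedback_extension s K \<sigma> K'" and "f \<in> hspace \<sigma>"
  shows "extended_feedback s K f = K' f"
  unfolding extended_feedback_def
proof (rule the_equality)
  show "\<exists>\<sigma> K''. feedback_extension s K \<sigma> K'' \<and> f \<in> hspace \<sigma> \<and> K' f = K'' f"
    using assms by blast
  fix y assume "\<exists>\<sigma> K'. feedback_extension s K \<sigma> K' \<and> f \<in> hspace \<sigma> \<and> y = K' f"
  then obtain \<sigma>2 K2 where "feedback_extension s K \<sigma>2 K2" "f \<in> hspace \<sigma>2" and y: "y = K2 f"
    by blast
  from this(1,2) have "(\<lambda>M. K (truncation M f)) \<longlonglongrightarrow> y"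
    unfolding y by (rule feedback_extension_limit)
  thus "y = K' f"
    by (rule LIMSEQ_unique) (rule feedback_extension_limit[OF assms])
qed

lemma isomorphism_onE:
  assumes "isomorphism_on V N W M T"
  obtains G where "bounded_clinear_on V N W M T" "bounded_clinear_on W M V N G"
    "\<And>f. f \<in> V \<Longrightarrow> G (T f) = f" "\<And>g. g \<in> W \<Longrightarrow> T (G g) = g"
  using assms unfolding isomorphism_on_def by blast

text \<open>
  Solving the operator equality for the control term gives \<open>B K = G \<nu> T - \<Lambda>\<close> with a left inverse \<open>G\<close> of
  \<open>T\<close>. The right-hand side is bounded from \<open>\<H>\<^sup>\<sigma>\<close> to \<open>\<H>\<^sup>w\<close>, although \<open>K\<close> is given only on the smaller space
  \<open>\<H>\<^sup>s\<close>. Dividing the leading coordinate of each component by that of \<open>B\<close> recovers the controls, which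
  defines the extension; the equation between \<open>\<H>\<^sup>\<sigma>\<close> and \<open>\<H>\<^sup>w\<close> then holds by density.
\<close>

lemma feedback_extends:
  fixes lam B :: "'i::finite \<Rightarrow> nat \<Rightarrow> complex"
  assumes K: "bounded_feedback s K"
    and maps: "\<And>f. f \<in> hspace s \<Longrightarrow> T (diag_op lam f + control_op B (K f)) = diag_op \<nu> (T f)"
    and T\<sigma>: "bounded_clinear_on (hspace \<sigma>) (hnorm \<sigma>) (hspace \<sigma>) (hnorm \<sigma>) T"
    and Gw: "bounded_clinear_on (hspace w) (hnorm w) (hspace w) (hnorm w) G"
    and GT: "\<And>f. f \<in> hspace w \<Longrightarrow> G (T f) = f"
    and lam: "bounded_clinear_on (hspace \<sigma>) (hnorm \<sigma>) (hspace w) (hnorm w) (diag_op lam)"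
    and \<nu>: "bounded_clinear_on (hspace \<sigma>) (hnorm \<sigma>) (hspace w) (hnorm w) (diag_op \<nu>)"
    and B: "B \<in> hspace w" and B0: "\<And>i. B i 0 \<noteq> 0" and sub: "hspace s \<subseteq> hspace \<sigma>"
  obtains K' where "feedback_extension s K \<sigma> K'"
    "\<And>f. f \<in> hspace \<sigma> \<Longrightarrow> diag_op lam f + control_op B (K' f) = G (diag_op \<nu> (T f))"
proof -
  define H where "H f = G (diag_op \<nu> (T f)) - diag_op lam f" for f
  define K' where "K' f = (\<chi> i. H f i 0 / B i 0)" for f
  have GnT: "bounded_clinear_on (hspace \<sigma>) (hnorm \<sigma>) (hspace w) (hnorm w) (\<lambda>f. G (diag_op \<nu> (T f)))"
    by (rule bounded_clinear_comp[OF bounded_clinear_comp[OF T\<sigma> \<nu>] Gw]) (auto intro: hnorm_nonneg)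
  obtain C1 where C1: "C1 > 0" "\<And>f. f \<in> hspace \<sigma> \<Longrightarrow> hnorm w (G (diag_op \<nu> (T f))) \<le> C1 * hnorm \<sigma> f"
    using bounded_clinear_boundE[OF GnT hnorm_nonneg] by blast
  obtain C2 where C2: "C2 > 0" "\<And>f. f \<in> hspace \<sigma> \<Longrightarrow> hnorm w (diag_op lam f) \<le> C2 * hnorm \<sigma> f"
    using bounded_clinear_boundE[OF lam hnorm_nonneg] by blast
  have H: "bounded_clinear_on (hspace \<sigma>) (hnorm \<sigma>) (hspace w) (hnorm w) H"
    unfolding bounded_clinear_on_def
  proof (intro conjI ballI allI exI[of _ "2 * (C1 + C2)"])
    fix f assume f: "f \<in> hspace \<sigma>"
    note in_w = bounded_clinear_in[OF GnT f] bounded_clinear_in[OF lam f]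
    show "H f \<in> hspace w" unfolding H_def by (rule hspace_diff[OF in_w])
    show "hnorm w (H f) \<le> 2 * (C1 + C2) * hnorm \<sigma> f"
      unfolding H_def using hnorm_diff[OF in_w] C1(2)[OF f] C2(2)[OF f] by (simp add: distrib_right)
    show "H (c *\<^sub>C f) = c *\<^sub>C H f" for c
      unfolding H_def bounded_clinear_scaleC[OF GnT f] bounded_clinear_scaleC[OF lam f]
      by (simp add: fun_eq_iff algebra_simps)
    fix g assume g: "g \<in> hspace \<sigma>"
    show "H (f + g) = H f + H g"
      unfolding H_def bounded_clinear_add[OF GnT f g] bounded_clinear_add[OF lam f g] by simp
  qed
  obtain CH where CH: "CH > 0" "\<And>f. f \<in> hspace \<sigma> \<Longrightarrow> hnorm w (H f) \<le> CH * hnorm \<sigma> f"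
    using bounded_clinear_boundE[OF H hnorm_nonneg] by blast
  have BK: "control_op B (K f) = H f" if f: "f \<in> hspace s" for f
  proof -
    have f\<sigma>: "f \<in> hspace \<sigma>" using f sub by blast
    have "diag_op lam f + control_op B (K f) \<in> hspace w"
      by (intro hspace_add bounded_clinear_in[OF lam f\<sigma>] control_op_in_hspace[OF B])
    from GT[OF this] have "diag_op lam f + control_op B (K f) = G (diag_op \<nu> (T f))"
      by (simp add: maps[OF f])
    thus ?thesis unfolding H_def by (metis add_diff_cancel_left')
  qed
  have K'_eq: "K' f = K f" if "f \<in> hspace s" for f
    using B0 by (simp add: K'_def BK[OF that, symmetric] control_op_def vec_eq_iff)
  have K'_bound: "norm (K' f) \<le> (\<Sum>i\<in>UNIV. CH / cmod (B i 0)) * hnorm \<sigma> f" if f: "f \<in> hspace \<sigma>" for f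
  proof -
    have "norm (K' f) \<le> (\<Sum>i\<in>UNIV. norm (K' f $ i))"
      unfolding norm_vec_def by (rule L2_set_le_sum) simp
    also have "\<dots> \<le> (\<Sum>i\<in>UNIV. CH / cmod (B i 0) * hnorm \<sigma> f)"
    proof (rule sum_mono)
      fix i
      have "cmod (H f i 0) \<le> CH * hnorm \<sigma> f"
        using hspace_coord_le[OF bounded_clinear_in[OF H f], of 0 i] CH(2)[OF f] by simp
      thus "norm (K' f $ i) \<le> CH / cmod (B i 0) * hnorm \<sigma> f"
        by (simp add: K'_def norm_divide divide_right_mono)
    qed
    finally show ?thesis by (simp add: sum_distrib_right)
  qed
  have K'_lin: "bounded_clinear_on (hspace \<sigma>) (hnorm \<sigma>) UNIV norm K'"
    unfolding bounded_clinear_on_def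
  proof (intro conjI ballI allI exI, rule UNIV_I)
    fix f assume f: "f \<in> hspace \<sigma>"
    show "norm (K' f) \<le> (\<Sum>i\<in>UNIV. CH / cmod (B i 0)) * hnorm \<sigma> f" by (rule K'_bound[OF f])
    show "K' (c *\<^sub>C f) = c *\<^sub>C K' f" for c
      by (simp add: K'_def bounded_clinear_scaleC[OF H f] vec_eq_iff scaleC_vec_def scaleC_complex_def)
    fix g assume g: "g \<in> hspace \<sigma>"
    show "K' (f + g) = K' f + K' g"
      by (simp add: K'_def bounded_clinear_add[OF H f g] vec_eq_iff add_divide_distrib)
  qed
  have BK'_lin: "bounded_clinear_on (hspace \<sigma>) (hnorm \<sigma>) (hspace w) (hnorm w) (\<lambda>f. control_op B (K' f))"
  proof (rule bounded_clinear_comp[OF K'_lin])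
    show "bounded_clinear_on UNIV norm (hspace w) (hnorm w) (control_op B)"
      unfolding bounded_clinear_on_def
    proof (intro conjI ballI allI exI)
      fix y show "control_op B y \<in> hspace w" by (rule control_op_in_hspace[OF B])
      show "hnorm w (control_op B y) \<le> hnorm w B * norm y"
        using hnorm_control_op[OF B, of y] by (simp add: mult.commute)
    qed (simp_all add: control_op_def fun_eq_iff scaleC_vec_def scaleC_complex_def algebra_simps)
  qed simp
  have "control_op B (K' f) = H f" if "f \<in> hspace \<sigma>" for f
    by (rule bounded_clinear_eqI[OF BK'_lin H _ that]) (simp add: K'_eq BK)
  moreover have "feedback_extension s K \<sigma> K'"
    using K'_lin K'_eq sub by (simp add: feedback_extension_def bounded_feedback_def)
  ultimately show ?thesis by (intro that[of K']) (simp_all add: H_def)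
qed

text \<open>
  The closed loop on \<open>\<H>\<^sup>\<rho>\<close> is the conjugate by \<open>T\<close> of the diagonal operator \<open>\<Lambda> - l\<close>, with equality of
  the domains. A state \<open>f\<close> with \<open>(\<Lambda> - l) T f \<in> \<H>\<^sup>\<rho>\<close> is regular enough for the extended feedback
  because \<open>T f\<close> gains \<open>\<alpha>\<close> powers. Conversely, a state in the domain of the closed loop is the limit of
  its truncations, along which the operator equality passes to the limit in a space \<open>\<H>\<^sup>w\<close> that is large
  enough to contain both \<open>\<H>\<^sup>\<rho>\<close> and \<open>B\<close>.
\<close>

lemma closed_loop_stable:
  fixes lam B :: "'i::finite \<Rightarrow> nat \<Rightarrow> complex" and \<alpha> \<beta> \<gamma> :: "real^'i"
  assumes \<alpha>: "\<And>i. \<alpha> $ i > 1"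
    and c: "c > 0" and lower: "\<And>i n. c * real (Suc n) powr (\<alpha> $ i) \<le> cmod (lam i n) + 1"
    and upper: "\<And>i n. cmod (lam i n) + 1 \<le> C * real (Suc n) powr (\<alpha> $ i)"
    and \<gamma>: "\<And>i. \<gamma> $ i \<in> {0 ..< (\<alpha> $ i - 1) / 2}"
    and B_space: "\<And>i. B i \<in> hcomp (\<beta> $ i - \<alpha> $ i / 2)" and B0: "\<And>i. B i 0 \<noteq> 0"
    and \<mu>: "\<mu> > 0" and l: "l > 0" and Re_lam: "\<And>i n. Re (lam i n) + \<mu> \<le> l"
    and pair: "backstepping_pair lam B \<alpha> \<beta> \<gamma> l K T" and r: "r \<in> admissible_shifts \<alpha> \<gamma>"
  shows "exponentially_stable (hspace (\<beta> + r)) (hnorm (\<beta> + r))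
           (closed_loop_domain lam B (\<beta> + (1/2) *\<^sub>R \<alpha>) K (\<beta> + r))
           (closed_loop lam B (\<beta> + (1/2) *\<^sub>R \<alpha>) K) \<mu>"
proof -
  define \<nu> where "\<nu> i n = lam i n - of_real l" for i n
  define s where "s = \<beta> + (1/2) *\<^sub>R \<alpha>"
  define \<rho> where "\<rho> = \<beta> + r"
  \<comment> \<open>\<open>r'\<close> is small enough for \<open>\<H>\<^sup>w\<close> to contain \<open>\<H>\<^sup>\<rho>\<close> and \<open>B\<close>, while \<open>r'\<close> and \<open>r' + \<alpha>\<close> are both admissible.\<close>
  define r' where "r' = (\<chi> i. min (r $ i) (- (\<alpha> $ i) / 2))"
  define w where "w = \<beta> + r'"
  define \<sigma> where "\<sigma> = \<beta> + (r' + \<alpha>)"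
  have adm: "1/2 - \<alpha> $ i + \<gamma> $ i < r $ i" "r $ i < \<alpha> $ i - 1/2 - \<gamma> $ i"
    "0 \<le> \<gamma> $ i" "\<gamma> $ i < \<alpha> $ i / 2 - 1/2" for i
    using r \<gamma>[of i] by (auto simp: admissible_shifts_def diff_divide_distrib)
  have r'_adm: "r' \<in> admissible_shifts \<alpha> \<gamma>" and r'\<alpha>_adm: "r' + \<alpha> \<in> admissible_shifts \<alpha> \<gamma>"
    unfolding admissible_shifts_def r'_def using adm \<alpha>
    by (auto simp: min_less_iff_disj; smt (verit) field_sum_of_halves)+
  have w_\<rho>: "w $ i \<le> \<rho> $ i" and w_\<sigma>: "w $ i \<le> \<sigma> $ i" and \<sigma>_s: "\<sigma> $ i \<le> s $ i" and
    w_B: "w $ i \<le> \<beta> $ i - \<alpha> $ i / 2" and \<sigma>_\<rho>: "\<sigma> $ i \<le> \<rho> $ i + \<alpha> $ i" for i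
    using \<alpha>[of i] unfolding w_def \<rho>_def \<sigma>_def s_def r'_def by (auto simp: min_def)
  have \<rho>_sub: "hspace \<rho> \<subseteq> hspace w" and \<sigma>_sub: "hspace \<sigma> \<subseteq> hspace w" and s_sub: "hspace s \<subseteq> hspace \<sigma>"
    using w_\<rho> w_\<sigma> \<sigma>_s hspace_mono by blast+
  have B: "B \<in> hspace w"
  proof (rule hspace_mono)
    show "B \<in> hspace (\<beta> - (1/2) *\<^sub>R \<alpha>)" using B_space by (simp add: hspace_def)
  qed (use w_B in simp)
  have iso: "isomorphism_on (hspace (\<beta> + q)) (hnorm (\<beta> + q)) (hspace (\<beta> + q)) (hnorm (\<beta> + q)) T"
    if "q \<in> admissible_shifts \<alpha> \<gamma>" for q
    using pair that by (simp add: backstepping_pair_def)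
  obtain G\<rho> where G\<rho>: "bounded_clinear_on (hspace \<rho>) (hnorm \<rho>) (hspace \<rho>) (hnorm \<rho>) T"
      "bounded_clinear_on (hspace \<rho>) (hnorm \<rho>) (hspace \<rho>) (hnorm \<rho>) G\<rho>"
      "\<And>f. f \<in> hspace \<rho> \<Longrightarrow> G\<rho> (T f) = f" "\<And>f. f \<in> hspace \<rho> \<Longrightarrow> T (G\<rho> f) = f"
    using iso[OF r] unfolding \<rho>_def[symmetric] by (rule isomorphism_onE) blast
  obtain Gw where Gw: "bounded_clinear_on (hspace w) (hnorm w) (hspace w) (hnorm w) T"
      "bounded_clinear_on (hspace w) (hnorm w) (hspace w) (hnorm w) Gw"
      "\<And>f. f \<in> hspace w \<Longrightarrow> Gw (T f) = f" "\<And>f. f \<in> hspace w \<Longrightarrow> T (Gw f) = f"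
    using iso[OF r'_adm] unfolding w_def[symmetric] by (rule isomorphism_onE) blast
  obtain G\<sigma> where G\<sigma>: "bounded_clinear_on (hspace \<sigma>) (hnorm \<sigma>) (hspace \<sigma>) (hnorm \<sigma>) T"
      "bounded_clinear_on (hspace \<sigma>) (hnorm \<sigma>) (hspace \<sigma>) (hnorm \<sigma>) G\<sigma>"
      "\<And>f. f \<in> hspace \<sigma> \<Longrightarrow> G\<sigma> (T f) = f" "\<And>f. f \<in> hspace \<sigma> \<Longrightarrow> T (G\<sigma> f) = f"
    using iso[OF r'\<alpha>_adm] unfolding \<sigma>_def[symmetric] by (rule isomorphism_onE) blast
  have one_le: "1 \<le> real (Suc n) powr (\<alpha> $ i)" for i n
    using \<alpha>[of i] by (simp add: ge_one_powr_ge_zero)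
  have norm_lam: "cmod (lam i n) \<le> \<bar>C\<bar> * real (Suc n) powr (\<alpha> $ i)" for i n
    using upper[of i n] mult_right_mono[OF abs_ge_self[of C] powr_ge_zero[of "real (Suc n)" "\<alpha> $ i"]] by linarith
  have norm_\<nu>: "cmod (\<nu> i n) \<le> (\<bar>C\<bar> + l) * real (Suc n) powr (\<alpha> $ i)" for i n
  proof -
    have "cmod (\<nu> i n) \<le> cmod (lam i n) + l"
      using norm_triangle_ineq4[of "lam i n" "of_real l"] l by (simp add: \<nu>_def)
    moreover have "l \<le> l * real (Suc n) powr (\<alpha> $ i)"
      using mult_left_mono[OF one_le[of n i], of l] l by linarith
    ultimately show ?thesis using norm_lam[of i n] unfolding distrib_right by linarith
  qed
  have \<sigma>w: "\<sigma> $ i - w $ i = \<alpha> $ i" for i by (simp add: \<sigma>_def w_def)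
  have lam: "bounded_clinear_on (hspace \<sigma>) (hnorm \<sigma>) (hspace w) (hnorm w) (diag_op lam)"
    by (rule diag_op_bounded[of "\<bar>C\<bar>"]) (use norm_lam in \<open>simp_all only: \<sigma>w abs_ge_zero\<close>)
  have \<nu>: "bounded_clinear_on (hspace \<sigma>) (hnorm \<sigma>) (hspace w) (hnorm w) (diag_op \<nu>)"
    by (rule diag_op_bounded[of "\<bar>C\<bar> + l"], use l in simp) (use norm_\<nu> in \<open>simp only: \<sigma>w\<close>)
  have Re_\<nu>: "Re (\<nu> i n) \<le> - \<mu>" for i n using Re_lam[of i n] by (simp add: \<nu>_def)
  have \<nu>_lower: "real (Suc n) powr (\<alpha> $ i) \<le> ((1 + (l + 1) / \<mu>) / c) * cmod (\<nu> i n)" for i n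
  proof -
    have "\<mu> \<le> cmod (\<nu> i n)" using Re_\<nu>[of i n] complex_Re_le_cmod[of "- \<nu> i n"] by simp
    hence "l + 1 \<le> (l + 1) / \<mu> * cmod (\<nu> i n)"
      using mult_left_mono[of \<mu> "cmod (\<nu> i n)" "(l + 1) / \<mu>"] \<mu> l by simp
    moreover have "cmod (lam i n) \<le> cmod (\<nu> i n) + l"
      using norm_triangle_ineq[of "\<nu> i n" "of_real l"] l by (simp add: \<nu>_def)
    ultimately have "c * real (Suc n) powr (\<alpha> $ i) \<le> (1 + (l + 1) / \<mu>) * cmod (\<nu> i n)"
      using lower[of n i] by (simp add: distrib_right)
    thus ?thesis using c by (simp add: field_simps del: of_nat_Suc)
  qed
  have gain: "g \<in> hspace \<sigma>" if g: "diag_op \<nu> g \<in> hspace \<rho>" for g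
  proof (rule hspace_dominated(1)[OF g])
    show "0 \<le> (1 + (l + 1) / \<mu>) / c" using c l \<mu> by simp
    fix i n
    have "real (Suc n) powr (\<sigma> $ i) * cmod (g i n) \<le> real (Suc n) powr (\<alpha> $ i + \<rho> $ i) * cmod (g i n)"
      using \<sigma>_\<rho>[of i] by (intro mult_right_mono powr_mono) auto
    also have "\<dots> = real (Suc n) powr (\<alpha> $ i) * (real (Suc n) powr (\<rho> $ i) * cmod (g i n))"
      by (simp only: powr_add mult.assoc)
    also have "\<dots> \<le> (((1 + (l + 1) / \<mu>) / c) * cmod (\<nu> i n)) * (real (Suc n) powr (\<rho> $ i) * cmod (g i n))"
      by (intro mult_right_mono \<nu>_lower) simp
    finally show "real (Suc n) powr (\<sigma> $ i) * cmod (g i n)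
        \<le> ((1 + (l + 1) / \<mu>) / c) * (real (Suc n) powr (\<rho> $ i) * cmod (diag_op \<nu> g i n))"
      by (simp add: diag_op_def norm_mult mult_ac)
  qed
  have maps: "T (diag_op lam f + control_op B (K f)) = diag_op \<nu> (T f)" if "f \<in> hspace s" for f
    using pair that unfolding backstepping_pair_def maps_system_def s_def[symmetric]
    by (auto simp: diag_op_def \<nu>_def fun_eq_iff algebra_simps)
  have Ks: "bounded_feedback s K" using pair by (simp add: backstepping_pair_def s_def)
  obtain K' where K': "feedback_extension s K \<sigma> K'"
      and cl\<sigma>: "\<And>f. f \<in> hspace \<sigma> \<Longrightarrow> diag_op lam f + control_op B (K' f) = Gw (diag_op \<nu> (T f))"
    using feedback_extends[OF Ks maps G\<sigma>(1) Gw(2,3) lam \<nu> B B0 s_sub] by blast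

  have regular: "f \<in> closed_loop_domain lam B s K \<rho>" "closed_loop lam B s K f = G\<rho> (diag_op \<nu> (T f))"
    if f: "f \<in> hspace \<rho>" and \<nu>f: "diag_op \<nu> (T f) \<in> hspace \<rho>" for f
  proof -
    have Tf: "T f \<in> hspace \<sigma>" by (rule gain[OF \<nu>f])
    have G\<sigma>Tf: "G\<sigma> (T f) \<in> hspace \<sigma>" by (rule bounded_clinear_in[OF G\<sigma>(2) Tf])
    have "Gw (T (G\<sigma> (T f))) = Gw (T f)" by (simp only: G\<sigma>(4)[OF Tf])
    moreover have "Gw (T f) = f" using f \<rho>_sub by (intro Gw(3)) auto
    moreover have "Gw (T (G\<sigma> (T f))) = G\<sigma> (T f)" using G\<sigma>Tf \<sigma>_sub by (intro Gw(3)) auto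
    ultimately have "G\<sigma> (T f) = f" by (simp only:)
    with G\<sigma>Tf have f\<sigma>: "f \<in> hspace \<sigma>" by (simp only:)
    have "closed_loop lam B s K f = Gw (diag_op \<nu> (T f))"
      unfolding closed_loop_def extended_feedback_eq[OF K' f\<sigma>] by (rule cl\<sigma>[OF f\<sigma>])
    also have "\<dots> = Gw (T (G\<rho> (diag_op \<nu> (T f))))" by (simp add: G\<rho>(4)[OF \<nu>f])
    also have "\<dots> = G\<rho> (diag_op \<nu> (T f))"
      using bounded_clinear_in[OF G\<rho>(2) \<nu>f] \<rho>_sub by (intro Gw(3)) auto
    finally show eq: "closed_loop lam B s K f = G\<rho> (diag_op \<nu> (T f))" .
    show "f \<in> closed_loop_domain lam B s K \<rho>"
      unfolding closed_loop_domain_def extended_domain_def using f K' f\<sigma>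
      by (auto simp: eq bounded_clinear_in[OF G\<rho>(2) \<nu>f])
  qed

  have conv: "diag_op \<nu> (T f) \<in> hspace \<rho>" if dom: "f \<in> closed_loop_domain lam B s K \<rho>" for f
  proof -
    obtain \<sigma>2 K2 where ext: "feedback_extension s K \<sigma>2 K2" and f2: "f \<in> hspace \<sigma>2"
      using dom by (auto simp: closed_loop_domain_def extended_domain_def)
    define h where "h = diag_op lam f + control_op B (K2 f)"
    have f: "f \<in> hspace \<rho>" and h: "h \<in> hspace \<rho>"
      using dom by (auto simp: closed_loop_domain_def closed_loop_def extended_feedback_eq[OF ext f2] h_def)
    have hw: "h \<in> hspace w" using h \<rho>_sub by blast
    have lf: "diag_op lam f \<in> hspace w"
    proof -
      have "diag_op lam f = h - control_op B (K2 f)" by (simp add: h_def)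
      thus ?thesis using hspace_diff[OF hw control_op_in_hspace[OF B]] by simp
    qed
    define hM where "hM M = diag_op lam (truncation M f) + control_op B (K (truncation M f))" for M
    have lam_trunc: "diag_op lam (truncation M f) = truncation M (diag_op lam f)" for M
      by (auto simp: diag_op_def truncation_def fun_eq_iff)
    have hM_w: "hM M \<in> hspace w" for M
      unfolding hM_def lam_trunc by (intro hspace_add control_op_in_hspace[OF B]) simp
    have diff: "hM M - h = (truncation M (diag_op lam f) - diag_op lam f)
        - control_op B (K2 f - K (truncation M f))" for M
      unfolding hM_def h_def lam_trunc control_op_diff by simp
    have "(\<lambda>M. hnorm w (control_op B (K2 f - K (truncation M f)))) \<longlonglongrightarrow> 0"
    proof (rule tendsto_sandwich[OF always_eventually always_eventually tendsto_const])
      have "(\<lambda>M. K2 f - K (truncation M f)) \<longlonglongrightarrow> K2 f - K2 f"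
        by (intro tendsto_intros feedback_extension_limit[OF ext f2])
      thus "(\<lambda>M. norm (K2 f - K (truncation M f)) * hnorm w B) \<longlonglongrightarrow> 0"
        by (auto intro!: tendsto_mult_left_zero tendsto_norm_zero)
    qed (auto intro: hnorm_nonneg control_op_in_hspace[OF B] hnorm_control_op[OF B])
    hence lim: "(\<lambda>M. hnorm w (hM M - h)) \<longlonglongrightarrow> 0"
      unfolding diff
      by (intro hnorm_diff_tendsto_0 truncation_tendsto lf hspace_diff control_op_in_hspace[OF B]) auto
    have "diag_op \<nu> (T f) i n = T h i n" for i n
    proof -
      have "(\<lambda>M. hnorm w (T (hM M - h))) \<longlonglongrightarrow> 0"
        by (rule bounded_clinear_tendsto_0[OF Gw(1) _ lim]) (simp add: hspace_diff hM_w hw)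
      hence "(\<lambda>M. T (hM M - h) i n) \<longlonglongrightarrow> 0"
        by (intro hnorm_tendsto_0_coord[of "\<lambda>M. T (hM M - h)" w])
           (simp_all add: bounded_clinear_in[OF Gw(1)] hspace_diff hM_w hw)
      hence "(\<lambda>M. T (hM M) i n) \<longlonglongrightarrow> T h i n"
        by (simp add: bounded_clinear_diff[OF Gw(1) hM_w hw] LIM_zero_iff)
      moreover have "T (hM M) i n = \<nu> i n * T (truncation M f) i n" for M
        unfolding hM_def by (subst maps) (simp_all add: diag_op_def)
      moreover have "(\<lambda>M. \<nu> i n * T (truncation M f) i n) \<longlonglongrightarrow> \<nu> i n * T f i n"
        by (intro tendsto_intros bounded_clinear_truncation_tendsto[OF G\<rho>(1) f])
      ultimately show ?thesis unfolding diag_op_def by (simp add: LIMSEQ_unique)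
    qed
    hence "diag_op \<nu> (T f) = T h" by (simp add: fun_eq_iff)
    thus ?thesis using bounded_clinear_in[OF G\<rho>(1) h] by simp
  qed

  have in_\<rho>: "f \<in> hspace \<rho>" if "f \<in> closed_loop_domain lam B s K \<rho>" for f
    using that by (simp add: closed_loop_domain_def)
  have dom_iff: "f \<in> closed_loop_domain lam B s K \<rho> \<longleftrightarrow> f \<in> hspace \<rho> \<and> diag_op \<nu> (T f) \<in> hspace \<rho>" for f
    using regular(1) conv in_\<rho> by blast
  show ?thesis
    unfolding s_def[symmetric] \<rho>_def[symmetric]
    by (rule exponentially_stable_conjugate[OF \<mu> Re_\<nu> G\<rho> dom_iff regular(2)[OF in_\<rho> conv]])
qed


section \<open>The spectral bound\<close>

lemma norm_scaleC:
  fixes x :: "'x::complex_hilbert"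
  shows "norm (c *\<^sub>C x) = cmod c * norm x"
proof -
  have "cinner (c *\<^sub>C x) (c *\<^sub>C x) = c * cnj c * cinner x x"
    by (simp add: cinner_scaleC_left cinner_commute[of x "c *\<^sub>C x"] cinner_commute[of x x, symmetric])
  hence "complex_of_real ((norm (c *\<^sub>C x))\<^sup>2) = complex_of_real ((cmod c * norm x)\<^sup>2)"
    by (simp add: cinner_self complex_norm_square[symmetric] power_mult_distrib)
  hence "(norm (c *\<^sub>C x))\<^sup>2 = (cmod c * norm x)\<^sup>2" by (simp only: of_real_eq_iff)
  thus ?thesis by (rule power2_eq_imp_eq) simp_all
qed

lemma riesz_basis_nonzero:
  fixes b :: "'j \<Rightarrow> 'x::complex_hilbert"
  assumes "riesz_basis b"
  shows "b j \<noteq> 0"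
proof
  assume b0: "b j = 0"
  obtain e and U :: "'x \<Rightarrow> 'x" where e: "orthonormal_basis e" and U: "isomorphism_on UNIV norm UNIV norm U"
    and b: "\<forall>j. b j = U (e j)"
    using assms unfolding riesz_basis_def by blast
  obtain G :: "'x \<Rightarrow> 'x" where G: "bounded_clinear_on UNIV norm UNIV norm G" "\<And>f. G (U f) = f"
    using U by (auto simp: isomorphism_on_def)
  have "G 0 = G (0 *\<^sub>C 0)" by simp
  also have "\<dots> = 0 *\<^sub>C G 0" by (rule bounded_clinear_scaleC[OF G(1)]) simp
  finally have "e j = 0" using G(2)[of "e j"] b0 by (simp add: b)
  moreover have "cinner (e j) (e j) = 1" using e by (simp add: orthonormal_basis_def)
  ultimately show False by (simp add: cinner_self)
qed

text \<open>
  On an eigenvector the semigroup acts as multiplication by \<open>exp (\<lambda> t)\<close>. The generator only gives this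
  to first order at time \<open>0\<close>; composing \<open>n\<close> steps of length \<open>t / n\<close> accumulates \<open>n\<close> errors of
  size \<open>o(t / n)\<close>, hence none in the limit.
\<close>

lemma eigenvector_semigroup:
  fixes A :: "'x::complex_hilbert \<Rightarrow> 'x"
  assumes gen: "generates UNIV norm D A S" and growth: "finite_growth_bound UNIV norm S"
    and \<phi>: "\<phi> \<in> D" "A \<phi> = z *\<^sub>C \<phi>" and t: "t > 0"
  shows "S t \<phi> = exp (of_real t * z) *\<^sub>C \<phi>"
proof -
  obtain M0 \<omega>0 where M0: "\<And>t f. t \<ge> 0 \<Longrightarrow> norm (S t f) \<le> M0 * exp (\<omega>0 * t) * norm f"
    using growth by (auto simp: finite_growth_bound_def)
  define M \<omega> where "M = \<bar>M0\<bar> + 1" and "\<omega> = \<bar>\<omega>0\<bar> + cmod z"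
  have M: "norm (S t f) \<le> M * exp (\<omega> * t) * norm f" if "t \<ge> 0" for t f
  proof -
    have "M0 * exp (\<omega>0 * t) \<le> M * exp (\<omega> * t)"
      unfolding M_def \<omega>_def using that by (intro mult_mono) (auto intro!: mult_right_mono add_increasing2)
    thus ?thesis using M0[OF that, of f] by (meson mult_right_mono norm_ge_zero order_trans)
  qed
  have M1: "M \<ge> 1" and \<omega>: "cmod z \<le> \<omega>" "\<omega> \<ge> 0" by (auto simp: M_def \<omega>_def)
  have S: "bounded_clinear_on UNIV norm UNIV norm (S t)" if "t \<ge> 0" for t
    using gen that by (simp add: generates_def c0_semigroup_def)
  have S0: "S 0 f = f" and Sadd: "p \<ge> 0 \<Longrightarrow> q \<ge> 0 \<Longrightarrow> S (p + q) f = S p (S q f)" for p q f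
    using gen by (simp_all add: generates_def c0_semigroup_def)
  have S_diff: "S p (f - g) = S p f - S p g" if "p \<ge> 0" for p f g
    using bounded_clinear_add[OF S[OF that], of "f - g" g] by (simp add: algebra_simps)
  define E where "E h = norm (S h \<phi> - exp (of_real h * z) *\<^sub>C \<phi>)" for h
  have E_lim: "((\<lambda>h. E h / h) \<longlongrightarrow> 0) (at_right 0)"
  proof -
    have "((\<lambda>h. norm (complex_of_real (1 / h) *\<^sub>C (S h \<phi> - \<phi>) - z *\<^sub>C \<phi>)) \<longlongrightarrow> 0) (at_right 0)"
      using gen \<phi> unfolding generates_def by blast
    moreover have "((\<lambda>h. cmod ((exp (of_real h * z) - 1) / of_real h - z) * norm \<phi>) \<longlongrightarrow> 0) (at_right 0)"
    proof -
      have "((\<lambda>h. (exp (of_real h * z) - 1) / of_real h) \<longlongrightarrow> z) (at_right 0)"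
        by (rule exp_difference_quotient)
      thus ?thesis by (auto intro!: tendsto_mult_left_zero tendsto_norm_zero simp: LIM_zero_iff)
    qed
    ultimately have "((\<lambda>h. norm (complex_of_real (1 / h) *\<^sub>C (S h \<phi> - \<phi>) - z *\<^sub>C \<phi>)
        + cmod ((exp (of_real h * z) - 1) / of_real h - z) * norm \<phi>) \<longlongrightarrow> 0) (at_right 0)"
      by (auto intro: tendsto_add_zero)
    moreover have "\<forall>\<^sub>F h in at_right 0. E h / h \<le> norm (complex_of_real (1 / h) *\<^sub>C (S h \<phi> - \<phi>) - z *\<^sub>C \<phi>)
        + cmod ((exp (of_real h * z) - 1) / of_real h - z) * norm \<phi>"
      using eventually_at_right_less[of "0::real"]
    proof eventually_elim
      fix h :: real assume h: "h > 0"
      have "E h / h = norm (complex_of_real (1 / h) *\<^sub>C (S h \<phi> - exp (of_real h * z) *\<^sub>C \<phi>))"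
        using h by (simp add: E_def norm_scaleC norm_divide)
      also have "complex_of_real (1 / h) *\<^sub>C (S h \<phi> - exp (of_real h * z) *\<^sub>C \<phi>)
          = (complex_of_real (1 / h) *\<^sub>C (S h \<phi> - \<phi>) - z *\<^sub>C \<phi>)
            - ((exp (of_real h * z) - 1) / of_real h - z) *\<^sub>C \<phi>"
        by (simp add: complex_vector.scale_left_diff_distrib complex_vector.scale_right_diff_distrib
            diff_divide_distrib)
      finally show "E h / h \<le> norm (complex_of_real (1 / h) *\<^sub>C (S h \<phi> - \<phi>) - z *\<^sub>C \<phi>)
        + cmod ((exp (of_real h * z) - 1) / of_real h - z) * norm \<phi>"
        using norm_triangle_ineq4 by (metis norm_scaleC)
    qed
    moreover have "\<forall>\<^sub>F h in at_right 0. 0 \<le> E h / h"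
      using eventually_at_right_less[of "0::real"] by eventually_elim (simp add: E_def)
    ultimately show ?thesis by - (rule tendsto_sandwich[OF _ _ tendsto_const]; assumption)
  qed
  \<comment> \<open>Telescoping over the steps; \<open>\<omega>\<close> bounds the growth of the semigroup and of the exponential alike.\<close>
  have steps: "E (real n * h) \<le> real n * M * exp (2 * \<omega> * (real n * h)) * E h" if h: "h > 0" for n h
  proof (induction n)
    case 0
    show ?case by (simp add: E_def S0)
  next
    case (Suc n)
    let ?n = "real n * h"
    have n: "0 \<le> ?n" using h by simp
    have split: "S (real (Suc n) * h) \<phi> - exp (of_real (real (Suc n) * h) * z) *\<^sub>C \<phi>
        = S ?n (S h \<phi> - exp (of_real h * z) *\<^sub>C \<phi>)
          + exp (of_real h * z) *\<^sub>C (S ?n \<phi> - exp (of_real ?n * z) *\<^sub>C \<phi>)"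
    proof -
      have "S (real (Suc n) * h) \<phi> = S ?n (S h \<phi>)"
        using Sadd[OF n, of h \<phi>] h by (simp add: algebra_simps)
      moreover have "exp (of_real (real (Suc n) * h) * z) = exp (of_real h * z) * exp (of_real ?n * z)"
        by (simp add: algebra_simps flip: exp_add)
      moreover have "S ?n (exp (of_real h * z) *\<^sub>C \<phi>) = exp (of_real h * z) *\<^sub>C S ?n \<phi>"
        by (rule bounded_clinear_scaleC[OF S[OF n]]) simp
      ultimately show ?thesis
        by (simp add: S_diff[OF n] complex_vector.scale_right_diff_distrib)
    qed
    have exp_h: "cmod (exp (of_real h * z)) \<le> exp (\<omega> * h)"
    proof -
      have "Re z * h \<le> \<omega> * h" using order_trans[OF complex_Re_le_cmod \<omega>(1)] h by (intro mult_right_mono) auto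
      thus ?thesis by (simp add: mult.commute)
    qed
    have "E (real (Suc n) * h) \<le> M * exp (\<omega> * ?n) * E h + exp (\<omega> * h) * E ?n"
      unfolding E_def split
      by (rule order_trans[OF norm_triangle_ineq add_mono[OF M[OF n]]])
         (simp add: norm_scaleC mult_right_mono exp_h del: norm_exp_eq_Re)
    also have "\<dots> \<le> M * exp (2 * \<omega> * (real (Suc n) * h)) * E h
        + exp (\<omega> * h) * (real n * M * exp (2 * \<omega> * ?n) * E h)"
    proof (intro add_mono mult_right_mono mult_left_mono Suc)
      have "\<omega> * ?n \<le> 2 * \<omega> * ?n" using \<omega>(2) n by (intro mult_right_mono) auto
      also have "\<dots> \<le> 2 * \<omega> * (real (Suc n) * h)" using \<omega>(2) h by (intro mult_left_mono mult_right_mono) auto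
      finally show "exp (\<omega> * ?n) \<le> exp (2 * \<omega> * (real (Suc n) * h))" by simp
    qed (use M1 in \<open>auto simp: E_def\<close>)
    also have "exp (\<omega> * h) * (real n * M * exp (2 * \<omega> * ?n) * E h)
        = real n * M * exp (\<omega> * h + 2 * \<omega> * ?n) * E h"
      by (simp add: exp_add)
    also have "\<dots> \<le> real n * M * exp (2 * \<omega> * (real (Suc n) * h)) * E h"
    proof (intro mult_right_mono mult_left_mono)
      have "0 \<le> \<omega> * h" using \<omega>(2) h by simp
      thus "exp (\<omega> * h + 2 * \<omega> * ?n) \<le> exp (2 * \<omega> * (real (Suc n) * h))" by (simp add: algebra_simps)
    qed (use M1 in \<open>auto simp: E_def\<close>)
    finally show ?case by (simp add: algebra_simps)
  qed
  have "E t \<le> 0"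
  proof (rule tendsto_lowerbound)
    have "filterlim (\<lambda>n. t / real (Suc n)) (at_right 0) sequentially"
      unfolding filterlim_at using t LIMSEQ_Suc[OF lim_const_over_n[of t]]
      by (simp del: of_nat_Suc)
    hence "(\<lambda>n. E (t / real (Suc n)) / (t / real (Suc n))) \<longlonglongrightarrow> 0"
      by (rule filterlim_compose[OF E_lim])
    thus "(\<lambda>n. M * exp (2 * \<omega> * t) * t * (E (t / real (Suc n)) / (t / real (Suc n)))) \<longlonglongrightarrow> 0"
      by (rule tendsto_mult_right_zero)
    show "\<forall>\<^sub>F n in sequentially. E t \<le> M * exp (2 * \<omega> * t) * t * (E (t / real (Suc n)) / (t / real (Suc n)))"
    proof (intro always_eventually allI)
      fix n
      have "real (Suc n) * (t / real (Suc n)) = t" by (simp del: of_nat_Suc)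
      hence "E t \<le> real (Suc n) * M * exp (2 * \<omega> * t) * E (t / real (Suc n))"
        using steps[of "t / real (Suc n)" "Suc n"] t by (simp del: of_nat_Suc)
      also have "\<dots> = M * exp (2 * \<omega> * t) * t * (E (t / real (Suc n)) / (t / real (Suc n)))"
        using t by (simp add: field_simps del: of_nat_Suc)
      finally show "E t \<le> \<dots>" .
    qed
  qed simp
  thus ?thesis by (simp add: E_def)
qed

lemma spectral_bound:
  assumes "diagonalizable D A \<phi> lam"
  obtains \<omega> where "\<And>i n. Re (lam i n) \<le> \<omega>"
proof -
  obtain S where gen: "generates UNIV norm D A S" and growth: "finite_growth_bound UNIV norm S"
    using assms by (auto simp: diagonalizable_def)
  obtain M \<omega> where M: "\<And>t f. t \<ge> 0 \<Longrightarrow> norm (S t f) \<le> M * exp (\<omega> * t) * norm f"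
    using growth by (auto simp: finite_growth_bound_def)
  have "Re (lam i n) \<le> \<omega>" for i n
  proof (rule ccontr)
    assume "\<not> Re (lam i n) \<le> \<omega>"
    hence pos: "Re (lam i n) - \<omega> > 0" by simp
    have eig: "\<phi> i n \<in> D" "A (\<phi> i n) = lam i n *\<^sub>C \<phi> i n" and rb: "riesz_basis (\<lambda>(i, n). \<phi> i n)"
      using assms by (auto simp: diagonalizable_def)
    have nz: "norm (\<phi> i n) > 0" using riesz_basis_nonzero[OF rb, of "(i, n)"] by simp
    have le: "exp (t * Re (lam i n)) \<le> M * exp (\<omega> * t)" if "t > 0" for t
    proof -
      have "exp (t * Re (lam i n)) * norm (\<phi> i n) \<le> M * exp (\<omega> * t) * norm (\<phi> i n)"
        using M[of t "\<phi> i n"] that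
        by (simp add: eigenvector_semigroup[OF gen growth eig that] norm_scaleC)
      thus ?thesis using nz by simp
    qed
    have "exp (t * (Re (lam i n) - \<omega>)) \<le> M" if "t > 0" for t
      using le[OF that] by (simp add: right_diff_distrib exp_diff divide_le_eq mult.commute)
    moreover obtain t where "t > 0" "exp (t * (Re (lam i n) - \<omega>)) > M"
    proof
      let ?t = "(\<bar>M\<bar> + 1) / (Re (lam i n) - \<omega>)"
      show "?t > 0" using pos by simp
      have "\<bar>M\<bar> + 1 < exp (\<bar>M\<bar> + 1)" using exp_ge_add_one_self[of "\<bar>M\<bar> + 1"] by linarith
      thus "exp (?t * (Re (lam i n) - \<omega>)) > M" using pos by simp
    qed
    ultimately show False by (meson not_less)
  qed
  thus ?thesis by (rule that)
qed


section \<open>A Schur test for weighted matrices\<close>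

text \<open>
  Weighted Cauchy-Schwarz on finite sections, which avoids any question of summability until the bounds
  are uniform.
\<close>

lemma schur_test:
  fixes k :: "nat \<Rightarrow> nat \<Rightarrow> real" and x v :: "nat \<Rightarrow> real"
  assumes k: "\<And>p n. k p n \<ge> 0" and x: "\<And>n. x n \<ge> 0" and v: "\<And>n. v n > 0"
    and rows: "\<And>p M. (\<Sum>n<M. k p n * v n) \<le> R * v p"
    and cols: "\<And>n M. (\<Sum>p<M. k p n * v p) \<le> R * v n"
    and sx: "summable (\<lambda>n. (x n)\<^sup>2)"
  shows "summable (\<lambda>n. k p n * x n)"
    and "summable (\<lambda>p. (\<Sum>n. k p n * x n)\<^sup>2)"
    and "(\<Sum>p. (\<Sum>n. k p n * x n)\<^sup>2) \<le> R\<^sup>2 * (\<Sum>n. (x n)\<^sup>2)"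
proof -
  define X where "X = (\<Sum>n. (x n)\<^sup>2)"
  have R: "R \<ge> 0" using rows[of 0 0] v[of 0] by (auto simp: zero_le_mult_iff)
  have X: "(\<Sum>n<M. (x n)\<^sup>2) \<le> X" for M
    unfolding X_def by (rule sum_le_suminf[OF sx]) auto
  have finite: "(\<Sum>p<P. (\<Sum>n<M. k p n * x n)\<^sup>2) \<le> R\<^sup>2 * X" for P M
  proof -
    have "(\<Sum>n<M. k p n * x n)\<^sup>2 \<le> R * v p * (\<Sum>n<M. k p n * (x n)\<^sup>2 / v n)" for p
    proof -
      have "(\<Sum>n<M. k p n * x n)\<^sup>2 = (\<Sum>n<M. sqrt (k p n * v n) * (sqrt (k p n / v n) * x n))\<^sup>2"
        using k less_imp_neq[OF v, symmetric]
        by (simp add: mult.assoc[symmetric] real_sqrt_mult[symmetric] del: real_sqrt_mult_self)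
      also have "\<dots> \<le> (\<Sum>n<M. (sqrt (k p n * v n))\<^sup>2) * (\<Sum>n<M. (sqrt (k p n / v n) * x n)\<^sup>2)"
        by (rule Cauchy_Schwarz_ineq_sum)
      also have "\<dots> = (\<Sum>n<M. k p n * v n) * (\<Sum>n<M. k p n * (x n)\<^sup>2 / v n)"
        using k v by (simp add: power_mult_distrib less_imp_le)
      also have "\<dots> \<le> R * v p * (\<Sum>n<M. k p n * (x n)\<^sup>2 / v n)"
        using k v by (intro mult_right_mono rows sum_nonneg) (simp add: less_imp_le)
      finally show ?thesis .
    qed
    hence "(\<Sum>p<P. (\<Sum>n<M. k p n * x n)\<^sup>2) \<le> (\<Sum>p<P. R * v p * (\<Sum>n<M. k p n * (x n)\<^sup>2 / v n))"
      by (rule sum_mono)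
    also have "\<dots> = R * (\<Sum>n<M. (x n)\<^sup>2 / v n * (\<Sum>p<P. k p n * v p))"
      unfolding sum_distrib_left by (subst sum.swap) (simp add: mult_ac)
    also have "\<dots> \<le> R * (\<Sum>n<M. (x n)\<^sup>2 / v n * (R * v n))"
      using v by (intro mult_left_mono sum_mono cols R) (simp add: less_imp_le)
    also have "\<dots> = R\<^sup>2 * (\<Sum>n<M. (x n)\<^sup>2)"
      using v by (simp add: sum_distrib_left power2_eq_square less_imp_neq[OF v, symmetric] mult_ac)
    also have "\<dots> \<le> R\<^sup>2 * X" by (intro mult_left_mono X) simp
    finally show ?thesis .
  qed
  have X0: "0 \<le> R\<^sup>2 * X" using finite[of 0 0] by simp
  show row: "summable (\<lambda>n. k p n * x n)" for p
  proof (rule summableI_nonneg_bounded)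
    fix M
    have "(\<Sum>n<M. k p n * x n)\<^sup>2 \<le> (\<Sum>q<Suc p. (\<Sum>n<M. k q n * x n)\<^sup>2)"
      by (rule member_le_sum) auto
    also have "\<dots> \<le> (sqrt (R\<^sup>2 * X))\<^sup>2"
      using finite[of M "Suc p"] by (simp only: real_sqrt_pow2[OF X0])
    finally show "(\<Sum>n<M. k p n * x n) \<le> sqrt (R\<^sup>2 * X)"
      by (rule power2_le_imp_le) (simp add: X0)
  qed (simp add: k x)
  have bound: "(\<Sum>p<P. (\<Sum>n. k p n * x n)\<^sup>2) \<le> R\<^sup>2 * X" for P
  proof (rule LIMSEQ_le_const2)
    show "(\<lambda>M. \<Sum>p<P. (\<Sum>n<M. k p n * x n)\<^sup>2) \<longlonglongrightarrow> (\<Sum>p<P. (\<Sum>n. k p n * x n)\<^sup>2)"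
      by (intro tendsto_intros summable_LIMSEQ row)
  qed (use finite in blast)
  show s: "summable (\<lambda>p. (\<Sum>n. k p n * x n)\<^sup>2)"
    by (rule summableI_nonneg_bounded[OF _ bound]) simp
  show "(\<Sum>p. (\<Sum>n. k p n * x n)\<^sup>2) \<le> R\<^sup>2 * (\<Sum>n. (x n)\<^sup>2)"
    using suminf_le_const[OF s bound] by (simp add: X_def)
qed

definition matrix_op ::
  "('i \<Rightarrow> nat \<Rightarrow> nat \<Rightarrow> complex) \<Rightarrow> ('i \<Rightarrow> nat \<Rightarrow> complex) \<Rightarrow> ('i \<Rightarrow> nat \<Rightarrow> complex)" where
  "matrix_op a f = (\<lambda>i p. \<Sum>n. a i p n * f i n)"

lemma matrix_op_unit_series: "matrix_op a (unit_series i n) = (\<lambda>j p. if j = i then a i p n else 0)"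
proof (intro ext)
  fix j p
  have "(\<lambda>q. a j p q * unit_series i n j q) = (\<lambda>q. if q = n then if j = i then a i p n else 0 else 0)"
    by (auto simp: unit_series_def)
  thus "matrix_op a (unit_series i n) j p = (if j = i then a i p n else 0)"
    unfolding matrix_op_def by (simp add: sums_unique[OF sums_single, symmetric])
qed

text \<open>
  The Schur test with the weight \<open>n\<^sup>-\<^sup>1\<^sup>/\<^sup>2\<close>, the borderline power for square summability.
\<close>

lemma matrix_op_bounded:
  fixes a :: "'i::finite \<Rightarrow> nat \<Rightarrow> nat \<Rightarrow> complex"
  assumes rows: "\<And>i p M. (\<Sum>n<M. cmod (a i p n) * (real (Suc p) / real (Suc n)) powr (s $ i + 1/2)) \<le> R"
    and cols: "\<And>i n M. (\<Sum>p<M. cmod (a i p n) * (real (Suc p) / real (Suc n)) powr (s $ i - 1/2)) \<le> R"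
  shows "bounded_clinear_on (hspace s) (hnorm s) (hspace s) (hnorm s) (matrix_op a)"
    and "f \<in> hspace s \<Longrightarrow> summable (\<lambda>n. cmod (a i p n * f i n))"
proof -
  define k where "k i p n = cmod (a i p n) * (real (Suc p) / real (Suc n)) powr (s $ i)" for i p n
  define v where "v n = real (Suc n) powr (- 1/2)" for n
  define x where "x f i n = real (Suc n) powr (s $ i) * cmod (f i n)" for f :: "'i \<Rightarrow> nat \<Rightarrow> complex" and i n
  have R: "R \<ge> 0" using rows[of undefined 0 0] by simp
  have k: "k i p n \<ge> 0" for i p n by (simp add: k_def)
  have v: "v n > 0" for n by (simp add: v_def)
  have x: "x f i n \<ge> 0" for f i n by (simp add: x_def)
  have shift: "(P / N) powr t * N powr (- h) = (P / N) powr (t + h) * P powr (- h)"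
    if "P > 0" "N > 0" for P N t h :: real
    using that by (simp add: powr_add powr_divide powr_minus field_simps)
  have kv1: "k i p n * v n = cmod (a i p n) * (real (Suc p) / real (Suc n)) powr (s $ i + 1/2) * v p" for i p n
    using shift[of "real (Suc p)" "real (Suc n)" "s $ i" "1/2"] by (simp add: k_def v_def mult.assoc)
  have kv2: "k i p n * v p = cmod (a i p n) * (real (Suc p) / real (Suc n)) powr (s $ i - 1/2) * v n" for i p n
    using shift[of "real (Suc p)" "real (Suc n)" "s $ i - 1/2" "1/2"] by (simp add: k_def v_def mult.assoc)
  have krows: "(\<Sum>n<M. k i p n * v n) \<le> R * v p" for i p M
    unfolding kv1 sum_distrib_right[symmetric] by (intro mult_right_mono rows less_imp_le v)
  have kcols: "(\<Sum>p<M. k i p n * v p) \<le> R * v n" for i n M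
    unfolding kv2 sum_distrib_right[symmetric] by (intro mult_right_mono cols less_imp_le v)
  have kx: "k i p n * x f i n = real (Suc p) powr (s $ i) * cmod (a i p n * f i n)" for f i p n
    by (simp add: k_def x_def powr_divide norm_mult field_simps del: of_nat_Suc)
  have sx: "summable (\<lambda>n. (x f i n)\<^sup>2)" if "f \<in> hspace s" for f i
    using that by (simp only: hspace_iff x_def)
  have schur: "summable (\<lambda>n. k i p n * x f i n)" "summable (\<lambda>p. (\<Sum>n. k i p n * x f i n)\<^sup>2)"
      "(\<Sum>p. (\<Sum>n. k i p n * x f i n)\<^sup>2) \<le> R\<^sup>2 * (\<Sum>n. (x f i n)\<^sup>2)"
    if "f \<in> hspace s" for f i p
    by (rule schur_test[OF k x v krows kcols sx[OF that]])+
  show abs: "summable (\<lambda>n. cmod (a i p n * f i n))" if "f \<in> hspace s" for f i p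
    using schur(1)[OF that, of i p] unfolding kx by (subst (asm) summable_cmult_iff) simp
  have conv: "summable (\<lambda>n. a i p n * f i n)" if "f \<in> hspace s" for f i p
    by (rule summable_norm_cancel[OF abs[OF that]])
  have le: "(real (Suc p) powr (s $ i) * cmod (matrix_op a f i p))\<^sup>2 \<le> (\<Sum>n. k i p n * x f i n)\<^sup>2"
    if f: "f \<in> hspace s" for f i p
  proof (intro power_mono)
    have "cmod (matrix_op a f i p) \<le> (\<Sum>n. cmod (a i p n * f i n))"
      unfolding matrix_op_def by (rule summable_norm[OF abs[OF f]])
    thus "real (Suc p) powr (s $ i) * cmod (matrix_op a f i p) \<le> (\<Sum>n. k i p n * x f i n)"
      unfolding kx by (subst suminf_mult[OF abs[OF f]]) (intro mult_left_mono, auto)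
  qed simp
  have sum_le: "summable (\<lambda>p. (real (Suc p) powr (s $ i) * cmod (matrix_op a f i p))\<^sup>2)" if f: "f \<in> hspace s" for f i
    by (rule summable_comparison_test'[of _ 0, OF schur(2)[OF f, of i]]) (use le[OF f] in \<open>simp del: of_nat_Suc\<close>)
  have in_s: "matrix_op a f \<in> hspace s" if f: "f \<in> hspace s" for f
    unfolding hspace_iff by (intro allI sum_le f)
  have norm_le: "hnorm s (matrix_op a f) \<le> R * hnorm s f" if f: "f \<in> hspace s" for f
  proof -
    have "(hnorm s (matrix_op a f))\<^sup>2 \<le> (\<Sum>i\<in>UNIV. R\<^sup>2 * (\<Sum>n. (x f i n)\<^sup>2))"
      unfolding hnorm_sq[OF in_s[OF f]]
    proof (rule sum_mono)
      fix i
      have "(\<Sum>p. (real (Suc p) powr (s $ i) * cmod (matrix_op a f i p))\<^sup>2) \<le> (\<Sum>p. (\<Sum>n. k i p n * x f i n)\<^sup>2)"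
        by (rule suminf_le[OF le[OF f] sum_le[OF f] schur(2)[OF f]])
      also have "\<dots> \<le> R\<^sup>2 * (\<Sum>n. (x f i n)\<^sup>2)" by (rule schur(3)[OF f])
      finally show "(\<Sum>p. (real (Suc p) powr (s $ i) * cmod (matrix_op a f i p))\<^sup>2) \<le> \<dots>" .
    qed
    also have "\<dots> = (R * hnorm s f)\<^sup>2"
      by (simp only: power_mult_distrib hnorm_sq[OF f] x_def sum_distrib_left)
    finally show ?thesis by (rule power2_le_imp_le) (intro mult_nonneg_nonneg R hnorm_nonneg[OF f])
  qed
  show "bounded_clinear_on (hspace s) (hnorm s) (hspace s) (hnorm s) (matrix_op a)"
    unfolding bounded_clinear_on_def
  proof (intro conjI ballI allI exI)
    fix f assume f: "f \<in> hspace s"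
    show "matrix_op a f \<in> hspace s" by (rule in_s[OF f])
    show "hnorm s (matrix_op a f) \<le> R * hnorm s f" by (rule norm_le[OF f])
    show "matrix_op a (c *\<^sub>C f) = c *\<^sub>C matrix_op a f" for c
      by (simp add: matrix_op_def fun_eq_iff suminf_mult[OF conv[OF f], symmetric] mult.left_commute)
    fix g assume g: "g \<in> hspace s"
    show "matrix_op a (f + g) = matrix_op a f + matrix_op a g"
      by (simp add: matrix_op_def fun_eq_iff suminf_add[OF conv[OF f] conv[OF g]] distrib_left)
  qed
qed

text \<open>
  A summable power is supplied by the distance to the diagonal or, when the row index is much larger than
  the column index, by the latter.
\<close>

lemma kernel_pointwise:
  fixes \<theta> a :: real and p n :: nat
  assumes \<theta>: "\<theta> > 0" and a: "- \<theta> < a" "a \<le> \<theta> + 1" and ne: "p \<noteq> n"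
  defines "d \<equiv> min \<theta> (\<theta> + a)" and "P \<equiv> real (Suc p)" and "N \<equiv> real (Suc n)"
  shows "(P / N) powr a * max P N powr (- \<theta>) / \<bar>P - N\<bar>
       \<le> (2 powr \<bar>a\<bar> + 2) * (N powr (-1 - d) + \<bar>P - N\<bar> powr (-1 - d))"
proof -
  let ?m = "\<bar>P - N\<bar>"
  let ?K = "(P / N) powr a * max P N powr (- \<theta>)"
  have P: "P \<ge> 1" and N: "N \<ge> 1" and m: "?m \<ge> 1" using ne by (auto simp: P_def N_def)
  have d: "d > 0" "d \<le> \<theta>" "d \<le> \<theta> + a" using \<theta> a by (auto simp: d_def)
  have A: "2 powr \<bar>a\<bar> \<ge> (1::real)" by (simp add: ge_one_powr_ge_zero)
  have near: "?K / ?m \<le> (2 powr \<bar>a\<bar> + 2) * (N powr (-1 - d) + ?m powr (-1 - d))"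
    if "?K \<le> 2 powr \<bar>a\<bar> * ?m powr (- d)"
  proof -
    have "?K / ?m \<le> 2 powr \<bar>a\<bar> * ?m powr (- d) / ?m" using that m by (intro divide_right_mono) auto
    also have "\<dots> = 2 powr \<bar>a\<bar> * ?m powr (-1 - d)"
      using m by (simp add: powr_diff powr_minus field_simps)
    also have "\<dots> \<le> (2 powr \<bar>a\<bar> + 2) * (N powr (-1 - d) + ?m powr (-1 - d))"
      by (intro mult_mono) auto
    finally show ?thesis .
  qed
  \<comment> \<open>In the last case \<open>\<bar>P - N\<bar> \<ge> P / 2\<close>, and the surplus power of \<open>P\<close> is traded for one of \<open>N\<close>.\<close>
  consider "P < N" | "P > N" "a \<le> 0 \<or> P \<le> 2 * N" | "a > 0" "P > 2 * N"
    using ne by (fastforce simp: P_def N_def)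
  thus ?thesis
  proof cases
    case 1
    have "?K \<le> N powr (- d)"
    proof (cases "a \<ge> 0")
      case True
      have "(P / N) powr a \<le> 1" using True 1 P N by (simp add: powr_le1)
      hence "?K \<le> 1 * N powr (- \<theta>)" using 1 by (intro mult_mono) auto
      also have "\<dots> \<le> N powr (- d)" using d N by (simp add: powr_mono)
      finally show ?thesis .
    next
      case False
      have "(P / N) powr a = (N / P) powr (- a)" using P N by (simp add: powr_divide powr_minus field_simps)
      also have "\<dots> \<le> N powr (- a)" using False P N by (intro powr_mono2) (auto simp: field_simps)
      finally have "?K \<le> N powr (- a) * N powr (- \<theta>)" using 1 by (intro mult_mono) auto
      also have "\<dots> = N powr (- (\<theta> + a))" by (simp add: algebra_simps flip: powr_add)
      also have "\<dots> \<le> N powr (- d)" using d N by (simp add: powr_mono)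
      finally show ?thesis .
    qed
    also have "\<dots> \<le> ?m powr (- d)" using 1 P m d by (intro powr_mono2') auto
    also have "\<dots> \<le> 2 powr \<bar>a\<bar> * ?m powr (- d)" using mult_right_mono[OF A, of "?m powr (- d)"] by simp
    finally show ?thesis by (rule near)
  next
    case 2
    have "(P / N) powr a \<le> 2 powr \<bar>a\<bar>"
    proof (cases "a \<le> 0")
      case True
      have "(P / N) powr a \<le> (P / N) powr 0" using True 2 N by (intro powr_mono) (auto simp: field_simps)
      thus ?thesis using A P N by (simp split: if_splits)
    next
      case False
      have "(P / N) powr a \<le> 2 powr a" using False 2 N P by (intro powr_mono2) (auto simp: field_simps)
      thus ?thesis using False by simp
    qed
    moreover have "max P N powr (- \<theta>) \<le> ?m powr (- d)"
    proof -
      have "P powr (- \<theta>) \<le> P powr (- d)" using d P by (intro powr_mono) auto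
      also have "\<dots> \<le> ?m powr (- d)" using 2 N m d by (intro powr_mono2') auto
      finally show ?thesis using 2 by (simp add: max_def)
    qed
    ultimately show ?thesis by (intro near mult_mono) auto
  next
    case 3
    have PN: "P > N" using 3(2) N by linarith
    have "?K / ?m = P powr (a - \<theta>) * N powr (- a) / (P - N)"
      using PN P N by (simp add: powr_divide powr_diff powr_minus field_simps)
    also have "\<dots> \<le> P powr (a - \<theta>) * N powr (- a) / (P / 2)"
      using 3 P N by (intro divide_left_mono) auto
    also have "\<dots> = 2 * N powr (- a) * P powr (a - \<theta> - 1)"
      using powr_diff[of P "a - \<theta>" 1] P by simp
    also have "\<dots> \<le> 2 * N powr (- a) * N powr (a - \<theta> - 1)"
      using PN N a by (intro mult_left_mono powr_mono2') auto
    also have "\<dots> = 2 * N powr (- 1 - \<theta>)" by (simp add: algebra_simps flip: powr_add)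
    also have "\<dots> \<le> 2 * N powr (- 1 - d)" using d N by (simp add: powr_mono)
    also have "\<dots> \<le> (2 powr \<bar>a\<bar> + 2) * (N powr (-1 - d) + ?m powr (-1 - d))"
      by (intro mult_mono) auto
    finally show ?thesis .
  qed
qed

lemma kernel_sum_bounded:
  fixes \<theta> a :: real
  assumes \<theta>: "\<theta> > 0" and a: "- \<theta> < a" "a \<le> \<theta> + 1"
  obtains C where "C > 0" "\<And>p M. (\<Sum>n<M. (real (Suc p) / real (Suc n)) powr a
      * max (real (Suc p)) (real (Suc n)) powr (- \<theta>) / \<bar>real p - real n\<bar>) \<le> C"
proof -
  define d where "d = min \<theta> (\<theta> + a)"
  define q where "q j = real j powr (-1 - d)" for j :: nat
  have "d > 0" using \<theta> a by (simp add: d_def)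
  hence q: "summable q" unfolding q_def by (subst summable_real_powr_iff) simp
  have q0: "q j \<ge> 0" for j by (simp add: q_def)
  define D where "D = 2 powr \<bar>a\<bar> + 2"
  have D: "D > 0" by (simp add: D_def add_pos_pos)
  have inj_le: "(\<Sum>n\<in>I. q (g n)) \<le> suminf q" if "finite I" "inj_on g I" for g :: "nat \<Rightarrow> nat" and I
    using sum_le_suminf[OF q, of "g ` I"] that q0 by (simp add: sum.reindex)
  have "(\<Sum>n<M. (real (Suc p) / real (Suc n)) powr a
      * max (real (Suc p)) (real (Suc n)) powr (- \<theta>) / \<bar>real p - real n\<bar>) \<le> D * (3 * suminf q) + 1" for p M
  proof -
    have "(\<Sum>n<M. (real (Suc p) / real (Suc n)) powr a
      * max (real (Suc p)) (real (Suc n)) powr (- \<theta>) / \<bar>real p - real n\<bar>)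
      \<le> (\<Sum>n<M. D * (q (Suc n) + q (nat \<bar>int p - int n\<bar>)))"
    proof (rule sum_mono)
      fix n
      show "(real (Suc p) / real (Suc n)) powr a * max (real (Suc p)) (real (Suc n)) powr (- \<theta>) / \<bar>real p - real n\<bar>
          \<le> D * (q (Suc n) + q (nat \<bar>int p - int n\<bar>))"
      proof (cases "p = n")
        case True
        thus ?thesis using D q0 by simp
      next
        case False
        have "real (nat \<bar>int p - int n\<bar>) = \<bar>real p - real n\<bar>" by simp
        thus ?thesis using kernel_pointwise[OF \<theta> a False]
          unfolding d_def[symmetric] D_def[symmetric] q_def by simp
      qed
    qed
    also have "\<dots> = D * ((\<Sum>n<M. q (Suc n)) + (\<Sum>n<M. q (nat \<bar>int p - int n\<bar>)))"
      by (simp only: sum.distrib flip: sum_distrib_left)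
    also have "(\<Sum>n<M. q (nat \<bar>int p - int n\<bar>))
        = (\<Sum>n\<in>{..<M} \<inter> {..p}. q (nat \<bar>int p - int n\<bar>)) + (\<Sum>n\<in>{..<M} - {..p}. q (nat \<bar>int p - int n\<bar>))"
      by (rule sum.Int_Diff) simp
    also have "D * ((\<Sum>n<M. q (Suc n)) + \<dots>) \<le> D * (suminf q + (suminf q + suminf q))"
      using D by (intro mult_left_mono add_mono inj_le) (auto simp: inj_on_def)
    finally show ?thesis by simp
  qed
  moreover have "D * (3 * suminf q) + 1 > 0"
    using D suminf_nonneg[OF q q0] by (intro add_nonneg_pos) auto
  ultimately show ?thesis by (rule that[rotated])
qed


section \<open>The partial fraction identities\<close>

text \<open>
  Division by zero being zero, the factor for \<open>k = n\<close> in \<open>\<Prod>k\<in>S. 1 + z / (lam n - lam k)\<close> is \<open>1\<close>, so that this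
  is the product over \<open>k \<noteq> n\<close> and \<open>z\<close> times it is the residue at \<open>lam n\<close> of the product on the right-hand side.
\<close>

lemma partial_fraction_product:
  fixes lam :: "'n \<Rightarrow> complex"
  assumes "finite S" and "inj_on lam S" and "\<And>k. k \<in> S \<Longrightarrow> w \<noteq> lam k"
  shows "(\<Sum>n\<in>S. - z * (\<Prod>k\<in>S. 1 + z / (lam n - lam k)) / (w - lam n))
           = 1 - (\<Prod>k\<in>S. 1 + z / (w - lam k))"
  using assms
proof (induction S arbitrary: w rule: finite_induct)
  case empty
  show ?case by simp
next
  case (insert q S)
  define pr where "pr x = (\<Prod>k\<in>S. 1 + z / (x - lam k))" for x
  have ne: "w \<noteq> lam q" "\<And>n. n \<in> S \<Longrightarrow> w \<noteq> lam n" "\<And>n. n \<in> S \<Longrightarrow> lam n \<noteq> lam q"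
    using insert.prems insert.hyps(2) by (auto simp: inj_on_def)
  have IH: "(\<Sum>n\<in>S. - z * pr (lam n) / (x - lam n)) = 1 - pr x" if "\<And>k. k \<in> S \<Longrightarrow> x \<noteq> lam k" for x
    unfolding pr_def using insert.IH[of x] insert.prems(1) that by simp
  have step: "- z * (pr (lam n) * (1 + z / (lam n - lam q))) / (w - lam n)
      = - z * pr (lam n) / (w - lam n)
        + z / (w - lam q) * (- z * pr (lam n) / (w - lam n) - (- z * pr (lam n) / (lam q - lam n)))"
    if "n \<in> S" for n
    using ne(1) ne(2)[OF that] ne(3)[OF that] by (simp add: divide_simps) (simp add: algebra_simps)
  have "(\<Sum>n\<in>insert q S. - z * (\<Prod>k\<in>insert q S. 1 + z / (lam n - lam k)) / (w - lam n))
      = (\<Sum>n\<in>S. - z * (pr (lam n) * (1 + z / (lam n - lam q))) / (w - lam n)) - z * pr (lam q) / (w - lam q)"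
    using insert.hyps by (simp add: pr_def mult.commute)
  also have "(\<Sum>n\<in>S. - z * (pr (lam n) * (1 + z / (lam n - lam q))) / (w - lam n))
      = (\<Sum>n\<in>S. - z * pr (lam n) / (w - lam n))
        + z / (w - lam q) * ((\<Sum>n\<in>S. - z * pr (lam n) / (w - lam n)) - (\<Sum>n\<in>S. - z * pr (lam n) / (lam q - lam n)))"
    unfolding sum_subtractf[symmetric] sum_distrib_left sum.distrib[symmetric] by (rule sum.cong[OF refl step])
  also have "\<dots> = (1 - pr w) + z / (w - lam q) * ((1 - pr w) - (1 - pr (lam q)))"
    using ne by (subst (1 2) IH, force, subst IH, metis) simp
  also have "\<dots> - z * pr (lam q) / (w - lam q) = 1 - pr w * (1 + z / (w - lam q))"
    using ne(1) by (simp add: divide_simps) (simp add: algebra_simps)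
  finally show ?case using insert.hyps by (simp add: pr_def mult.commute)
qed

text \<open>
  For \<open>n \<noteq> p\<close> the factor for \<open>k = p\<close> cancels \<open>lam n - lam p + z\<close>. What is left is a sum for
  \<open>S - {p}\<close>, split by partial fractions into the values at \<open>w\<close> and at \<open>lam p\<close> of the previous identity.
\<close>

lemma partial_fraction_product_pole:
  fixes lam :: "'n \<Rightarrow> complex"
  assumes S: "finite S" and inj: "inj_on lam S" and w: "\<And>k. k \<in> S \<Longrightarrow> w \<noteq> lam k" and p: "p \<in> S"
    and z: "\<And>n. n \<in> S \<Longrightarrow> lam n - lam p + z \<noteq> 0"
  shows "(\<Sum>n\<in>S. - z * (\<Prod>k\<in>S. 1 + z / (lam n - lam k)) / ((w - lam n) * (lam n - lam p + z)))
           = - (\<Prod>k\<in>S - {p}. 1 + z / (w - lam k)) / (w - lam p)"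
proof -
  let ?S = "S - {p}"
  define pr where "pr x = (\<Prod>k\<in>?S. 1 + z / (x - lam k))" for x
  have ne: "lam n \<noteq> lam p" if "n \<in> ?S" for n using inj p that by (auto simp: inj_on_def)
  have z0: "z \<noteq> 0" using z[OF p] by simp
  have finS: "finite ?S" and injS: "inj_on lam ?S" using S inj by (auto intro: inj_on_subset)
  have split: "(\<Prod>k\<in>S. 1 + z / (x - lam k)) = (1 + z / (x - lam p)) * pr x" for x
    unfolding pr_def using prod.remove[OF S p] .
  have "(\<Sum>n\<in>S. - z * (\<Prod>k\<in>S. 1 + z / (lam n - lam k)) / ((w - lam n) * (lam n - lam p + z)))
      = - pr (lam p) / (w - lam p)
        + (\<Sum>n\<in>?S. - z * ((1 + z / (lam n - lam p)) * pr (lam n)) / ((w - lam n) * (lam n - lam p + z)))"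
    unfolding split by (subst sum.remove[OF S p]) (use z0 in simp)
  also have "(\<Sum>n\<in>?S. - z * ((1 + z / (lam n - lam p)) * pr (lam n)) / ((w - lam n) * (lam n - lam p + z)))
      = (\<Sum>n\<in>?S. 1 / (w - lam p) * (- z * pr (lam n) / (w - lam n) - (- z * pr (lam n) / (lam p - lam n))))"
  proof (rule sum.cong[OF refl])
    fix n assume n: "n \<in> ?S"
    define d where "d = lam n - lam p"
    define v where "v = w - lam n"
    have d: "d \<noteq> 0" "d + z \<noteq> 0" "v \<noteq> 0" "v + d \<noteq> 0"
      using ne[OF n] z[of n] w[of n] w[OF p] n by (auto simp: d_def v_def)
    have eqs: "lam n - lam p = d" "w - lam n = v" "w - lam p = v + d" "lam p - lam n = - d"
      by (auto simp: d_def v_def)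
    have "1 + z / d = (d + z) / d" using d by (simp add: field_simps)
    hence "- z * ((1 + z / d) * pr (lam n)) / (v * (d + z)) = - z * pr (lam n) / (v * d)"
      using d by simp
    also have "\<dots> = 1 / (v + d) * (- z * pr (lam n) / v - (- z * pr (lam n) / (- d)))"
      using d by (simp add: divide_simps) (simp add: algebra_simps)
    finally show "- z * ((1 + z / (lam n - lam p)) * pr (lam n)) / ((w - lam n) * (lam n - lam p + z))
        = 1 / (w - lam p) * (- z * pr (lam n) / (w - lam n) - (- z * pr (lam n) / (lam p - lam n)))"
      unfolding eqs .
  qed
  also have "\<dots> = 1 / (w - lam p) * ((1 - pr w) - (1 - pr (lam p)))"
    unfolding sum_distrib_left[symmetric] sum_subtractf
  proof -
    have "(\<Sum>n\<in>?S. - z * pr (lam n) / (w - lam n)) = 1 - pr w"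
      unfolding pr_def by (rule partial_fraction_product[OF finS injS]) (use w in blast)
    moreover have "(\<Sum>n\<in>?S. - z * pr (lam n) / (lam p - lam n)) = 1 - pr (lam p)"
      unfolding pr_def by (rule partial_fraction_product[OF finS injS]) (use ne in metis)
    ultimately show "1 / (w - lam p) * ((\<Sum>n\<in>?S. - z * pr (lam n) / (w - lam n))
        - (\<Sum>n\<in>?S. - z * pr (lam n) / (lam p - lam n))) = 1 / (w - lam p) * ((1 - pr w) - (1 - pr (lam p)))"
      by (simp only:)
  qed
  also have "- pr (lam p) / (w - lam p) + \<dots> = - pr w / (w - lam p)"
    using w[OF p] by (simp add: divide_simps)
  finally show ?thesis by (simp add: pr_def)
qed

section \<open>Separated spectra\<close>

locale separated_spectrum =
  fixes lam :: "nat \<Rightarrow> complex" and \<alpha> c :: real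
  assumes \<alpha>: "\<alpha> > 1" and c: "c > 0"
    and gap: "\<And>n p. c * real (Suc n) powr (\<alpha> - 1) * \<bar>real n - real p\<bar> \<le> cmod (lam n - lam p)"
begin

lemma gap_max:
  "c * max (real (Suc n)) (real (Suc p)) powr (\<alpha> - 1) * \<bar>real n - real p\<bar> \<le> cmod (lam n - lam p)"
proof (cases "n \<le> p")
  case True
  hence "max (real (Suc n)) (real (Suc p)) = real (Suc p)" by simp
  thus ?thesis using gap[of p n] by (simp only: norm_minus_commute abs_minus_commute)
next
  case False
  hence "max (real (Suc n)) (real (Suc p)) = real (Suc n)" by simp
  thus ?thesis using gap[of n p] by (simp only:)
qed

lemma inj_lam: "lam n = lam p \<longleftrightarrow> n = p"
proof
  assume "lam n = lam p"
  hence "c * real (Suc n) powr (\<alpha> - 1) * \<bar>real n - real p\<bar> \<le> 0" using gap[of n p] by simp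
  thus "n = p" using c by (simp add: mult_le_0_iff del: of_nat_Suc)
qed simp

lemma inverse_gap_sum_bounded:
  obtains Q where "\<And>n M. (\<Sum>k<M. 1 / cmod (lam n - lam k)) \<le> Q"
proof -
  obtain C where C: "C > 0" "\<And>p M. (\<Sum>n<M. (real (Suc p) / real (Suc n)) powr 0
      * max (real (Suc p)) (real (Suc n)) powr (- (\<alpha> - 1)) / \<bar>real p - real n\<bar>) \<le> C"
    using kernel_sum_bounded[of "\<alpha> - 1" 0] \<alpha> by auto
  have "(\<Sum>k<M. 1 / cmod (lam n - lam k)) \<le> 1 / c * C" for n M
  proof -
    have "(\<Sum>k<M. 1 / cmod (lam n - lam k)) \<le> (\<Sum>k<M. 1 / c * ((real (Suc n) / real (Suc k)) powr 0
      * max (real (Suc n)) (real (Suc k)) powr (- (\<alpha> - 1)) / \<bar>real n - real k\<bar>))"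
    proof (rule sum_mono)
      fix k
      let ?m = "max (real (Suc n)) (real (Suc k))"
      have m: "?m > 0" by simp
      show "1 / cmod (lam n - lam k) \<le> 1 / c * ((real (Suc n) / real (Suc k)) powr 0
          * ?m powr (- (\<alpha> - 1)) / \<bar>real n - real k\<bar>)"
      proof (cases "n = k")
        case False
        hence "1 / cmod (lam n - lam k) \<le> 1 / (c * ?m powr (\<alpha> - 1) * \<bar>real n - real k\<bar>)"
          using c m by (intro divide_left_mono gap_max mult_pos_pos) (auto simp: inj_lam)
        also have "\<dots> = 1 / c * (1 * ?m powr (- (\<alpha> - 1)) / \<bar>real n - real k\<bar>)"
          by (simp only: powr_minus divide_inverse inverse_mult_distrib mult_1_left mult_ac)
        finally show ?thesis by simp
      qed simp
    qed
    also have "\<dots> \<le> 1 / c * C" unfolding sum_distrib_left[symmetric] using c by (intro mult_left_mono C) simp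
    finally show ?thesis .
  qed
  thus ?thesis by (rule that)
qed

text \<open>
  All but finitely many gaps exceed \<open>2 \<bar>z\<bar>\<close>, where the shift by \<open>z\<close> costs at most a factor \<open>2\<close>; on the
  remaining pairs nonresonance suffices.
\<close>

lemma nonresonant_lower_bound:
  assumes nonres: "\<And>n p. lam p - lam n \<noteq> z"
  obtains \<delta> where "\<delta> > 0" "\<And>p n. \<delta> * cmod (lam p - lam n) \<le> cmod (lam p - lam n - z)"
proof -
  \<comment> \<open>If one of two distinct indices exceeds \<open>B\<close>, their gap is at least \<open>2 \<bar>z\<bar>\<close>.\<close>
  define B where "B = (2 * cmod z / c) powr (1 / (\<alpha> - 1))"
  define F where "F = {..nat \<lceil>B\<rceil>} \<times> {..nat \<lceil>B\<rceil>}"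
  \<comment> \<open>The summand \<open>1\<close> keeps the quotient meaningful, hence positive, for \<open>p = n\<close>.\<close>
  define g where "g = (\<lambda>(p, n). cmod (lam p - lam n - z) / (cmod (lam p - lam n) + 1))"
  define \<delta> where "\<delta> = Min (insert (1/2) (g ` F))"
  have F: "finite (insert (1/2) (g ` F))" by (simp add: F_def)
  have g: "g pn > 0" for pn
    using nonres by (auto simp: g_def split: prod.split intro!: divide_pos_pos add_nonneg_pos)
  have \<delta>: "\<delta> > 0" using F g by (simp add: \<delta>_def)
  have \<delta>_half: "\<delta> \<le> 1/2" and \<delta>_g: "pn \<in> F \<Longrightarrow> \<delta> \<le> g pn" for pn
    unfolding \<delta>_def by (rule Min_le[OF F], simp)+
  have "\<delta> * cmod (lam p - lam n) \<le> cmod (lam p - lam n - z)" for p n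
  proof (cases "(p, n) \<in> F")
    case True
    have "\<delta> * cmod (lam p - lam n) \<le> \<delta> * (cmod (lam p - lam n) + 1)" using \<delta> by simp
    also have "\<dots> \<le> g (p, n) * (cmod (lam p - lam n) + 1)" using \<delta>_g[OF True] by (intro mult_right_mono) auto
    also have "\<dots> = cmod (lam p - lam n - z)" by (simp add: g_def add_nonneg_eq_0_iff)
    finally show ?thesis .
  next
    case False
    let ?m = "max (real (Suc p)) (real (Suc n))"
    have "real p > B \<or> real n > B" using False by (auto simp: F_def not_le) linarith+
    hence m: "?m \<ge> B" "?m > 0" by auto
    show ?thesis
    proof (cases "p = n")
      case False
      have B0: "B \<ge> 0" by (simp add: B_def)
      have "2 * cmod z / c = B powr (\<alpha> - 1)"
        using \<alpha> c by (simp add: B_def powr_powr)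
      also have "\<dots> \<le> ?m powr (\<alpha> - 1)" using m \<alpha> B0 by (intro powr_mono2) auto
      finally have "2 * cmod z \<le> c * ?m powr (\<alpha> - 1) * 1" using c by (simp add: field_simps)
      also have "\<dots> \<le> c * ?m powr (\<alpha> - 1) * \<bar>real p - real n\<bar>"
        using False c by (intro mult_left_mono) auto
      also have "\<dots> \<le> cmod (lam p - lam n)" by (rule gap_max)
      finally have "cmod z \<le> 1/2 * cmod (lam p - lam n)" by simp
      moreover have "cmod (lam p - lam n) - cmod z \<le> cmod (lam p - lam n - z)" by (rule norm_triangle_ineq2)
      moreover have "\<delta> * cmod (lam p - lam n) \<le> 1/2 * cmod (lam p - lam n)"
        using \<delta>_half by (intro mult_right_mono) auto
      ultimately show ?thesis by linarith
    qed simp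
  qed
  thus ?thesis using that \<delta> by blast
qed

text \<open>The residue at \<open>lam n\<close> of \<open>1 - \<Prod>k<M. 1 + z / (w - lam k)\<close> as a function of \<open>w\<close>.\<close>

definition partial_residue :: "complex \<Rightarrow> nat \<Rightarrow> nat \<Rightarrow> complex" where
  "partial_residue z M n = - z * (\<Prod>k<M. 1 + z / (lam n - lam k))"

definition residue :: "complex \<Rightarrow> nat \<Rightarrow> complex" where
  "residue z n = lim (\<lambda>M. partial_residue z M n)"

lemma partial_residue_bounded:
  obtains C where "C > 0" "\<And>M n. cmod (partial_residue z M n) \<le> C"
proof -
  obtain Q where Q: "\<And>n M. (\<Sum>k<M. 1 / cmod (lam n - lam k)) \<le> Q"
    using inverse_gap_sum_bounded by blast
  have "cmod (partial_residue z M n) \<le> cmod z * exp (cmod z * Q)" for M n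
  proof -
    have "cmod (\<Prod>k<M. 1 + z / (lam n - lam k)) = (\<Prod>k<M. cmod (1 + z / (lam n - lam k)))"
      by (rule prod_norm[symmetric])
    also have "\<dots> \<le> (\<Prod>k<M. exp (cmod z * (1 / cmod (lam n - lam k))))"
    proof (intro prod_mono conjI)
      fix k
      have "cmod (1 + z / (lam n - lam k)) \<le> 1 + cmod z * (1 / cmod (lam n - lam k))"
        using norm_triangle_ineq[of 1 "z / (lam n - lam k)"] by (simp add: norm_divide)
      also have "\<dots> \<le> exp (cmod z * (1 / cmod (lam n - lam k)))" by (rule exp_ge_add_one_self)
      finally show "cmod (1 + z / (lam n - lam k)) \<le> exp (cmod z * (1 / cmod (lam n - lam k)))" .
    qed simp
    also have "\<dots> = exp (cmod z * (\<Sum>k<M. 1 / cmod (lam n - lam k)))"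
      by (simp add: exp_sum sum_distrib_left)
    also have "\<dots> \<le> exp (cmod z * Q)" using Q by (simp add: mult_left_mono)
    finally show ?thesis by (simp add: partial_residue_def norm_mult mult_left_mono)
  qed
  hence "cmod (partial_residue z M n) \<le> cmod z * exp (cmod z * Q) + 1" for M n
    by (smt (verit))
  thus ?thesis by (intro that[of "cmod z * exp (cmod z * Q) + 1"]) (auto intro: add_nonneg_pos)
qed

lemma summable_inverse_gap: "summable (\<lambda>k. 1 / cmod (lam n - lam k))"
proof -
  obtain Q where Q: "\<And>n M. (\<Sum>k<M. 1 / cmod (lam n - lam k)) \<le> Q"
    using inverse_gap_sum_bounded by blast
  show ?thesis by (rule summableI_nonneg_bounded[OF _ Q]) simp
qed

lemma residue_tendsto: "(\<lambda>M. partial_residue z M n) \<longlonglongrightarrow> residue z n"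
proof -
  have "summable (\<lambda>k. norm ((1 + z / (lam n - lam k)) - 1))"
    using summable_mult[OF summable_inverse_gap[of n], of "cmod z"] by (simp add: norm_divide)
  hence "convergent_prod (\<lambda>k. 1 + z / (lam n - lam k))"
    by (intro abs_convergent_prod_imp_convergent_prod summable_imp_abs_convergent_prod)
  hence "convergent (\<lambda>M. \<Prod>k\<le>M. 1 + z / (lam n - lam k))"
    by (rule convergent_prod_imp_convergent)
  then obtain L where "(\<lambda>M. \<Prod>k\<le>M. 1 + z / (lam n - lam k)) \<longlonglongrightarrow> L"
    by (auto simp: convergent_def)
  hence "(\<lambda>M. \<Prod>k<Suc M. 1 + z / (lam n - lam k)) \<longlonglongrightarrow> L"
    by (simp only: lessThan_Suc_atMost)
  hence "(\<lambda>M. \<Prod>k<M. 1 + z / (lam n - lam k)) \<longlonglongrightarrow> L" by (rule LIMSEQ_imp_Suc)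
  hence "(\<lambda>M. partial_residue z M n) \<longlonglongrightarrow> - z * L"
    unfolding partial_residue_def by (intro tendsto_intros)
  hence "convergent (\<lambda>M. partial_residue z M n)" by (auto simp: convergent_def)
  thus ?thesis unfolding residue_def by (rule convergent_LIMSEQ_iff[THEN iffD1])
qed

lemma residue_bounded:
  obtains C where "C > 0" "\<And>n. cmod (residue z n) \<le> C"
proof -
  obtain C where C: "C > 0" "\<And>M n. cmod (partial_residue z M n) \<le> C"
    using partial_residue_bounded by blast
  have "cmod (residue z n) \<le> C" for n
    by (rule LIMSEQ_le_const2[OF tendsto_norm[OF residue_tendsto]]) (use C(2) in blast)
  thus ?thesis using that C(1) by blast
qed

lemma summable_inverse_shifted_gap:
  assumes nonres: "\<And>n p. lam p - lam n \<noteq> z"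
  shows "summable (\<lambda>n. 1 / cmod (lam q - lam n - z))"
proof -
  obtain \<delta> where \<delta>: "\<delta> > 0" "\<And>p n. \<delta> * cmod (lam p - lam n) \<le> cmod (lam p - lam n - z)"
    using nonresonant_lower_bound[OF nonres] by blast
  show ?thesis
  proof (rule summable_comparison_test'[of _ "Suc q"])
    show "summable (\<lambda>n. 1 / \<delta> * (1 / cmod (lam q - lam n)))"
      by (intro summable_mult summable_inverse_gap)
    fix n assume "Suc q \<le> n"
    hence "cmod (lam q - lam n) > 0" by (simp add: inj_lam)
    moreover have "cmod (lam q - lam n - z) > 0" using nonres by simp
    ultimately have "1 / cmod (lam q - lam n - z) \<le> 1 / (\<delta> * cmod (lam q - lam n))"
      using \<delta> by (intro divide_left_mono \<delta>(2)) auto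
    thus "norm (1 / cmod (lam q - lam n - z)) \<le> 1 / \<delta> * (1 / cmod (lam q - lam n))" by simp
  qed
qed

text \<open>
  The common passage to the limit of infinitely many eigenvalues, by dominated convergence: the residues of the
  finite products are bounded uniformly, and the shifted inverse gaps are summable.
\<close>

lemma residue_sums_limit:
  assumes nonres: "\<And>n p. lam p - lam n \<noteq> z"
    and h: "\<And>n M. cmod (h n M) \<le> H" and h_lim: "\<And>n. h n \<longlonglongrightarrow> g n"
    and fin: "\<forall>\<^sub>F M in sequentially. (\<Sum>n<M. partial_residue z M n / (lam q - lam n - z) * h n M) = l"
  shows "(\<lambda>n. residue z n / (lam q - lam n - z) * g n) sums l"
proof -
  define a where "a n M = (if n < M then partial_residue z M n / (lam q - lam n - z) * h n M else 0)" for n M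
  obtain C where C: "C > 0" "\<And>M n. cmod (partial_residue z M n) \<le> C"
    using partial_residue_bounded by blast
  have H: "H \<ge> 0" using h[of 0 0] norm_ge_zero order_trans by blast
  have tannery: "summable (\<lambda>n. norm (residue z n / (lam q - lam n - z) * g n)) \<and>
      (\<lambda>M. \<Sum>n. a n M) \<longlonglongrightarrow> (\<Sum>n. residue z n / (lam q - lam n - z) * g n)"
  proof (rule tannerys_theorem[THEN conjunct2])
    show "(\<lambda>M. a n M) \<longlonglongrightarrow> residue z n / (lam q - lam n - z) * g n" for n
    proof (rule Lim_transform_eventually)
      show "(\<lambda>M. partial_residue z M n / (lam q - lam n - z) * h n M) \<longlonglongrightarrow> residue z n / (lam q - lam n - z) * g n"
        using nonres[of q n] by (intro tendsto_intros residue_tendsto h_lim) auto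
      show "\<forall>\<^sub>F M in sequentially. partial_residue z M n / (lam q - lam n - z) * h n M = a n M"
        using eventually_gt_at_top[of n] by eventually_elim (simp add: a_def)
    qed
    show "summable (\<lambda>n. C * (1 / cmod (lam q - lam n - z)) * H)"
      by (intro summable_mult2 summable_mult summable_inverse_shifted_gap[OF nonres])
    have "cmod (a n M) \<le> C * (1 / cmod (lam q - lam n - z)) * H" for n M
    proof (cases "n < M")
      case True
      hence "cmod (a n M) = cmod (partial_residue z M n) * (1 / cmod (lam q - lam n - z)) * cmod (h n M)"
        by (simp add: a_def norm_mult norm_divide)
      also have "\<dots> \<le> C * (1 / cmod (lam q - lam n - z)) * H"
        using C by (intro mult_mono h mult_right_mono) auto
      finally show ?thesis .
    qed (use C H in \<open>simp add: a_def\<close>)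
    thus "\<forall>\<^sub>F (n, M) in sequentially \<times>\<^sub>F sequentially. norm (a n M) \<le> C * (1 / cmod (lam q - lam n - z)) * H"
      by (intro always_eventually) auto
  qed simp
  have "(\<Sum>n. a n M) = (\<Sum>n<M. partial_residue z M n / (lam q - lam n - z) * h n M)" for M
    by (subst suminf_finite[of "{..<M}"]) (auto simp: a_def)
  hence "(\<lambda>M. \<Sum>n<M. partial_residue z M n / (lam q - lam n - z) * h n M)
      \<longlonglongrightarrow> (\<Sum>n. residue z n / (lam q - lam n - z) * g n)"
    using tannery by simp
  moreover have "(\<lambda>M. \<Sum>n<M. partial_residue z M n / (lam q - lam n - z) * h n M) \<longlonglongrightarrow> l"
    using fin by (rule tendsto_eventually)
  ultimately have "(\<Sum>n. residue z n / (lam q - lam n - z) * g n) = l" by (rule LIMSEQ_unique)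
  thus ?thesis using summable_sums[OF summable_norm_cancel[OF conjunct1[OF tannery]]] by (simp only:)
qed

text \<open>The factor for \<open>k = q\<close> of \<open>\<Prod>k<M. 1 + z / (w - lam k)\<close> vanishes at \<open>w = lam q - z\<close>.\<close>

lemma residue_sum_one:
  assumes nonres: "\<And>n p. lam p - lam n \<noteq> z"
  shows "(\<lambda>n. residue z n / (lam q - lam n - z)) sums 1"
proof -
  have "\<forall>\<^sub>F M in sequentially. (\<Sum>n<M. partial_residue z M n / (lam q - lam n - z) * 1) = 1"
    using eventually_gt_at_top[of q]
  proof eventually_elim
    fix M assume M: "q < M"
    have ne: "lam q - z \<noteq> lam k" for k using nonres[of q k] by (auto simp: algebra_simps)
    have "(\<Sum>n<M. partial_residue z M n / (lam q - lam n - z) * 1)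
        = (\<Sum>n<M. - z * (\<Prod>k<M. 1 + z / (lam n - lam k)) / ((lam q - z) - lam n))"
      by (simp add: partial_residue_def algebra_simps)
    also have "\<dots> = 1 - (\<Prod>k<M. 1 + z / ((lam q - z) - lam k))"
      by (rule partial_fraction_product) (auto simp: inj_on_def inj_lam ne)
    also have "(\<Prod>k<M. 1 + z / ((lam q - z) - lam k)) = 0"
      using M nonres[of q q] by (intro prod_zero) (auto intro!: bexI[of _ q])
    finally show "(\<Sum>n<M. partial_residue z M n / (lam q - lam n - z) * 1) = 1" by simp
  qed
  from residue_sums_limit[OF nonres _ tendsto_const this, of 1] show ?thesis by simp
qed

text \<open>
  For \<open>q \<noteq> m\<close> the finite products vanish for the same reason. For \<open>q = m\<close> the product that remains is the
  inverse of the one in the residue for \<open>- z\<close>, since \<open>(1 + z / (d - z)) (1 - z / d) = 1\<close>.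
\<close>

lemma residue_orthogonality:
  assumes nonres: "\<And>n p. lam p - lam n \<noteq> z"
  shows "(\<lambda>n. residue z n / (lam q - lam n - z) * (residue (- z) m / (lam n - lam m + z)))
           sums (if q = m then 1 else 0)"
proof -
  have ne: "lam q - z \<noteq> lam k" for q k using nonres[of q k] by (auto simp: algebra_simps)
  have ne2: "lam n - lam p + z \<noteq> 0" for n p using nonres[of p n] by (auto simp: algebra_simps add_eq_0_iff)
  have z: "z \<noteq> 0" using nonres[of 0 0] by auto
  obtain \<delta> where \<delta>: "\<delta> > 0" "\<And>p n. \<delta> * cmod (lam p - lam n) \<le> cmod (lam p - lam n - z)"
    using nonresonant_lower_bound[OF nonres] by blast
  define e where "e = min (cmod z) (\<delta> * c)"
  have e: "e > 0" using \<delta> c z by (simp add: e_def)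
  have lower: "e \<le> cmod (lam n - lam m + z)" for n
  proof (cases "n = m")
    case False
    have "1 * 1 \<le> real (Suc n) powr (\<alpha> - 1) * \<bar>real n - real m\<bar>"
      using False \<alpha> by (intro mult_mono) (auto simp: ge_one_powr_ge_zero)
    hence "c * (1 * 1) \<le> cmod (lam n - lam m)"
      using c gap[of n m] by (metis mult.assoc mult_left_mono order_less_imp_le order_trans)
    hence "\<delta> * c \<le> \<delta> * cmod (lam m - lam n)" using \<delta>(1) by (simp add: norm_minus_commute)
    also have "\<dots> \<le> cmod (lam m - lam n - z)" by (rule \<delta>(2))
    also have "\<dots> = cmod (- (lam n - lam m + z))" by (rule arg_cong[of _ _ cmod]) simp
    finally show ?thesis unfolding norm_minus_cancel e_def by simp
  qed (simp add: e_def)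
  obtain C where C: "C > 0" "\<And>M n. cmod (partial_residue (- z) M n) \<le> C"
    using partial_residue_bounded by blast
  let ?h = "\<lambda>n M. partial_residue (- z) M m / (lam n - lam m + z)"
  have h: "cmod (?h n M) \<le> C / e" for n M
    using lower[of n] e C(2)[of M m] C(1) by (simp add: norm_divide frac_le)
  have h_lim: "?h n \<longlonglongrightarrow> residue (- z) m / (lam n - lam m + z)" for n
    by (intro tendsto_intros residue_tendsto ne2)
  let ?L = "\<lambda>M. - (\<Prod>k\<in>{..<M} - {m}. 1 + z / ((lam q - z) - lam k)) / ((lam q - z) - lam m)"
  have fin: "\<forall>\<^sub>F M in sequentially.
      (\<Sum>n<M. partial_residue z M n / (lam q - lam n - z) * (1 / (lam n - lam m + z))) = ?L M"
    using eventually_gt_at_top[of m]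
  proof eventually_elim
    fix M assume M: "m < M"
    have "(\<Sum>n<M. partial_residue z M n / (lam q - lam n - z) * (1 / (lam n - lam m + z)))
        = (\<Sum>n<M. - z * (\<Prod>k<M. 1 + z / (lam n - lam k)) / (((lam q - z) - lam n) * (lam n - lam m + z)))"
      by (simp add: partial_residue_def algebra_simps)
    also have "\<dots> = ?L M"
      by (rule partial_fraction_product_pole) (auto simp: inj_on_def inj_lam ne ne2 M)
    finally show "(\<Sum>n<M. partial_residue z M n / (lam q - lam n - z) * (1 / (lam n - lam m + z))) = ?L M" .
  qed
  have prod_L: "\<forall>\<^sub>F M in sequentially. ?L M * partial_residue (- z) M m = (if q = m then 1 else 0)"
    using eventually_gt_at_top[of "max q m"]
  proof eventually_elim
    fix M assume M: "max q m < M"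
    show "?L M * partial_residue (- z) M m = (if q = m then 1 else 0)"
    proof (cases "q = m")
      case False
      hence "(\<Prod>k\<in>{..<M} - {m}. 1 + z / ((lam q - z) - lam k)) = 0"
        using M z by (intro prod_zero) (auto intro!: bexI[of _ q])
      thus ?thesis using False by simp
    next
      case True
      have "(\<Prod>k<M. 1 + - z / (lam m - lam k)) = (\<Prod>k\<in>{..<M} - {m}. 1 + - z / (lam m - lam k))"
        using M by (subst prod.remove[of _ m]) auto
      hence "?L M * partial_residue (- z) M m
          = (\<Prod>k\<in>{..<M} - {m}. 1 + z / ((lam m - z) - lam k)) * (\<Prod>k\<in>{..<M} - {m}. 1 + - z / (lam m - lam k))"
        using True z by (simp add: partial_residue_def)
      also have "\<dots> = (\<Prod>k\<in>{..<M} - {m}. (1 + z / ((lam m - z) - lam k)) * (1 + - z / (lam m - lam k)))"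
        by (rule prod.distrib[symmetric])
      also have "\<dots> = (\<Prod>k\<in>{..<M} - {m}. 1)"
      proof (intro prod.cong refl)
        fix k assume "k \<in> {..<M} - {m}"
        hence d: "lam m - lam k \<noteq> 0" "(lam m - z) - lam k \<noteq> 0" using ne[of m k] by (auto simp: inj_lam)
        define d where "d = lam m - lam k"
        have "d \<noteq> 0" "d - z \<noteq> 0" using d by (auto simp: d_def algebra_simps)
        moreover have "(lam m - z) - lam k = d - z" by (simp add: d_def)
        ultimately show "(1 + z / ((lam m - z) - lam k)) * (1 + - z / (lam m - lam k)) = 1"
          unfolding d_def[symmetric] by (simp add: field_simps)
      qed
      finally show ?thesis using True by simp
    qed
  qed
  have "\<forall>\<^sub>F M in sequentially. (\<Sum>n<M. partial_residue z M n / (lam q - lam n - z) * ?h n M) = (if q = m then 1 else 0)"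
    using fin prod_L
  proof eventually_elim
    fix M
    assume 1: "(\<Sum>n<M. partial_residue z M n / (lam q - lam n - z) * (1 / (lam n - lam m + z))) = ?L M"
      and 2: "?L M * partial_residue (- z) M m = (if q = m then 1 else 0)"
    have "(\<Sum>n<M. partial_residue z M n / (lam q - lam n - z) * ?h n M)
        = (\<Sum>n<M. partial_residue z M n / (lam q - lam n - z) * (1 / (lam n - lam m + z))) * partial_residue (- z) M m"
      unfolding sum_distrib_right by (intro sum.cong refl) simp
    thus "(\<Sum>n<M. partial_residue z M n / (lam q - lam n - z) * ?h n M) = (if q = m then 1 else 0)"
      unfolding 1 2 .
  qed
  thus ?thesis by (rule residue_sums_limit[OF nonres h h_lim])
qed

end


context separated_spectrum
begin

section \<open>The backstepping matrix\<close>

text \<open>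
  The matrix of the transformation for the shift \<open>z\<close> and the control vector \<open>b\<close>: its columns solve the operator
  equality on the basis vectors, normalized so that the transformation fixes \<open>b\<close>.
\<close>

definition backstepping_entry :: "(nat \<Rightarrow> complex) \<Rightarrow> complex \<Rightarrow> nat \<Rightarrow> nat \<Rightarrow> complex" where
  "backstepping_entry b z p n = b p * residue z n / (b n * (lam p - lam n - z))"

text \<open>
  Off the diagonal the powers \<open>- \<beta>\<close> of the weights cancel those of \<open>b\<close>, and the loss \<open>\<gamma>\<close> is absorbed by the gap, leaving
  the kernel with \<open>\<theta> = \<alpha> - 1 - \<gamma>\<close>. Transposing the kernel turns the exponent \<open>r - 1/2\<close> into \<open>1/2 - r\<close>, so the two
  bounds on \<open>r\<close> come from the rows and from the columns.
\<close>

lemma backstepping_entry_bounded: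
  fixes b :: "nat \<Rightarrow> complex" and \<beta> \<gamma> r c1 c2 :: real
  assumes nonres: "\<And>n p. lam p - lam n \<noteq> z"
    and c1: "c1 > 0" and lower: "\<And>n. c1 * real (Suc n) powr (- \<beta>) \<le> cmod (b n)"
    and upper: "\<And>n. cmod (b n) \<le> c2 * real (Suc n) powr (- \<beta> + \<gamma>)"
    and \<gamma>: "0 \<le> \<gamma>" "\<gamma> < \<alpha> - 1"
    and r: "1/2 - \<alpha> + \<gamma> < r" "r < \<alpha> - 1/2 - \<gamma>"
  obtains R where
    "\<And>p M. (\<Sum>n<M. cmod (backstepping_entry b z p n) * (real (Suc p) / real (Suc n)) powr (\<beta> + r + 1/2)) \<le> R"
    "\<And>n M. (\<Sum>p<M. cmod (backstepping_entry b z p n) * (real (Suc p) / real (Suc n)) powr (\<beta> + r - 1/2)) \<le> R"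
proof -
  define \<theta> where "\<theta> = \<alpha> - 1 - \<gamma>"
  have \<theta>: "\<theta> > 0" using \<gamma> by (simp add: \<theta>_def)
  obtain \<delta> where \<delta>: "\<delta> > 0" "\<And>p n. \<delta> * cmod (lam p - lam n) \<le> cmod (lam p - lam n - z)"
    using nonresonant_lower_bound[OF nonres] by blast
  obtain C where C: "C > 0" "\<And>n. cmod (residue z n) \<le> C" using residue_bounded by blast
  have z: "z \<noteq> 0" using nonres[of 0 0] by auto
  have c2: "c2 > 0"
  proof -
    have "c1 \<le> c2" using lower[of 0] upper[of 0] by simp
    thus ?thesis using c1 by simp
  qed
  have b: "cmod (b n) > 0" for n
    using lower[of n] mult_pos_pos[OF c1 weight_pos[of n "- \<beta>"]] by linarith
  define D where "D = c2 * C / (c1 * (\<delta> * c))"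
  define E where "E = C / cmod z"
  have D: "D > 0" and E: "E > 0" using c1 c2 C \<delta> c z by (simp_all add: D_def E_def)
  define w where "w p n = max (real (Suc p)) (real (Suc n)) powr (- \<theta>) / \<bar>real p - real n\<bar>" for p n
  have w: "w p n \<ge> 0" for p n by (simp add: w_def)
  have entry: "cmod (backstepping_entry b z p n)
      \<le> D * ((real (Suc p) / real (Suc n)) powr (- \<beta>) * w p n) + (if p = n then E else 0)" for p n
  proof (cases "p = n")
    case True
    have "cmod (backstepping_entry b z p n) = cmod (residue z n) / cmod z"
      using b[of n] True by (simp add: backstepping_entry_def norm_mult norm_divide)
    also have "\<dots> \<le> E" unfolding E_def by (intro divide_right_mono C) simp
    finally show ?thesis using True D w[of n n] by (simp add: add_increasing)
  next
    case False
    let ?P = "real (Suc p)" and ?N = "real (Suc n)"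
    let ?m = "max ?P ?N" and ?k = "\<bar>real p - real n\<bar>"
    have k: "?k > 0" and m: "?m > 0" using False by auto
    have bp: "cmod (b p) \<le> c2 * (?P powr (- \<beta>) * ?m powr \<gamma>)"
    proof -
      have "cmod (b p) \<le> c2 * (?P powr (- \<beta>) * ?P powr \<gamma>)" using upper[of p] by (simp only: powr_add)
      also have "\<dots> \<le> c2 * (?P powr (- \<beta>) * ?m powr \<gamma>)"
        using c2 \<gamma> by (intro mult_left_mono powr_mono2) auto
      finally show ?thesis .
    qed
    have gap': "\<delta> * (c * ?m powr (\<alpha> - 1) * ?k) \<le> cmod (lam p - lam n - z)"
      using order_trans[OF mult_left_mono[OF gap_max less_imp_le[OF \<delta>(1)]] \<delta>(2)] .
    have "cmod (backstepping_entry b z p n) = cmod (b p) * cmod (residue z n) / (cmod (b n) * cmod (lam p - lam n - z))"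
      by (simp add: backstepping_entry_def norm_mult norm_divide)
    also have "\<dots> \<le> (c2 * (?P powr (- \<beta>) * ?m powr \<gamma>)) * C
        / ((c1 * ?N powr (- \<beta>)) * (\<delta> * (c * ?m powr (\<alpha> - 1) * ?k)))"
    proof (rule frac_le)
      show "cmod (b p) * cmod (residue z n) \<le> (c2 * (?P powr (- \<beta>) * ?m powr \<gamma>)) * C"
        using c2 by (intro mult_mono bp C) auto
      show "(c1 * ?N powr (- \<beta>)) * (\<delta> * (c * ?m powr (\<alpha> - 1) * ?k)) \<le> cmod (b n) * cmod (lam p - lam n - z)"
        using \<delta> c by (intro mult_mono lower gap') auto
      show "0 < (c1 * ?N powr (- \<beta>)) * (\<delta> * (c * ?m powr (\<alpha> - 1) * ?k))"
        using c1 \<delta>(1) c k m by (intro mult_pos_pos) (auto simp del: of_nat_Suc)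
    qed (use c2 C in simp)
    also have "\<dots> = D * ((?P powr (- \<beta>) / ?N powr (- \<beta>)) * ((?m powr \<gamma> / ?m powr (\<alpha> - 1)) / ?k))"
      by (simp add: D_def mult_ac del: of_nat_Suc)
    also have "?m powr \<gamma> / ?m powr (\<alpha> - 1) = ?m powr (- \<theta>)"
      unfolding powr_diff[symmetric] by (simp add: \<theta>_def)
    also have "?P powr (- \<beta>) / ?N powr (- \<beta>) = (?P / ?N) powr (- \<beta>)"
      by (rule powr_divide[symmetric])
    finally show ?thesis using False by (simp add: w_def)
  qed
  have weighted: "cmod (backstepping_entry b z p n) * (real (Suc p) / real (Suc n)) powr (\<beta> + t)
      \<le> D * ((real (Suc p) / real (Suc n)) powr t * w p n) + (if p = n then E else 0)" for p n t
  proof -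
    let ?q = "real (Suc p) / real (Suc n)"
    have "cmod (backstepping_entry b z p n) * ?q powr (\<beta> + t)
        \<le> (D * (?q powr (- \<beta>) * w p n) + (if p = n then E else 0)) * ?q powr (\<beta> + t)"
      by (intro mult_right_mono entry) simp
    also have "\<dots> = D * ((?q powr (- \<beta>) * ?q powr (\<beta> + t)) * w p n) + (if p = n then E else 0)"
      by (cases "p = n") (simp_all add: algebra_simps del: of_nat_Suc)
    also have "?q powr (- \<beta>) * ?q powr (\<beta> + t) = ?q powr t" by (simp flip: powr_add del: of_nat_Suc)
    finally show ?thesis .
  qed
  have diag1: "(\<Sum>n<M. if p = n then E else 0) \<le> E" for p M :: nat
    using E by simp
  have diag2: "(\<Sum>n<M. if n = p then E else 0) \<le> E" for p M :: nat
    using E by simp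
  obtain C1 where C1: "C1 > 0" "\<And>p M. (\<Sum>n<M. (real (Suc p) / real (Suc n)) powr (r + 1/2)
      * max (real (Suc p)) (real (Suc n)) powr (- \<theta>) / \<bar>real p - real n\<bar>) \<le> C1"
    by (rule kernel_sum_bounded[OF \<theta>, of "r + 1/2"]) (use r in \<open>auto simp: \<theta>_def\<close>)
  obtain C2 where C2: "C2 > 0" "\<And>p M. (\<Sum>n<M. (real (Suc p) / real (Suc n)) powr (1/2 - r)
      * max (real (Suc p)) (real (Suc n)) powr (- \<theta>) / \<bar>real p - real n\<bar>) \<le> C2"
    by (rule kernel_sum_bounded[OF \<theta>, of "1/2 - r"]) (use r in \<open>auto simp: \<theta>_def\<close>)
  define R where "R = D * C1 + D * C2 + E"
  have "(\<Sum>n<M. cmod (backstepping_entry b z p n) * (real (Suc p) / real (Suc n)) powr (\<beta> + r + 1/2)) \<le> R" for p M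
  proof -
    have "(\<Sum>n<M. cmod (backstepping_entry b z p n) * (real (Suc p) / real (Suc n)) powr (\<beta> + r + 1/2))
        \<le> (\<Sum>n<M. D * ((real (Suc p) / real (Suc n)) powr (r + 1/2) * w p n) + (if p = n then E else 0))"
      unfolding add.assoc[of \<beta>] by (intro sum_mono weighted)
    also have "\<dots> = D * (\<Sum>n<M. (real (Suc p) / real (Suc n)) powr (r + 1/2) * w p n) + (\<Sum>n<M. if p = n then E else 0)"
      by (simp only: sum.distrib sum_distrib_left)
    also have "\<dots> \<le> D * C1 + E"
      using C1(2)[of p M] D unfolding w_def times_divide_eq_right by (intro add_mono mult_left_mono diag1) auto
    also have "\<dots> \<le> R" using D C2(1) by (simp add: R_def)
    finally show ?thesis .
  qed
  moreover have "(\<Sum>p<M. cmod (backstepping_entry b z p n) * (real (Suc p) / real (Suc n)) powr (\<beta> + r - 1/2)) \<le> R" for n M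
  proof -
    have flip: "(real (Suc p) / real (Suc n)) powr (r - 1/2) * w p n
        = (real (Suc n) / real (Suc p)) powr (1/2 - r) * w n p" for p
    proof -
      have "(real (Suc p) / real (Suc n)) powr (r - 1/2) = inverse (real (Suc p) / real (Suc n)) powr (- (r - 1/2))"
        by (simp only: inverse_powr powr_minus inverse_inverse_eq)
      thus ?thesis by (simp add: w_def max.commute abs_minus_commute del: of_nat_Suc)
    qed
    have "(\<Sum>p<M. cmod (backstepping_entry b z p n) * (real (Suc p) / real (Suc n)) powr (\<beta> + r - 1/2))
        \<le> (\<Sum>p<M. D * ((real (Suc p) / real (Suc n)) powr (r - 1/2) * w p n) + (if p = n then E else 0))"
      unfolding add_diff_eq[symmetric] by (intro sum_mono weighted)
    also have "\<dots> = D * (\<Sum>p<M. (real (Suc n) / real (Suc p)) powr (1/2 - r) * w n p) + (\<Sum>p<M. if p = n then E else 0)"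
      unfolding flip by (simp only: sum.distrib sum_distrib_left)
    also have "\<dots> \<le> D * C2 + E"
      using C2(2)[of n M] D unfolding w_def times_divide_eq_right by (intro add_mono mult_left_mono diag2) auto
    also have "\<dots> \<le> R" using D C1(1) by (simp add: R_def)
    finally show ?thesis .
  qed
  ultimately show ?thesis by (rule that)
qed

lemma backstepping_entry_inverse:
  assumes nonres: "\<And>n p. lam p - lam n \<noteq> z" and b: "\<And>n. b n \<noteq> 0"
  shows "(\<lambda>n. backstepping_entry b z q n * backstepping_entry b (- z) n m) sums (if q = m then 1 else 0)"
proof -
  have "(\<lambda>n. b q / b m * (residue z n / (lam q - lam n - z) * (residue (- z) m / (lam n - lam m + z))))
      sums (b q / b m * (if q = m then 1 else 0))"
    by (intro sums_mult residue_orthogonality nonres)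
  also have "(\<lambda>n. b q / b m * (residue z n / (lam q - lam n - z) * (residue (- z) m / (lam n - lam m + z))))
      = (\<lambda>n. backstepping_entry b z q n * backstepping_entry b (- z) n m)"
    using b by (simp add: backstepping_entry_def fun_eq_iff)
  also have "b q / b m * (if q = m then 1 else 0) = (if q = m then 1 else 0)" using b by simp
  finally show ?thesis .
qed

end


section \<open>The backstepping pair\<close>

lemma bounded_clinear_id: "bounded_clinear_on V N V N (\<lambda>f. f)"
  unfolding bounded_clinear_on_def by (auto intro: exI[of _ 1])

text \<open>Cauchy-Schwarz against \<open>n\<^sup>-\<^sup>a\<^sup>/\<^sup>2\<close>, which is square summable as \<open>a > 1\<close>.\<close>

lemma feedback_component_bounded:
  fixes f :: "'i::finite \<Rightarrow> nat \<Rightarrow> complex"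
  assumes a: "a > 1" and f: "f \<in> hspace s" and s: "s $ i = b + a / 2"
    and k: "\<And>n. cmod (k n) \<le> C * real (Suc n) powr b" and C: "C \<ge> 0"
  shows "summable (\<lambda>n. cmod (k n * f i n))"
    and "(\<Sum>n. cmod (k n * f i n)) \<le> C * sqrt (\<Sum>n. real (Suc n) powr (- a)) * hnorm s f"
proof -
  define Z where "Z = (\<Sum>n. real (Suc n) powr (- a))"
  have sZ: "summable (\<lambda>n. real (Suc n) powr (- a))"
    using a summable_real_powr_iff[of "- a"] by (subst summable_Suc_iff) simp
  let ?x = "\<lambda>n. real (Suc n) powr (s $ i) * cmod (f i n)"
  have sx: "summable (\<lambda>n. (?x n)\<^sup>2)" using f by (simp only: hspace_iff)
  have bound: "(\<Sum>n<M. cmod (k n * f i n)) \<le> C * sqrt Z * hnorm s f" for M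
  proof -
    have "cmod (k n * f i n) \<le> C * (real (Suc n) powr (- a / 2) * ?x n)" for n
    proof -
      have "cmod (k n * f i n) \<le> C * real (Suc n) powr b * cmod (f i n)"
        unfolding norm_mult by (intro mult_right_mono k) simp
      also have "real (Suc n) powr b = real (Suc n) powr (- a / 2) * real (Suc n) powr (s $ i)"
        unfolding powr_add[symmetric] s by simp
      finally show ?thesis by (simp only: mult.assoc)
    qed
    hence "(\<Sum>n<M. cmod (k n * f i n)) \<le> C * (\<Sum>n<M. real (Suc n) powr (- a / 2) * ?x n)"
      unfolding sum_distrib_left by (rule sum_mono)
    also have "(\<Sum>n<M. real (Suc n) powr (- a / 2) * ?x n) \<le> sqrt Z * hnorm s f"
    proof (rule power2_le_imp_le)
      have "(\<Sum>n<M. real (Suc n) powr (- a / 2) * ?x n)\<^sup>2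
          \<le> (\<Sum>n<M. (real (Suc n) powr (- a / 2))\<^sup>2) * (\<Sum>n<M. (?x n)\<^sup>2)"
        by (rule Cauchy_Schwarz_ineq_sum)
      also have "\<dots> \<le> Z * (hnorm s f)\<^sup>2"
      proof (intro mult_mono)
        have "(\<Sum>n<M. (real (Suc n) powr (- a / 2))\<^sup>2) = (\<Sum>n<M. real (Suc n) powr (- a))"
          by (intro sum.cong refl) (simp add: power2_eq_square flip: powr_add)
        also have "\<dots> \<le> Z" unfolding Z_def by (rule sum_le_suminf[OF sZ]) auto
        finally show "(\<Sum>n<M. (real (Suc n) powr (- a / 2))\<^sup>2) \<le> Z" .
        have "(\<Sum>n<M. (?x n)\<^sup>2) \<le> (\<Sum>n. (?x n)\<^sup>2)" by (rule sum_le_suminf[OF sx]) auto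
        also have "\<dots> \<le> (\<Sum>j\<in>UNIV. \<Sum>n. (real (Suc n) powr (s $ j) * cmod (f j n))\<^sup>2)"
          using f unfolding hspace_iff by (intro member_le_sum suminf_nonneg) auto
        also have "\<dots> = (hnorm s f)\<^sup>2" by (rule hnorm_sq[OF f, symmetric])
        finally show "(\<Sum>n<M. (?x n)\<^sup>2) \<le> (hnorm s f)\<^sup>2" .
      qed (auto simp: Z_def simp del: of_nat_Suc intro!: suminf_nonneg sZ sum_nonneg)
      also have "\<dots> = (sqrt Z * hnorm s f)\<^sup>2"
        by (simp add: power_mult_distrib Z_def suminf_nonneg[OF sZ] del: of_nat_Suc)
      finally show "(\<Sum>n<M. real (Suc n) powr (- a / 2) * ?x n)\<^sup>2 \<le> (sqrt Z * hnorm s f)\<^sup>2" .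
    qed (auto simp: Z_def simp del: of_nat_Suc intro!: mult_nonneg_nonneg hnorm_nonneg[OF f] real_sqrt_ge_zero suminf_nonneg sZ)
    finally show ?thesis using C by (simp add: mult_left_mono mult.assoc)
  qed
  show sum: "summable (\<lambda>n. cmod (k n * f i n))"
    by (rule summableI_nonneg_bounded[OF _ bound]) simp
  show "(\<Sum>n. cmod (k n * f i n)) \<le> C * sqrt Z * hnorm s f"
    by (rule suminf_le_const[OF sum bound])
qed

text \<open>
  The feedback has the coefficients \<open>\<kappa>\<^sub>n / B\<^sub>n\<close>, which grow at most like \<open>n\<^sup>\<beta>\<close>. The transformation is inverted by the
  matrix for \<open>- l\<close>: this holds on basis vectors and extends by density. In the operator equality the control
  term is computed in two ways, as \<open>T B = B\<close> and by expanding \<open>k\<^sub>n B\<^sub>p = T\<^sub>p\<^sub>n (lam p - lam n - l)\<close>.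
\<close>

lemma backstepping_exists:
  fixes lam B :: "'i::finite \<Rightarrow> nat \<Rightarrow> complex" and \<alpha> \<beta> \<gamma> :: "real^'i"
  assumes sep: "\<And>i. separated_spectrum (lam i) (\<alpha> $ i) c"
    and upper_lam: "\<And>i n. cmod (lam i n) + 1 \<le> C * real (Suc n) powr (\<alpha> $ i)"
    and \<gamma>: "\<And>i. \<gamma> $ i \<in> {0 ..< (\<alpha> $ i - 1) / 2}"
    and B_space: "\<And>i. B i \<in> hcomp (\<beta> $ i - \<alpha> $ i / 2)"
    and c1: "c1 > 0" and lower: "\<And>i n. c1 * real (Suc n) powr (- \<beta> $ i) \<le> cmod (B i n)"
    and upper: "\<And>i n. cmod (B i n) \<le> c2 * real (Suc n) powr (- \<beta> $ i + \<gamma> $ i)"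
    and nonres: "\<And>i n p. lam i p - lam i n \<noteq> of_real l"
  shows "\<exists>K T. backstepping_pair lam B \<alpha> \<beta> \<gamma> l K T"
proof -
  interpret sep: separated_spectrum "lam i" "\<alpha> $ i" c for i by (rule sep)
  define a where "a z i p n = sep.backstepping_entry i (B i) z p n" for z i p n
  define z where "z = complex_of_real l"
  define k where "k i n = sep.residue i z n / B i n" for i n
  define K where "K f = (\<chi> i. \<Sum>n. k i n * f i n)" for f :: "'i \<Rightarrow> nat \<Rightarrow> complex"
  define s where "s = \<beta> + (1/2) *\<^sub>R \<alpha>"
  define s' where "s' = \<beta> - (1/2) *\<^sub>R \<alpha>"
  have \<alpha>: "\<alpha> $ i > 1" for i by (rule sep.\<alpha>)
  have nonres_z: "lam i p - lam i n \<noteq> z" for i n p using nonres by (simp add: z_def)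
  have nonres_mz: "lam i p - lam i n \<noteq> - z" for i n p
    using nonres_z[of i n p] by (metis minus_diff_eq minus_minus)
  have B0: "B i n \<noteq> 0" for i n
    using lower[where i = i and n = n] mult_pos_pos[OF c1 weight_pos[of n "- \<beta> $ i"]] by auto
  have \<gamma>_le: "0 \<le> \<gamma> $ i" "\<gamma> $ i < \<alpha> $ i - 1" "\<gamma> $ i < \<alpha> $ i / 2 - 1/2" for i
    using \<gamma>[of i] \<alpha>[of i] by (auto simp: diff_divide_distrib)

  have bounded: "bounded_clinear_on (hspace (\<beta> + r)) (hnorm (\<beta> + r)) (hspace (\<beta> + r)) (hnorm (\<beta> + r)) (matrix_op (a x))"
      "\<And>f i p. f \<in> hspace (\<beta> + r) \<Longrightarrow> summable (\<lambda>n. cmod (a x i p n * f i n))"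
    if r: "r \<in> admissible_shifts \<alpha> \<gamma>" and x: "\<And>i n p. lam i p - lam i n \<noteq> x" for r x
  proof -
    define Q where "Q i R \<longleftrightarrow>
        (\<forall>p M. (\<Sum>n<M. cmod (a x i p n) * (real (Suc p) / real (Suc n)) powr ((\<beta> + r) $ i + 1/2)) \<le> R) \<and>
        (\<forall>n M. (\<Sum>p<M. cmod (a x i p n) * (real (Suc p) / real (Suc n)) powr ((\<beta> + r) $ i - 1/2)) \<le> R)" for i R
    have "\<exists>R. Q i R" for i
    proof -
      have ri: "1/2 - \<alpha> $ i + \<gamma> $ i < r $ i" "r $ i < \<alpha> $ i - 1/2 - \<gamma> $ i"
        using r by (auto simp: admissible_shifts_def)
      show ?thesis
        by (rule sep.backstepping_entry_bounded[OF x c1 lower upper \<gamma>_le(1,2) ri])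
           (auto simp only: Q_def a_def vector_add_component)
    qed
    then obtain R where "\<And>i. Q i (R i)" by metis
    hence R:
      "\<And>i p M. (\<Sum>n<M. cmod (a x i p n) * (real (Suc p) / real (Suc n)) powr ((\<beta> + r) $ i + 1/2)) \<le> R i"
      "\<And>i n M. (\<Sum>p<M. cmod (a x i p n) * (real (Suc p) / real (Suc n)) powr ((\<beta> + r) $ i - 1/2)) \<le> R i"
      unfolding Q_def by blast+
    have R_le: "R i \<le> (\<Sum>i\<in>UNIV. R i)" for i
      using R(1)[where M = 0] by (intro member_le_sum) auto
    note bounds = matrix_op_bounded[of "a x" "\<beta> + r" "\<Sum>i\<in>UNIV. R i", OF order_trans[OF R(1) R_le] order_trans[OF R(2) R_le]]
    show "bounded_clinear_on (hspace (\<beta> + r)) (hnorm (\<beta> + r)) (hspace (\<beta> + r)) (hnorm (\<beta> + r)) (matrix_op (a x))"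
      by (rule bounds(1))
    show "\<And>f i p. f \<in> hspace (\<beta> + r) \<Longrightarrow> summable (\<lambda>n. cmod (a x i p n * f i n))"
      by (rule bounds(2))
  qed

  have inverse: "matrix_op (a x) (matrix_op (a (- x)) f) = f"
    if r: "r \<in> admissible_shifts \<alpha> \<gamma>" and x: "\<And>i n p. lam i p - lam i n \<noteq> x"
      and mx: "\<And>i n p. lam i p - lam i n \<noteq> - x" and f: "f \<in> hspace (\<beta> + r)" for r x f
  proof -
    note comp = bounded_clinear_comp[OF bounded(1)[OF r mx] bounded(1)[OF r x] hnorm_nonneg]
    have "matrix_op (a x) (matrix_op (a (- x)) (unit_series i m)) = unit_series i m" for i m
    proof (intro ext)
      fix j q
      have "(\<lambda>n. a x i q n * a (- x) i n m) sums (if q = m then 1 else 0)"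
        unfolding a_def by (rule sep.backstepping_entry_inverse[OF x B0])
      thus "matrix_op (a x) (matrix_op (a (- x)) (unit_series i m)) j q = unit_series i m j q"
        unfolding matrix_op_unit_series
        by (cases "j = i") (simp_all add: matrix_op_def unit_series_def sums_iff)
    qed
    from truncation_eq_on_units[OF comp bounded_clinear_id this] show ?thesis
      by (intro bounded_clinear_eqI[OF comp bounded_clinear_id _ f])
  qed

  have iso: "isomorphism_on (hspace (\<beta> + r)) (hnorm (\<beta> + r)) (hspace (\<beta> + r)) (hnorm (\<beta> + r)) (matrix_op (a z))"
    if r: "r \<in> admissible_shifts \<alpha> \<gamma>" for r
    unfolding isomorphism_on_def
  proof (intro conjI exI[of _ "matrix_op (a (- z))"] ballI)
    show "bounded_clinear_on (hspace (\<beta> + r)) (hnorm (\<beta> + r)) (hspace (\<beta> + r)) (hnorm (\<beta> + r)) (matrix_op (a z))"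
      by (rule bounded(1)[OF r nonres_z])
    show "bounded_clinear_on (hspace (\<beta> + r)) (hnorm (\<beta> + r)) (hspace (\<beta> + r)) (hnorm (\<beta> + r)) (matrix_op (a (- z)))"
      by (rule bounded(1)[OF r nonres_mz])
    fix f assume f: "f \<in> hspace (\<beta> + r)"
    show "matrix_op (a z) (matrix_op (a (- z)) f) = f" by (rule inverse[OF r nonres_z nonres_mz f])
    show "matrix_op (a (- z)) (matrix_op (a z) f) = f"
      using inverse[OF r, of "- z" f] nonres_z nonres_mz f by simp
  qed

  have "\<exists>D. \<forall>n. cmod (sep.residue i z n) \<le> D" for i using sep.residue_bounded by metis
  then obtain D where D: "\<And>i n. cmod (sep.residue i z n) \<le> D i" by metis
  have D0: "D i \<ge> 0" for i using D[of i 0] norm_ge_zero order_trans by blast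
  have k: "cmod (k i n) \<le> D i / c1 * real (Suc n) powr (\<beta> $ i)" for i n
  proof -
    have "cmod (k i n) \<le> D i / (c1 * real (Suc n) powr (- \<beta> $ i))"
      unfolding k_def norm_divide using c1 D0
      by (intro frac_le D lower mult_pos_pos) auto
    also have "\<dots> = D i / c1 * real (Suc n) powr (\<beta> $ i)" by (simp add: powr_minus divide_inverse del: of_nat_Suc)
    finally show ?thesis .
  qed
  have si: "s $ i = \<beta> $ i + \<alpha> $ i / 2" for i by (simp add: s_def)
  have K_sum: "summable (\<lambda>n. cmod (k i n * f i n))" if "f \<in> hspace s" for f i
    using feedback_component_bounded(1)[OF \<alpha> that si k] c1 D0 by simp
  have K_conv: "summable (\<lambda>n. k i n * f i n)" if "f \<in> hspace s" for f i
    by (rule summable_norm_cancel[OF K_sum[OF that]])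
  have K: "bounded_feedback s K"
    unfolding bounded_feedback_def bounded_clinear_on_def
  proof (intro conjI ballI allI exI, rule UNIV_I)
    fix f assume f: "f \<in> hspace s"
    have "norm (K f) \<le> (\<Sum>i\<in>UNIV. norm (K f $ i))"
      unfolding norm_vec_def by (rule L2_set_le_sum) simp
    also have "\<dots> \<le> (\<Sum>i\<in>UNIV. D i / c1 * sqrt (\<Sum>n. real (Suc n) powr (- \<alpha> $ i)) * hnorm s f)"
    proof (rule sum_mono)
      fix i
      have "norm (K f $ i) \<le> (\<Sum>n. cmod (k i n * f i n))"
        unfolding K_def by (simp add: summable_norm[OF K_sum[OF f]])
      also have "\<dots> \<le> D i / c1 * sqrt (\<Sum>n. real (Suc n) powr (- \<alpha> $ i)) * hnorm s f"
        using feedback_component_bounded(2)[OF \<alpha> f si k] c1 D0 by simp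
      finally show "norm (K f $ i) \<le> \<dots>" .
    qed
    finally show "norm (K f) \<le> (\<Sum>i\<in>UNIV. D i / c1 * sqrt (\<Sum>n. real (Suc n) powr (- \<alpha> $ i))) * hnorm s f"
      by (simp only: sum_distrib_right)
    show "K (x *\<^sub>C f) = x *\<^sub>C K f" for x
      by (simp add: K_def vec_eq_iff scaleC_vec_def scaleC_complex_def
          suminf_mult[OF K_conv[OF f], symmetric] mult.left_commute)
    fix g assume g: "g \<in> hspace s"
    show "K (f + g) = K f + K g"
      by (simp add: K_def vec_eq_iff suminf_add[OF K_conv[OF f] K_conv[OF g]] distrib_left)
  qed

  \<comment> \<open>Both spaces in the operator equality belong to admissible shifts, so the series of \<open>T\<close> converge there.\<close>
  have shifts: "(1/2) *\<^sub>R \<alpha> \<in> admissible_shifts \<alpha> \<gamma>" "- ((1/2) *\<^sub>R \<alpha>) \<in> admissible_shifts \<alpha> \<gamma>"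
    using \<gamma>_le \<alpha> unfolding admissible_shifts_def
    by (auto simp: field_simps; smt (verit) field_sum_of_halves)+
  have s'_eq: "s' = \<beta> + - ((1/2) *\<^sub>R \<alpha>)" by (simp add: s'_def)
  have B: "B \<in> hspace s'" using B_space by (simp add: hspace_def s'_def)
  have lam: "bounded_clinear_on (hspace s) (hnorm s) (hspace s') (hnorm s') (diag_op lam)"
  proof (rule diag_op_bounded[of "\<bar>C\<bar>"])
    fix i n
    have "C * real (Suc n) powr (\<alpha> $ i) \<le> \<bar>C\<bar> * real (Suc n) powr (\<alpha> $ i)" by (intro mult_right_mono) auto
    hence "cmod (lam i n) \<le> \<bar>C\<bar> * real (Suc n) powr (\<alpha> $ i)" using upper_lam[of i n] by linarith
    thus "cmod (lam i n) \<le> \<bar>C\<bar> * real (Suc n) powr (s $ i - s' $ i)" by (simp add: s_def s'_def)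
  qed simp
  have maps: "maps_system lam B K l s s' (matrix_op (a z))"
    unfolding maps_system_def
  proof (intro ballI conjI)
    fix f assume f: "f \<in> hspace s"
    have lf: "diag_op lam f \<in> hspace s'" by (rule bounded_clinear_in[OF lam f])
    show "matrix_op (a z) (diag_op lam f + control_op B (K f)) \<in> hspace s'"
      using bounded(1)[OF shifts(2) nonres_z] unfolding s'_eq[symmetric]
      by (rule bounded_clinear_in) (intro hspace_add lf control_op_in_hspace[OF B])
    show "matrix_op (a z) (diag_op lam f + control_op B (K f))
        = diag_op lam (matrix_op (a z) f) - complex_of_real l *\<^sub>C matrix_op (a z) f"
    proof (intro ext)
      fix i p
      have S1: "summable (\<lambda>n. a z i p n * f i n)"
        using bounded(2)[OF shifts(1) nonres_z, folded s_def, OF f] by (rule summable_norm_cancel)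
      have S2: "summable (\<lambda>n. a z i p n * (lam i n * f i n))"
        using bounded(2)[OF shifts(2) nonres_z, folded s'_eq, OF lf, of i p]
        by - (rule summable_norm_cancel, simp add: diag_op_def)
      have one: "(\<lambda>n. a z i p n * B i n) sums B i p"
      proof -
        have "(\<lambda>n. B i p * (sep.residue i z n / (lam i p - lam i n - z))) sums (B i p * 1)"
          by (intro sums_mult sep.residue_sum_one nonres_z)
        also have "(\<lambda>n. B i p * (sep.residue i z n / (lam i p - lam i n - z))) = (\<lambda>n. a z i p n * B i n)"
          using B0 by (simp add: a_def sep.backstepping_entry_def fun_eq_iff)
        finally show ?thesis by simp
      qed
      have control: "B i p * (K f $ i) = (\<Sum>n. (lam i p - z) * (a z i p n * f i n) - a z i p n * (lam i n * f i n))"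
      proof -
        have "B i p * (K f $ i) = (\<Sum>n. B i p * (k i n * f i n))"
          by (simp add: K_def suminf_mult[OF K_conv[OF f]])
        also have "(\<lambda>n. B i p * (k i n * f i n)) = (\<lambda>n. (lam i p - z) * (a z i p n * f i n) - a z i p n * (lam i n * f i n))"
        proof
          fix n
          have "lam i p - lam i n - z \<noteq> 0" using nonres_z by simp
          hence "B i p * k i n = a z i p n * (lam i p - lam i n - z)"
            using B0 by (simp add: a_def sep.backstepping_entry_def k_def)
          hence "B i p * (k i n * f i n) = a z i p n * (lam i p - lam i n - z) * f i n"
            by (simp only: mult.assoc[symmetric])
          thus "B i p * (k i n * f i n) = (lam i p - z) * (a z i p n * f i n) - a z i p n * (lam i n * f i n)"
            by (simp add: algebra_simps)
        qed
        finally show ?thesis .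
      qed
      have "matrix_op (a z) (diag_op lam f + control_op B (K f)) i p
          = (\<Sum>n. a z i p n * (lam i n * f i n) + (a z i p n * B i n) * (K f $ i))"
        by (simp add: matrix_op_def diag_op_def control_op_def algebra_simps)
      also have "\<dots> = (\<Sum>n. a z i p n * (lam i n * f i n)) + B i p * (K f $ i)"
        using one S2 by (intro sums_unique[symmetric] sums_add sums_mult2) auto
      also have "B i p * (K f $ i) = (lam i p - z) * (\<Sum>n. a z i p n * f i n) - (\<Sum>n. a z i p n * (lam i n * f i n))"
        unfolding control by (subst suminf_diff[symmetric]) (simp_all add: S1 S2 summable_mult suminf_mult)
      finally show "matrix_op (a z) (diag_op lam f + control_op B (K f)) i p
          = (diag_op lam (matrix_op (a z) f) - complex_of_real l *\<^sub>C matrix_op (a z) f) i p"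
        by (simp add: diag_op_def matrix_op_def z_def left_diff_distrib)
    qed
  qed
  have "backstepping_pair lam B \<alpha> \<beta> \<gamma> l K (matrix_op (a z))"
    unfolding backstepping_pair_def using K iso maps by (simp add: s_def s'_def)
  thus ?thesis by blast
qed

lemma nonresonant_shift_exists:
  fixes lam :: "'i::finite \<Rightarrow> nat \<Rightarrow> complex"
  obtains l where "l > l0" "\<And>i n p. lam i p - lam i n \<noteq> complex_of_real l"
proof -
  define N where "N = (\<Union>i. \<Union>p. range (\<lambda>n. Re (lam i p - lam i n)))"
  have "countable N" unfolding N_def by (intro countable_UN countable_image countableI_type)
  hence "uncountable ({l0<..<l0 + 1} - N)"
    by (intro uncountable_minus_countable) (simp_all add: uncountable_open_interval)
  hence "{l0<..<l0 + 1} - N \<noteq> {}" by (metis countable_empty)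
  then obtain l where l: "l \<in> {l0<..<l0 + 1}" "l \<notin> N" by blast
  have "lam i p - lam i n \<noteq> complex_of_real l" for i n p
  proof
    assume "lam i p - lam i n = complex_of_real l"
    hence "Re (lam i p - lam i n) = l" by simp
    thus False using l(2) by (auto simp: N_def)
  qed
  thus ?thesis using that l(1) by auto
qed

theorem theorem3p3:
  fixes D :: "'x::complex_hilbert set"
    and A :: "'x \<Rightarrow> 'x"
    and \<phi> :: "'i::finite \<Rightarrow> nat \<Rightarrow> 'x"
    and lam :: "'i \<Rightarrow> nat \<Rightarrow> complex"
    and \<alpha> \<beta> \<gamma> :: "real^'i"
    and B :: "'i \<Rightarrow> nat \<Rightarrow> complex"
  assumes diag: "diagonalizable D A \<phi> lam"
    and alpha: "\<And>i. \<alpha> $ i > 1"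
    and eigenvalues: "\<exists>c>0. \<exists>C>0. \<forall>i n p.
          c * real (Suc n) powr (\<alpha> $ i) \<le> cmod (lam i n) + 1 \<and>
          cmod (lam i n) + 1 \<le> C * real (Suc n) powr (\<alpha> $ i) \<and>
          cmod (lam i n - lam i p) \<ge> c * real (Suc n) powr (\<alpha> $ i - 1) * \<bar>real n - real p\<bar>"
    and gamma: "\<And>i. \<gamma> $ i \<in> {0 ..< (\<alpha> $ i - 1) / 2}"
    and B_space: "\<And>i. B i \<in> hcomp (\<beta> $ i - \<alpha> $ i / 2)"
    and B_bounds: "\<exists>c1>0. \<exists>c2>0. \<forall>i n.
          c1 * real (Suc n) powr (- \<beta> $ i) \<le> cmod (B i n) \<and>
          cmod (B i n) \<le> c2 * real (Suc n) powr (- \<beta> $ i + \<gamma> $ i)"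
  shows "(\<forall>l0>0. \<exists>l>l0. \<exists>K T. backstepping_pair lam B \<alpha> \<beta> \<gamma> l K T) \<and>
         (\<forall>\<mu>>0. \<exists>l0>0. \<forall>l>l0. \<forall>K T. backstepping_pair lam B \<alpha> \<beta> \<gamma> l K T \<longrightarrow>
            (\<forall>r\<in>admissible_shifts \<alpha> \<gamma>.
               exponentially_stable (hspace (\<beta> + r)) (hnorm (\<beta> + r))
                 (closed_loop_domain lam B (\<beta> + (1/2) *\<^sub>R \<alpha>) K (\<beta> + r))
                 (closed_loop lam B (\<beta> + (1/2) *\<^sub>R \<alpha>) K) \<mu>))"
proof -
  obtain c C where c: "c > 0" and ev: "\<And>i n p. c * real (Suc n) powr (\<alpha> $ i) \<le> cmod (lam i n) + 1"
      "\<And>i n p. cmod (lam i n) + 1 \<le> C * real (Suc n) powr (\<alpha> $ i)"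
      "\<And>i n p. cmod (lam i n - lam i p) \<ge> c * real (Suc n) powr (\<alpha> $ i - 1) * \<bar>real n - real p\<bar>"
    using eigenvalues by blast
  obtain c1 c2 where c1: "c1 > 0" and lower: "\<And>i n. c1 * real (Suc n) powr (- \<beta> $ i) \<le> cmod (B i n)"
      and upper: "\<And>i n. cmod (B i n) \<le> c2 * real (Suc n) powr (- \<beta> $ i + \<gamma> $ i)"
    using B_bounds by blast
  have sep: "separated_spectrum (lam i) (\<alpha> $ i) c" for i
    by (unfold_locales) (use alpha c ev in auto)
  have B0: "B i 0 \<noteq> 0" for i
  proof -
    have "c1 \<le> cmod (B i 0)" using lower[of 0 i] by simp
    thus ?thesis using c1 by auto
  qed
  obtain \<omega> where \<omega>: "\<And>i n. Re (lam i n) \<le> \<omega>" using spectral_bound[OF diag] by blast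
  show ?thesis
  proof (intro conjI allI impI)
    fix l0 :: real
    obtain l where "l > l0" and nonres: "\<And>i n p. lam i p - lam i n \<noteq> complex_of_real l"
      using nonresonant_shift_exists by blast
    thus "\<exists>l>l0. \<exists>K T. backstepping_pair lam B \<alpha> \<beta> \<gamma> l K T"
      using backstepping_exists[OF sep ev(2) gamma B_space c1 lower upper nonres] by blast
  next
    fix \<mu> :: real assume \<mu>: "\<mu> > 0"
    show "\<exists>l0>0. \<forall>l>l0. \<forall>K T. backstepping_pair lam B \<alpha> \<beta> \<gamma> l K T \<longrightarrow>
        (\<forall>r\<in>admissible_shifts \<alpha> \<gamma>.
           exponentially_stable (hspace (\<beta> + r)) (hnorm (\<beta> + r))
             (closed_loop_domain lam B (\<beta> + (1/2) *\<^sub>R \<alpha>) K (\<beta> + r))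
             (closed_loop lam B (\<beta> + (1/2) *\<^sub>R \<alpha>) K) \<mu>)"
    \<comment> \<open>Beyond \<open>\<omega> + \<mu>\<close> every entry of \<open>\<Lambda> - l\<close> has real part below \<open>- \<mu>\<close>.\<close>
    proof (intro exI[of _ "max 1 (\<omega> + \<mu>)"] conjI allI impI ballI)
      fix l K T r
      assume l: "max 1 (\<omega> + \<mu>) < l" and pair: "backstepping_pair lam B \<alpha> \<beta> \<gamma> l K T"
        and r: "r \<in> admissible_shifts \<alpha> \<gamma>"
      have "Re (lam i n) + \<mu> \<le> l" for i n using \<omega>[of i n] l by simp
      thus "exponentially_stable (hspace (\<beta> + r)) (hnorm (\<beta> + r))
             (closed_loop_domain lam B (\<beta> + (1/2) *\<^sub>R \<alpha>) K (\<beta> + r))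
             (closed_loop lam B (\<beta> + (1/2) *\<^sub>R \<alpha>) K) \<mu>"
        using l by (intro closed_loop_stable[OF alpha c ev(1,2) gamma B_space B0 \<mu> _ _ pair r]) auto
    qed simp
  qed
qed

end
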